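(* Let $N\ge 1$ be an integer and let $0<s<1$, $N>2s$, $0<\mu<N$, $p,q>0$. Let $u$ be a positive punctured solution of $$(-\Delta)^s u=\mathcal H_{p,\mu}[u]\,u^q\quad\text{in }\mathbb R^N\setminus\{0\},$$ and set $F=\mathcal H_{p,\mu}[u]\,u^q$ on $\mathbb R^N\setminus\{0\}$ (with any value assigned at the origin). Assume that $$\int_{\mathbb R^N}\frac{F(y)}{1+|y|^{N-2s}}\,dy<+\infty$$ and that $$\limsup_{x\to0}|x|^{N-2s}u(x)<+\infty .$$ Define $$V(x)=c_{N,s}\int_{\mathbb R^N}\frac{F(y)}{|x-y|^{N-2s}}\,dy,\qquad x\in\mathbb R^N\setminus\{0\}.$$ Then there exists $m\ge0$ such that $$u(x)=V(x)+m\,\Phi_s(x)\qquad\text{for every }x\in\mathbb R^N\setminus\{0\}.$$ Consequently, $(-\Delta)^s u=F+m\delta_0$ in $\mathcal D'(\mathbb R^N)$.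
   Context: Notation. $\mathcal H_{p,\mu}[u](x)=\int_{\mathbb R^N\setminus\{0\}}\frac{u^p(y)}{|x-y|^\mu}\,dy$. $\mathcal L_s(\mathbb R^N)=\{u\in L^1_{\rm loc}(\mathbb R^N):\int_{\mathbb R^N}\frac{|u(x)|}{1+|x|^{N+2s}}\,dx<+\infty\}$. Fourier convention: $\widehat f(\xi)=\int e^{-ix\cdot\xi}f(x)\,dx$ and $\widehat{(-\Delta)^s\varphi}(\xi)=|\xi|^{2s}\widehat\varphi(\xi)$. For $u\in\mathcal L_s(\mathbb R^N)$ sufficiently regular near $x$, pointwise $(-\Delta)^su(x)=C_{N,s}\,\mathrm{P.V.}\int_{\mathbb R^N}\frac{u(x)-u(y)}{|x-y|^{N+2s}}\,dy$, with the positive constant $C_{N,s}$ compatible with this Fourier normalization. For $u\in\mathcal L_s(\mathbb R^N)$, the distribution $(-\Delta)^su$ is defined by $\langle(-\Delta)^su,\varphi\rangle=\int_{\mathbb R^N} u\,(-\Delta)^s\varphi\,dx$ for $\varphi\in C_c^\infty(\mathbb R^N)$. $c_{N,s}=\frac{\Gamma(\frac{N-2s}{2})}{2^{2s}\pi^{N/2}\Gamma(s)}$ and $\Phi_s(x)=c_{N,s}|x|^{-(N-2s)}$, so that $(-\Delta)^s\Phi_s=\delta_0$ in $\mathcal D'(\mathbb R^N)$. A positive punctured solution is a function $u\in\mathcal L_s(\mathbb R^N)\cap C^{2s+\beta}_{\rm loc}(\mathbb R^N\setminus\{0\})$ for some $\beta>0$ with $2s+\beta\notin\mathbb N$, such that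 $u>0$ in $\mathbb R^N\setminus\{0\}$, $\mathcal H_{p,\mu}[u]$ is finite at every point of $\mathbb R^N\setminus\{0\}$, and the equation holds pointwise in $\mathbb R^N\setminus\{0\}$. *)

theory Defs
  imports "HOL-Probability.Probability"
begin

text \<open>
  The space \<open>\<real>\<^sup>N\<close> is an arbitrary type of class \<^class>\<open>euclidean_space\<close>, with \<open>N = DIM('a) \<ge> 1\<close>.
  A function on \<open>\<real>\<^sup>N - {0}\<close> is represented by a total function with an arbitrary value at
  the origin; in the notions built from it (integrals, and pointwise conditions on
  \<open>- {0}\<close>) that value plays no role.
\<close>

section \<open>Function spaces\<close>

text \<open>\<open>C\<^sup>k(\<Omega>)\<close> for open \<open>\<Omega>\<close>, by recursion on the first-order partial derivatives.\<close>

primrec Ck_on :: "nat \<Rightarrow> 'a::euclidean_space set \<Rightarrow> ('a \<Rightarrow> real) \<Rightarrow> bool" where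
  "Ck_on 0 \<Omega> f \<longleftrightarrow> continuous_on \<Omega> f"
| "Ck_on (Suc k) \<Omega> f \<longleftrightarrow> (\<forall>x\<in>\<Omega>. f differentiable at x) \<and>
     (\<forall>b\<in>Basis. Ck_on k \<Omega> (\<lambda>x. frechet_derivative f (at x) b))"

text \<open>\<open>C\<^sup>k\<^sup>,\<^sup>\<alpha>\<close> locally in the open set \<open>\<Omega>\<close>: the partial derivatives of order \<open>k\<close> are
  \<open>\<alpha>\<close>-Hoelder continuous on every compact subset of \<open>\<Omega>\<close>.\<close>

primrec Ck_Holder_loc :: "nat \<Rightarrow> real \<Rightarrow> 'a::euclidean_space set \<Rightarrow> ('a \<Rightarrow> real) \<Rightarrow> bool" where
  "Ck_Holder_loc 0 \<alpha> \<Omega> f \<longleftrightarrow>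
     (\<forall>K. compact K \<and> K \<subseteq> \<Omega> \<longrightarrow> (\<exists>C. \<forall>x\<in>K. \<forall>y\<in>K. \<bar>f x - f y\<bar> \<le> C * dist x y powr \<alpha>))"
| "Ck_Holder_loc (Suc k) \<alpha> \<Omega> f \<longleftrightarrow> (\<forall>x\<in>\<Omega>. f differentiable at x) \<and>
     (\<forall>b\<in>Basis. Ck_Holder_loc k \<alpha> \<Omega> (\<lambda>x. frechet_derivative f (at x) b))"

text \<open>\<open>C\<^sup>\<gamma>\<close> locally in \<open>\<Omega>\<close> for a positive non-integer exponent \<open>\<gamma>\<close>.\<close>

definition Holder_loc :: "real \<Rightarrow> 'a::euclidean_space set \<Rightarrow> ('a \<Rightarrow> real) \<Rightarrow> bool" where
  "Holder_loc \<gamma> \<Omega> f \<longleftrightarrow> Ck_Holder_loc (nat \<lfloor>\<gamma>\<rfloor>) (frac \<gamma>) \<Omega> f"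

definition test_function :: "('a::euclidean_space \<Rightarrow> real) \<Rightarrow> bool" where
  "test_function \<phi> \<longleftrightarrow> (\<forall>k. Ck_on k UNIV \<phi>) \<and> compact (closure {x. \<phi> x \<noteq> 0})"

definition Ls_space :: "real \<Rightarrow> ('a::euclidean_space \<Rightarrow> real) set" where
  "Ls_space s = {u. (\<forall>K. compact K \<longrightarrow> set_integrable lebesgue K u) \<and>
     integrable lebesgue (\<lambda>x. \<bar>u x\<bar> / (1 + norm x powr (real DIM('a) + 2 * s)))}"

section \<open>The fractional Laplacian\<close>

text \<open>This is the explicit value of the constant compatible with
  \<open>((-\<Delta>)\<^sup>s \<phi>)^(\<xi>) = |\<xi>|\<^sup>2\<^sup>s \<phi>^(\<xi>)\<close>; see lemma \<open>frac_lap_const_symbol\<close> below.\<close>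

definition frac_lap_const :: "nat \<Rightarrow> real \<Rightarrow> real" where
  "frac_lap_const N s =
     2 powr (2 * s) * s * Gamma ((real N + 2 * s) / 2) / (pi powr (real N / 2) * Gamma (1 - s))"

definition frac_lap_trunc :: "real \<Rightarrow> real \<Rightarrow> ('a::euclidean_space \<Rightarrow> real) \<Rightarrow> 'a \<Rightarrow> real" where
  "frac_lap_trunc s \<epsilon> u x = frac_lap_const DIM('a) s *
     (LINT y:{y. \<epsilon> \<le> norm (x - y)}|lebesgue. (u x - u y) / norm (x - y) powr (real DIM('a) + 2 * s))"

text \<open>\<open>has_frac_lap s u x l\<close>: the principal value at \<open>x\<close> exists and \<open>(-\<Delta>)\<^sup>s u(x) = l\<close>.\<close>

definition has_frac_lap :: "real \<Rightarrow> ('a::euclidean_space \<Rightarrow> real) \<Rightarrow> 'a \<Rightarrow> real \<Rightarrow> bool" where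
  "has_frac_lap s u x l \<longleftrightarrow> ((\<lambda>\<epsilon>. frac_lap_trunc s \<epsilon> u x) \<longlongrightarrow> l) (at_right 0)"

definition frac_lap :: "real \<Rightarrow> ('a::euclidean_space \<Rightarrow> real) \<Rightarrow> 'a \<Rightarrow> real" where
  "frac_lap s u x = (THE l. has_frac_lap s u x l)"

text \<open>The pairing of the distribution \<open>(-\<Delta>)\<^sup>s u\<close>, for \<open>u \<in> Ls_space s\<close>, with a test function.\<close>

definition frac_lap_distr :: "real \<Rightarrow> ('a::euclidean_space \<Rightarrow> real) \<Rightarrow> ('a \<Rightarrow> real) \<Rightarrow> real" where
  "frac_lap_distr s u \<phi> = (LINT x|lebesgue. u x * frac_lap s \<phi> x)"

section \<open>Riesz kernels and the nonlocal equation\<close>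

definition riesz_const :: "nat \<Rightarrow> real \<Rightarrow> real" where
  "riesz_const N s =
     Gamma ((real N - 2 * s) / 2) / (2 powr (2 * s) * pi powr (real N / 2) * Gamma s)"

definition fund_sol :: "real \<Rightarrow> 'a::euclidean_space \<Rightarrow> real" where
  "fund_sol s x = riesz_const DIM('a) s * norm x powr - (real DIM('a) - 2 * s)"

definition riesz_potential :: "real \<Rightarrow> ('a::euclidean_space \<Rightarrow> real) \<Rightarrow> 'a \<Rightarrow> real" where
  "riesz_potential s F x = riesz_const DIM('a) s *
     (LINT y|lebesgue. F y / norm (x - y) powr (real DIM('a) - 2 * s))"

definition choquard :: "real \<Rightarrow> real \<Rightarrow> ('a::euclidean_space \<Rightarrow> real) \<Rightarrow> 'a \<Rightarrow> real" where
  "choquard p \<mu> u x = (LINT y:- {0}|lebesgue. u y powr p / norm (x - y) powr \<mu>)"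

text \<open>For a nonnegative \<open>u\<close>, finiteness of the potential is integrability of its integrand.\<close>

definition choquard_finite :: "real \<Rightarrow> real \<Rightarrow> ('a::euclidean_space \<Rightarrow> real) \<Rightarrow> 'a \<Rightarrow> bool" where
  "choquard_finite p \<mu> u x \<longleftrightarrow>
     set_integrable lebesgue (- {0}) (\<lambda>y. u y powr p / norm (x - y) powr \<mu>)"

definition positive_punctured_solution ::
    "real \<Rightarrow> real \<Rightarrow> real \<Rightarrow> real \<Rightarrow> ('a::euclidean_space \<Rightarrow> real) \<Rightarrow> bool" where
  "positive_punctured_solution s \<mu> p q u \<longleftrightarrow>
     u \<in> Ls_space s \<and>
     (\<exists>\<beta>>0. 2 * s + \<beta> \<notin> \<nat> \<and> Holder_loc (2 * s + \<beta>) (- {0}) u) \<and>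
     (\<forall>x. x \<noteq> 0 \<longrightarrow> u x > 0) \<and>
     (\<forall>x. x \<noteq> 0 \<longrightarrow> choquard_finite p \<mu> u x) \<and>
     (\<forall>x. x \<noteq> 0 \<longrightarrow> has_frac_lap s u x (choquard p \<mu> u x * u x powr q))"

section \<open>Fourier normalization of the fractional Laplacian\<close>

text \<open>
  In symmetrized form, \<open>(-\<Delta>)\<^sup>s \<phi>(x)\<close> is the integral over \<open>y\<close> of
  \<open>C/2 \<cdot> (2 \<phi>(x) - \<phi>(x + y) - \<phi>(x - y)) / |y|\<^sup>N\<^sup>+\<^sup>2\<^sup>s\<close>, so its Fourier transform is
  \<open>\<phi>^(\<xi>)\<close> times the integral over \<open>y\<close> of \<open>C (1 - cos(\<xi>\<bullet>y)) / |y|\<^sup>N\<^sup>+\<^sup>2\<^sup>s\<close>.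
  Lemma \<open>frac_lap_const_symbol\<close> shows that, for \<open>C = frac_lap_const N s\<close>, this factor is
  exactly \<open>|\<xi>|\<^sup>2\<^sup>s\<close>. It is obtained by writing \<open>|y|\<^sup>-\<^sup>N\<^sup>-\<^sup>2\<^sup>s\<close> as a Gamma integral of Gaussians.
\<close>

lemma gauss_cos_integral_1:
  fixes a r :: real assumes "r > 0"
  shows "has_bochner_integral lborel (\<lambda>t. exp (- r * t\<^sup>2) *\<^sub>R iexp (a * t))
           (complex_of_real (sqrt (pi / r) * exp (- a\<^sup>2 / (4 * r))))"
proof -
  let ?f = "\<lambda>x. std_normal_density x *\<^sub>R iexp (a / sqrt (2 * r) * x)"
  have "integrable lborel ?f"
    by (rule Bochner_Integration.integrable_bound[of lborel std_normal_density])
       (auto intro!: integrable_normal_density simp: normal_density_nonneg)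
  moreover have "integral\<^sup>L lborel ?f = char std_normal_distribution (a / sqrt (2 * r))"
    unfolding char_def by (subst integral_density) (auto simp: normal_density_nonneg)
  ultimately have "has_bochner_integral lborel ?f (complex_of_real (exp (- (a / sqrt (2 * r))\<^sup>2 / 2)))"
    by (simp add: has_bochner_integral_iff char_std_normal_distribution)
  then have "has_bochner_integral lborel (\<lambda>t. ?f (0 + sqrt (2 * r) * t))
      (complex_of_real (exp (- (a / sqrt (2 * r))\<^sup>2 / 2)) /\<^sub>R \<bar>sqrt (2 * r)\<bar>)"
    using assms by (subst (asm) lborel_has_bochner_integral_real_affine_iff[where c = "sqrt (2 * r)" and t = 0]) auto
  then have "has_bochner_integral lborel (\<lambda>t. sqrt (2 * pi) *\<^sub>R ?f (0 + sqrt (2 * r) * t))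
      (sqrt (2 * pi) *\<^sub>R (complex_of_real (exp (- (a / sqrt (2 * r))\<^sup>2 / 2)) /\<^sub>R \<bar>sqrt (2 * r)\<bar>))"
    by (rule has_bochner_integral_scaleR_right)
  also have "(\<lambda>t. sqrt (2 * pi) *\<^sub>R ?f (0 + sqrt (2 * r) * t)) = (\<lambda>t. exp (- r * t\<^sup>2) *\<^sub>R iexp (a * t))"
    using assms by (auto simp: fun_eq_iff std_normal_density_def power_mult_distrib scaleR_conv_of_real)
  also have "sqrt (2 * pi) *\<^sub>R (complex_of_real (exp (- (a / sqrt (2 * r))\<^sup>2 / 2)) /\<^sub>R \<bar>sqrt (2 * r)\<bar>)
     = complex_of_real (sqrt (pi / r) * exp (- a\<^sup>2 / (4 * r)))"
  proof -
    have "sqrt (2 * pi) / sqrt (2 * r) = sqrt (pi / r)"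
      by (simp add: real_sqrt_divide[symmetric])
    moreover have "(a / sqrt (2 * r))\<^sup>2 / 2 = a\<^sup>2 / (4 * r)" using assms by (simp add: power_divide)
    moreover have "sqrt (2 * pi) *\<^sub>R (complex_of_real e /\<^sub>R \<bar>sqrt (2 * r)\<bar>) =
        complex_of_real (sqrt (2 * pi) / sqrt (2 * r) * e)" for e
    proof -
      have "\<bar>sqrt (2 * r)\<bar> = sqrt (2 * r)" using assms by simp
      then show ?thesis
        unfolding scaleR_conv_of_real divide_inverse of_real_mult by (simp only: mult_ac)
    qed
    ultimately show ?thesis by (simp only: minus_divide_left[symmetric])
  qed
  finally show ?thesis .
qed

lemma gauss_cos_integral:
  fixes \<xi> :: "'a::euclidean_space" assumes r: "r > 0"
  shows "has_bochner_integral lborel (\<lambda>y. exp (- r * (norm y)\<^sup>2) * cos (\<xi> \<bullet> y))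
           ((pi / r) powr (real DIM('a) / 2) * exp (- (norm \<xi>)\<^sup>2 / (4 * r)))"
proof -
  let ?g = "\<lambda>b t. exp (- r * t\<^sup>2) *\<^sub>R iexp ((\<xi> \<bullet> b) * t)"
  have nrm: "(norm z)\<^sup>2 = (\<Sum>b\<in>Basis. (z \<bullet> b)\<^sup>2)" for z :: 'a
    unfolding power2_norm_eq_inner using euclidean_inner[of z z] by (simp add: power2_eq_square)
  have ex: "(\<Prod>b\<in>Basis. ?g b (y \<bullet> b)) = exp (- r * (norm y)\<^sup>2) *\<^sub>R iexp (\<xi> \<bullet> y)" for y :: 'a
  proof -
    have "(\<Prod>b\<in>Basis. ?g b (y \<bullet> b)) = of_real (\<Prod>b\<in>Basis. exp (- r * (y \<bullet> b)\<^sup>2)) * (\<Prod>b\<in>Basis. iexp ((\<xi> \<bullet> b) * (y \<bullet> b)))"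
      by (simp add: scaleR_conv_of_real prod.distrib)
    also have "(\<Prod>b\<in>Basis. exp (- r * (y \<bullet> b)\<^sup>2)) = exp (- r * (norm y)\<^sup>2)"
      by (simp only: nrm exp_sum[OF finite_Basis, symmetric] sum_distrib_left)
    also have "(\<Prod>b\<in>Basis. iexp ((\<xi> \<bullet> b) * (y \<bullet> b))) = iexp (\<xi> \<bullet> y)"
      by (simp only: euclidean_inner[of \<xi> y] of_real_sum exp_sum[OF finite_Basis, symmetric] sum_distrib_left of_real_mult)
    finally show ?thesis by (simp add: scaleR_conv_of_real)
  qed
  interpret product_sigma_finite "\<lambda>_::'a. lborel :: real measure" by standard
  have g: "integrable lborel (?g b)" "integral\<^sup>L lborel (?g b) = complex_of_real (sqrt (pi / r) * exp (- (\<xi> \<bullet> b)\<^sup>2 / (4 * r)))" for b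
    using gauss_cos_integral_1[OF r, of "\<xi> \<bullet> b"] by (auto simp: has_bochner_integral_iff)
  have P: "(\<Prod>b\<in>Basis. ?g b ((\<Sum>b\<in>Basis. f b *\<^sub>R b) \<bullet> b)) = (\<Prod>b\<in>Basis. ?g b (f b))" for f :: "'a \<Rightarrow> real"
    by (intro prod.cong refl) simp
  have m: "(\<lambda>y::'a. \<Prod>b\<in>Basis. ?g b (y \<bullet> b)) \<in> borel_measurable borel"
    by measurable
  have I: "integrable lborel (\<lambda>y::'a. \<Prod>b\<in>Basis. ?g b (y \<bullet> b))"
    unfolding lborel_eq[where 'a='a]
    apply (subst integrable_distr_eq)
      apply simp
     apply (rule m)
    unfolding P by (rule product_integrable_prod) (use g in auto)
  have "integral\<^sup>L lborel (\<lambda>y::'a. \<Prod>b\<in>Basis. ?g b (y \<bullet> b)) = (\<Prod>b\<in>Basis. integral\<^sup>L lborel (?g b))"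
    unfolding lborel_eq[where 'a='a]
    apply (subst integral_distr)
      apply simp
     apply (rule m)
    unfolding P by (rule product_integral_prod) (use g in auto)
  also have "\<dots> = of_real (\<Prod>b\<in>(Basis::'a set). sqrt (pi / r) * exp (- (\<xi> \<bullet> b)\<^sup>2 / (4 * r)))"
    by (simp only: g of_real_prod)
  also have "(\<Prod>b\<in>(Basis::'a set). sqrt (pi / r) * exp (- (\<xi> \<bullet> b)\<^sup>2 / (4 * r))) =
      (pi / r) powr (real DIM('a) / 2) * exp (- (norm \<xi>)\<^sup>2 / (4 * r))"
  proof -
    have "(\<Prod>b\<in>(Basis::'a set). exp (- (\<xi> \<bullet> b)\<^sup>2 / (4 * r))) = exp (- (norm \<xi>)\<^sup>2 / (4 * r))"
      by (simp only: nrm exp_sum[OF finite_Basis, symmetric] sum_divide_distrib sum_negf[symmetric])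
    moreover have "sqrt (pi / r) ^ DIM('a) = (pi / r) powr (real DIM('a) / 2)"
    proof -
      have "sqrt (pi / r) = (pi / r) powr (1 / 2)" using r by (simp add: powr_half_sqrt)
      then have "sqrt (pi / r) ^ DIM('a) = ((pi / r) powr (1 / 2)) powr real DIM('a)"
        using r by (subst powr_realpow) auto
      then show ?thesis unfolding powr_powr by (simp add: mult.commute)
    qed
    ultimately show ?thesis by (simp add: prod.distrib)
  qed
  finally have "has_bochner_integral lborel (\<lambda>y::'a. exp (- r * (norm y)\<^sup>2) *\<^sub>R iexp (\<xi> \<bullet> y))
     (complex_of_real ((pi / r) powr (real DIM('a) / 2) * exp (- (norm \<xi>)\<^sup>2 / (4 * r))))"
    using I unfolding ex by (simp add: has_bochner_integral_iff)
  note * = has_bochner_integral_Re[OF this]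
  have "Re (exp (- r * (norm y)\<^sup>2) *\<^sub>R iexp (\<xi> \<bullet> y)) = exp (- r * (norm y)\<^sup>2) * cos (\<xi> \<bullet> y)" for y
    by (simp only: scaleR_complex.sel) (simp add: Re_exp)
  with * show ?thesis by (simp only: Re_complex_of_real)
qed

lemma nn_integral_one_minus_cos_gauss:
  fixes \<xi> :: "'a::euclidean_space" assumes r: "r > 0"
  shows "(\<integral>\<^sup>+y. ennreal (exp (- r * (norm y)\<^sup>2) * (1 - cos (\<xi> \<bullet> y))) \<partial>lborel) =
           ennreal ((pi / r) powr (real DIM('a) / 2) * (1 - exp (- (norm \<xi>)\<^sup>2 / (4 * r))))"
proof -
  have "has_bochner_integral lborel (\<lambda>y. exp (- r * (norm y)\<^sup>2) * cos (0 \<bullet> y) - exp (- r * (norm y)\<^sup>2) * cos (\<xi> \<bullet> y))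
           ((pi / r) powr (real DIM('a) / 2) * exp (- (norm (0::'a))\<^sup>2 / (4 * r))
            - (pi / r) powr (real DIM('a) / 2) * exp (- (norm \<xi>)\<^sup>2 / (4 * r)))"
    by (intro has_bochner_integral_diff gauss_cos_integral r)
  then have "has_bochner_integral lborel (\<lambda>y. exp (- r * (norm y)\<^sup>2) * (1 - cos (\<xi> \<bullet> y)))
           ((pi / r) powr (real DIM('a) / 2) * (1 - exp (- (norm \<xi>)\<^sup>2 / (4 * r))))"
    by (simp add: algebra_simps)
  note * = this[unfolded has_bochner_integral_iff]
  have "(\<integral>\<^sup>+y. ennreal (exp (- r * (norm y)\<^sup>2) * (1 - cos (\<xi> \<bullet> y))) \<partial>lborel) =
      ennreal (\<integral>y. exp (- r * (norm y)\<^sup>2) * (1 - cos (\<xi> \<bullet> y)) \<partial>lborel)"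
    by (rule nn_integral_eq_integral) (use * in \<open>auto intro!: mult_nonneg_nonneg\<close>)
  then show ?thesis using * by simp
qed

lemma nn_integral_powr_exp:
  fixes a c :: real assumes "a > 0" "c > 0"
  shows "(\<integral>\<^sup>+r. ennreal (indicator {0<..} r * r powr (a - 1) * exp (- r * c)) \<partial>lborel) = ennreal (Gamma a / c powr a)"
proof -
  have "ennreal (Gamma a) = (\<integral>\<^sup>+t. ennreal (indicator {0..} t * t powr (a - 1) / exp t) \<partial>lborel)"
    by (rule Gamma_conv_nn_integral_real) fact
  also have "\<dots> = ennreal c * (\<integral>\<^sup>+r. ennreal (indicator {0..} (0 + c * r) * (0 + c * r) powr (a - 1) / exp (0 + c * r)) \<partial>lborel)"
    using assms by (subst nn_integral_real_affine[where c = c and t = 0]) auto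
  also have "(\<integral>\<^sup>+r. ennreal (indicator {0..} (0 + c * r) * (0 + c * r) powr (a - 1) / exp (0 + c * r)) \<partial>lborel) =
    (\<integral>\<^sup>+r. ennreal (c powr (a - 1)) * ennreal (indicator {0<..} r * r powr (a - 1) * exp (- r * c)) \<partial>lborel)"
    using assms
    by (intro nn_integral_cong)
       (auto simp: indicator_def powr_mult exp_minus field_simps zero_le_mult_iff simp flip: ennreal_mult')
  also have "\<dots> = ennreal (c powr (a - 1)) * (\<integral>\<^sup>+r. ennreal (indicator {0<..} r * r powr (a - 1) * exp (- r * c)) \<partial>lborel)"
    by (rule nn_integral_cmult) measurable
  finally have *: "ennreal (Gamma a) = ennreal (c powr a) * (\<integral>\<^sup>+r. ennreal (indicator {0<..} r * r powr (a - 1) * exp (- r * c)) \<partial>lborel)"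
    using assms by (simp add: mult.assoc[symmetric] ennreal_mult'[symmetric] powr_diff)
  have "ennreal (Gamma a / c powr a) = ennreal (1 / c powr a) * ennreal (Gamma a)"
    using assms by (simp add: ennreal_mult'[symmetric] field_simps)
  also have "\<dots> = ennreal (1 / c powr a * c powr a) * (\<integral>\<^sup>+r. ennreal (indicator {0<..} r * r powr (a - 1) * exp (- r * c)) \<partial>lborel)"
    unfolding * by (subst (2) ennreal_mult') (simp_all add: mult.assoc)
  finally show ?thesis using assms by simp
qed

lemma nn_integral_powr_one_minus_exp:
  fixes s A :: real assumes s: "0 < s" "s < 1" and A: "A \<ge> 0"
  shows "(\<integral>\<^sup>+r. ennreal (indicator {0<..} r * r powr (s - 1) * (1 - exp (- A / r))) \<partial>lborel)
     = ennreal (A powr s * Gamma (1 - s) / s)"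
proof (cases "A = 0")
  case True
  then show ?thesis using s by simp
next
  case False
  with A have A: "A > 0" by simp
  have 1: "(\<integral>\<^sup>+v. ennreal (exp (- v)) * indicator {0..B} v \<partial>lborel) = ennreal (1 - exp (- B))" if "B \<ge> 0" for B :: real
    using that by (subst nn_integral_FTC_Icc[where F = "\<lambda>v. - exp (- v)"]) (auto intro!: derivative_eq_intros)
  have 2: "(\<integral>\<^sup>+r. ennreal (r powr (s - 1)) * indicator {0<..B} r \<partial>lborel) = ennreal (B powr s / s)" if "B \<ge> 0" for B :: real
  proof -
    have "((\<lambda>x. x powr (s - 1)) has_integral (B powr s / s)) {0..B}"
      using has_integral_powr_from_0[of "s - 1" B] s that by simp
    from nn_integral_has_integral_lebesgue[OF _ this]
    have "(\<integral>\<^sup>+r. ennreal (indicator {0..B} r * r powr (s - 1)) \<partial>lborel) = ennreal (B powr s / s)" by simp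
    also have "(\<integral>\<^sup>+r. ennreal (indicator {0..B} r * r powr (s - 1)) \<partial>lborel) =
       (\<integral>\<^sup>+r. ennreal (r powr (s - 1)) * indicator {0<..B} r \<partial>lborel)"
      by (intro nn_integral_cong) (auto simp: indicator_def)
    finally show ?thesis .
  qed
  have "(\<integral>\<^sup>+r. ennreal (indicator {0<..} r * r powr (s - 1) * (1 - exp (- A / r))) \<partial>lborel) =
    (\<integral>\<^sup>+r. (\<integral>\<^sup>+v. ennreal (indicator {0<..} r * r powr (s - 1)) * (ennreal (exp (- v)) * indicator {0..A / r} v) \<partial>lborel) \<partial>lborel)"
    (is "?L = ?M")
  proof (intro nn_integral_cong)
    fix r :: real
    show "ennreal (indicator {0<..} r * r powr (s - 1) * (1 - exp (- A / r))) =
       (\<integral>\<^sup>+v. ennreal (indicator {0<..} r * r powr (s - 1)) * (ennreal (exp (- v)) * indicator {0..A / r} v) \<partial>lborel)"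
    proof (cases "r > 0")
      case True
      have "(\<integral>\<^sup>+v. ennreal (indicator {0<..} r * r powr (s - 1)) * (ennreal (exp (- v)) * indicator {0..A / r} v) \<partial>lborel)
        = ennreal (indicator {0<..} r * r powr (s - 1)) * (\<integral>\<^sup>+v. ennreal (exp (- v)) * indicator {0..A / r} v \<partial>lborel)"
        by (rule nn_integral_cmult) measurable
      also have "\<dots> = ennreal (indicator {0<..} r * r powr (s - 1)) * ennreal (1 - exp (- (A / r)))"
        using True A by (subst 1) auto
      also have "\<dots> = ennreal (indicator {0<..} r * r powr (s - 1) * (1 - exp (- A / r)))"
        by (subst ennreal_mult'[symmetric]) (simp_all add: indicator_def)
      finally show ?thesis ..
    qed simp
  qed
  also have "?M = (\<integral>\<^sup>+r. (\<integral>\<^sup>+v. ennreal (indicator {0<..} r * r powr (s - 1) * exp (- v) * (if 0 \<le> v \<and> v * r \<le> A then 1 else 0)) \<partial>lborel) \<partial>lborel)"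
    by (intro nn_integral_cong) (auto simp: indicator_def field_simps simp flip: ennreal_mult')
  also have "\<dots> = (\<integral>\<^sup>+v. (\<integral>\<^sup>+r. ennreal (indicator {0<..} r * r powr (s - 1) * exp (- v) * (if 0 \<le> v \<and> v * r \<le> A then 1 else 0)) \<partial>lborel) \<partial>lborel)"
    by (rule lborel_pair.Fubini') measurable
  also have "\<dots> = (\<integral>\<^sup>+v. ennreal (A powr s / s) * ennreal (indicator {0<..} v * v powr ((1 - s) - 1) * exp (- v * 1)) \<partial>lborel)"
  proof (intro nn_integral_cong_AE eventually_mono[OF AE_lborel_singleton[of 0]])
    fix v :: real assume v: "v \<noteq> 0"
    show "(\<integral>\<^sup>+r. ennreal (indicator {0<..} r * r powr (s - 1) * exp (- v) * (if 0 \<le> v \<and> v * r \<le> A then 1 else 0)) \<partial>lborel) =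
      ennreal (A powr s / s) * ennreal (indicator {0<..} v * v powr ((1 - s) - 1) * exp (- v * 1))"
    proof (cases "v > 0")
      case False
      then show ?thesis using v by simp
    next
      case True
      have "(\<integral>\<^sup>+r. ennreal (indicator {0<..} r * r powr (s - 1) * exp (- v) * (if 0 \<le> v \<and> v * r \<le> A then 1 else 0)) \<partial>lborel)
        = (\<integral>\<^sup>+r. ennreal (exp (- v)) * (ennreal (r powr (s - 1)) * indicator {0<..A / v} r) \<partial>lborel)"
        using True by (intro nn_integral_cong) (auto simp: indicator_def field_simps simp flip: ennreal_mult')
      also have "\<dots> = ennreal (exp (- v)) * ennreal ((A / v) powr s / s)"
        using True A by (subst nn_integral_cmult) (auto simp: 2)
      also have "\<dots> = ennreal (A powr s / s) * ennreal (indicator {0<..} v * v powr ((1 - s) - 1) * exp (- v * 1))"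
        using True A s by (simp add: powr_divide powr_minus field_simps flip: ennreal_mult')
      finally show ?thesis .
    qed
  qed
  also have "\<dots> = ennreal (A powr s / s) * (\<integral>\<^sup>+v. ennreal (indicator {0<..} v * v powr ((1 - s) - 1) * exp (- v * 1)) \<partial>lborel)"
    by (rule nn_integral_cmult) measurable
  also have "\<dots> = ennreal (A powr s / s) * ennreal (Gamma (1 - s) / 1 powr (1 - s))"
    using s by (subst nn_integral_powr_exp) auto
  also have "\<dots> = ennreal (A powr s * Gamma (1 - s) / s)" using s by (simp flip: ennreal_mult')
  finally show ?thesis .
qed

lemma nn_integral_one_minus_cos_riesz:
  fixes \<xi> :: "'a::euclidean_space" assumes s: "0 < s" "s < 1"
  defines "N \<equiv> real DIM('a)"
  shows "(\<integral>\<^sup>+y. ennreal ((1 - cos (\<xi> \<bullet> y)) / norm y powr (N + 2 * s)) \<partial>lborel)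
    = ennreal (norm \<xi> powr (2 * s) * (pi powr (N / 2) * Gamma (1 - s)) / (2 powr (2 * s) * s * Gamma ((N + 2 * s) / 2)))"
proof -
  define a where "a = N / 2 + s"
  have a: "a > 0" "N \<ge> 1" using s by (auto simp: a_def N_def Suc_leI)
  have G: "Gamma a > 0" using a by simp
  have "(\<integral>\<^sup>+y. ennreal (Gamma a) * ennreal ((1 - cos (\<xi> \<bullet> y)) / norm y powr (N + 2 * s)) \<partial>lborel) =
    (\<integral>\<^sup>+y. (\<integral>\<^sup>+r. ennreal (1 - cos (\<xi> \<bullet> y)) * ennreal (indicator {0<..} r * r powr (a - 1) * exp (- r * (norm y)\<^sup>2)) \<partial>lborel) \<partial>lborel)"
  proof (intro nn_integral_cong_AE eventually_mono[OF AE_lborel_singleton[of 0]])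
    fix y :: 'a assume y: "y \<noteq> 0"
    have e: "((norm y)\<^sup>2) powr a = norm y powr (N + 2 * s)"
      using powr_powr[of "norm y" 2 a] y by (simp add: a_def algebra_simps)
    show "ennreal (Gamma a) * ennreal ((1 - cos (\<xi> \<bullet> y)) / norm y powr (N + 2 * s)) =
     (\<integral>\<^sup>+r. ennreal (1 - cos (\<xi> \<bullet> y)) * ennreal (indicator {0<..} r * r powr (a - 1) * exp (- r * (norm y)\<^sup>2)) \<partial>lborel)"
    proof -
      have g: "(\<integral>\<^sup>+r. ennreal (indicator {0<..} r * r powr (a - 1) * exp (- r * (norm y)\<^sup>2)) \<partial>lborel)
         = ennreal (Gamma a / norm y powr (N + 2 * s))"
        using nn_integral_powr_exp[of a "(norm y)\<^sup>2"] a y unfolding e by simp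
      show ?thesis
        by (subst nn_integral_cmult) (measurable, simp only: g, use G in \<open>simp add: mult.commute flip: ennreal_mult'\<close>)
    qed
  qed
  also have "\<dots> = (\<integral>\<^sup>+r. (\<integral>\<^sup>+y. ennreal (1 - cos (\<xi> \<bullet> y)) * ennreal (indicator {0<..} r * r powr (a - 1) * exp (- r * (norm y)\<^sup>2)) \<partial>lborel) \<partial>lborel)"
    by (rule lborel_pair.Fubini') measurable
  also have "\<dots> = (\<integral>\<^sup>+r. ennreal (pi powr (N / 2)) * ennreal (indicator {0<..} r * r powr (s - 1) * (1 - exp (- ((norm \<xi>)\<^sup>2 / 4) / r))) \<partial>lborel)"
  proof (intro nn_integral_cong)
    fix r :: real
    show "(\<integral>\<^sup>+y. ennreal (1 - cos (\<xi> \<bullet> y)) * ennreal (indicator {0<..} r * r powr (a - 1) * exp (- r * (norm y)\<^sup>2)) \<partial>lborel)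
      = ennreal (pi powr (N / 2)) * ennreal (indicator {0<..} r * r powr (s - 1) * (1 - exp (- ((norm \<xi>)\<^sup>2 / 4) / r)))"
    proof (cases "r > 0")
      case r: True
      have "(\<integral>\<^sup>+y. ennreal (1 - cos (\<xi> \<bullet> y)) * ennreal (indicator {0<..} r * r powr (a - 1) * exp (- r * (norm y)\<^sup>2)) \<partial>lborel)
       = (\<integral>\<^sup>+y. ennreal (r powr (a - 1)) * ennreal (exp (- r * (norm y)\<^sup>2) * (1 - cos (\<xi> \<bullet> y))) \<partial>lborel)"
        using r by (intro nn_integral_cong) (auto simp: mult_ac simp flip: ennreal_mult')
      also have "\<dots> = ennreal (r powr (a - 1)) * ennreal ((pi / r) powr (N / 2) * (1 - exp (- (norm \<xi>)\<^sup>2 / (4 * r))))"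
        unfolding N_def nn_integral_one_minus_cos_gauss[OF r, symmetric] by (rule nn_integral_cmult) measurable
      also have "\<dots> = ennreal (r powr (a - 1) * ((pi / r) powr (N / 2) * (1 - exp (- (norm \<xi>)\<^sup>2 / (4 * r)))))"
        by (rule ennreal_mult'[symmetric]) simp
      also have "r powr (a - 1) * ((pi / r) powr (N / 2) * (1 - exp (- (norm \<xi>)\<^sup>2 / (4 * r)))) =
         pi powr (N / 2) * (indicator {0<..} r * r powr (s - 1) * (1 - exp (- ((norm \<xi>)\<^sup>2 / 4) / r)))"
      proof -
        have "r powr (a - 1) * (pi / r) powr (N / 2) = pi powr (N / 2) * r powr (s - 1)"
        proof -
          have "a - 1 = (s - 1) + N / 2" by (simp add: a_def)
          then have "r powr (a - 1) = r powr (s - 1) * r powr (N / 2)" by (simp only: powr_add)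
          then show ?thesis using r by (simp add: powr_divide)
        qed
        moreover have "- (norm \<xi>)\<^sup>2 / (4 * r) = - ((norm \<xi>)\<^sup>2 / 4) / r" by simp
        ultimately show ?thesis using r by (simp only: mult.assoc[symmetric]) simp
      qed
      finally show ?thesis by (simp add: ennreal_mult')
    qed auto
  qed
  also have "\<dots> = ennreal (pi powr (N / 2)) * ennreal (((norm \<xi>)\<^sup>2 / 4) powr s * Gamma (1 - s) / s)"
    using s by (subst nn_integral_powr_one_minus_exp[OF s, symmetric], simp, intro nn_integral_cmult) measurable
  also have "((norm \<xi>)\<^sup>2 / 4) powr s = norm \<xi> powr (2 * s) / 2 powr (2 * s)"
  proof -
    have "(4::real) powr s = 2 powr (2 * s)" using powr_powr[of 2 2 s] by simp
    moreover have "((norm \<xi>)\<^sup>2) powr s = norm \<xi> powr (2 * s)"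
      using powr_powr[of "norm \<xi>" 2 s] by (cases "\<xi> = 0") simp_all
    ultimately show ?thesis by (simp add: powr_divide)
  qed
  finally have *: "ennreal (Gamma a) * (\<integral>\<^sup>+y. ennreal ((1 - cos (\<xi> \<bullet> y)) / norm y powr (N + 2 * s)) \<partial>lborel)
    = ennreal (pi powr (N / 2) * (norm \<xi> powr (2 * s) / 2 powr (2 * s) * Gamma (1 - s) / s))"
    by (subst (asm) nn_integral_cmult) (auto simp only: ennreal_mult'[OF powr_ge_zero], measurable)
  have "ennreal (1 / Gamma a) * (ennreal (Gamma a) * (\<integral>\<^sup>+y. ennreal ((1 - cos (\<xi> \<bullet> y)) / norm y powr (N + 2 * s)) \<partial>lborel))
     = (\<integral>\<^sup>+y. ennreal ((1 - cos (\<xi> \<bullet> y)) / norm y powr (N + 2 * s)) \<partial>lborel)"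
    using G by (simp add: mult.assoc[symmetric] flip: ennreal_mult')
  then have "(\<integral>\<^sup>+y. ennreal ((1 - cos (\<xi> \<bullet> y)) / norm y powr (N + 2 * s)) \<partial>lborel) =
     ennreal (1 / Gamma a * (pi powr (N / 2) * (norm \<xi> powr (2 * s) / 2 powr (2 * s) * Gamma (1 - s) / s)))"
    unfolding * using G by (subst ennreal_mult') auto
  moreover have "a = (N + 2 * s) / 2" by (simp add: a_def add_divide_distrib)
  ultimately show ?thesis by (simp add: mult_ac)
qed

lemma frac_lap_const_symbol:
  fixes \<xi> :: "'a::euclidean_space" assumes s: "0 < s" "s < 1"
  shows "has_bochner_integral lborel
    (\<lambda>y. frac_lap_const DIM('a) s * ((1 - cos (\<xi> \<bullet> y)) / norm y powr (real DIM('a) + 2 * s)))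
    (norm \<xi> powr (2 * s))"
proof -
  let ?K = "pi powr (real DIM('a) / 2) * Gamma (1 - s)"
  let ?L = "2 powr (2 * s) * s * Gamma ((real DIM('a) + 2 * s) / 2)"
  have pos: "?K > 0" "?L > 0"
    using s by (auto intro!: mult_pos_pos Gamma_real_pos add_nonneg_pos)
  have "has_bochner_integral lborel (\<lambda>y. (1 - cos (\<xi> \<bullet> y)) / norm y powr (real DIM('a) + 2 * s))
      (norm \<xi> powr (2 * s) * ?K / ?L)"
  proof (rule has_bochner_integral_nn_integral)
    show "0 \<le> norm \<xi> powr (2 * s) * ?K / ?L"
      using pos by (intro divide_nonneg_pos mult_nonneg_nonneg[OF _ less_imp_le]) auto
  qed (use nn_integral_one_minus_cos_riesz[OF s, of \<xi>] in auto)
  from has_bochner_integral_mult_right[OF this, of "frac_lap_const DIM('a) s"]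
  have "has_bochner_integral lborel
    (\<lambda>y. frac_lap_const DIM('a) s * ((1 - cos (\<xi> \<bullet> y)) / norm y powr (real DIM('a) + 2 * s)))
    (?L / ?K * (norm \<xi> powr (2 * s) * ?K / ?L))"
    unfolding frac_lap_const_def by simp
  also have "?L / ?K * (norm \<xi> powr (2 * s) * ?K / ?L) = norm \<xi> powr (2 * s)"
  proof -
    have "l / k * (n * k / l) = n" if "k > 0" "l > 0" for k l n :: real using that by simp
    from this[OF pos] show ?thesis .
  qed
  finally show ?thesis .
qed

end

theory Submission imports Defs begin

text \<open>
  Both conclusions follow from one linear functional. Let
  \<open>T f = \<integral> u (-\<Delta>)\<^sup>s f - \<integral> F f\<close> be the \<^emph>\<open>defect\<close> in the distributional equation, on a
  class of functions \<open>f\<close> wide enough to contain both the test functions and some explicit kernels.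
  The core of the proof is that \<open>T f = m f(0)\<close> for a constant \<open>m\<close> (\<open>defect_eq_point_mass\<close>):
  the defect is a point mass at the origin, without derivatives of it.

  If \<open>f\<close> lives in an annulus, \<open>T f = 0\<close>: the truncated operators are symmetric by Fubini's
  theorem (\<open>frac_lap_trunc_symmetric\<close>), and the truncation can be removed under the integral since
  Hoelder regularity makes the second differences of \<open>u\<close> uniformly small on compact sets that avoid
  the origin (\<open>frac_lap_pairing_local\<close>). A cutoff at infinity is removed by dominated convergence
  in the class of functions that decay like \<open>|x|\<close> to the power \<open>-(N + 2 - 2 s)\<close> and whose
  differences decay accordingly (\<open>symbol_bound\<close>); their fractional Laplacians are bounded by a
  multiple of the weight of \<open>Ls_space\<close> (\<open>symbol_diff2_levy_bound\<close>). So \<open>T f = 0\<close> as soon as \<open>f\<close>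
  vanishes near the origin. A general \<open>f\<close> may then be replaced by its cutoff at any scale \<open>r\<close>, and
  after subtraction of \<open>f(0)\<close> that is a bump of height \<open>O(r)\<close> and width \<open>r\<close>. The bound
  \<open>u = O(|x|\<^sup>2\<^sup>s\<^sup>-\<^sup>N)\<close> is exactly what makes a bump of height one and width \<open>r\<close> pair with \<open>u\<close>
  to \<open>O(1)\<close>, and \<open>F\<close> is integrable near the origin; hence \<open>T f - m f(0) = O(r)\<close>, and it vanishes.

  The representation comes from testing with differences of the bubbles
  \<open>\<Phi>\<^sub>\<epsilon>(x) = c\<^sub>N\<^sub>,\<^sub>s (\<epsilon>\<^sup>2 + |x|\<^sup>2)\<^sup>s\<^sup>-\<^sup>N\<^sup>/\<^sup>2\<close>. These are superpositions of Gaussians, and on the Fourier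
  side one sees that \<open>(-\<Delta>)\<^sup>s \<Phi>\<^sub>\<epsilon>\<close> is an explicit probability density \<open>K\<^sub>\<epsilon>\<close> concentrated at the
  scale \<open>\<epsilon>\<close> (\<open>flap_bubble\<close>). A single bubble decays too slowly to be tested with, but a difference
  gains two powers (\<open>bubble_diff_symbol_bound\<close>). With \<open>f = \<Phi>\<^sub>\<epsilon>(x - \<cdot>) - \<Phi>\<^sub>R(x - \<cdot>)\<close> the identity
  \<open>T f = m f(0)\<close> says that the averages of \<open>u\<close> around \<open>x\<close> at the scales \<open>\<epsilon>\<close> and \<open>R\<close> differ by
  \<open>\<integral> F f + m f(0)\<close> (\<open>average_identity\<close>). Now let \<open>\<epsilon> \<rightarrow> 0\<close> and \<open>R \<rightarrow> \<infinity>\<close>. The first average tends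
  to \<open>u(x)\<close>, and \<open>\<integral> F f\<close> increases to the Riesz potential, which is finite because the other
  terms on its side are nonnegative. The second average tends to a limit that does not depend on \<open>x\<close>, since the
  quotient of \<open>K\<^sub>R(x - y)\<close> and \<open>K\<^sub>R(x' - y)\<close> tends to one uniformly in \<open>y\<close>
  (\<open>bubble_density_shift_le\<close>). Thus \<open>u = V + m \<Phi>\<^sub>s + c\<close> with \<open>c \<ge> 0\<close>.

  Two signs remain. The point mass is nonnegative because the averages of \<open>u\<close> at the origin are,
  while the potential of \<open>F\<close> contributes to them only \<open>o(\<epsilon>\<^sup>2\<^sup>s\<^sup>-\<^sup>N)\<close> (\<open>point_mass_nonneg\<close>). And a
  positive \<open>c\<close> would be a lower bound for \<open>u\<close>, which makes the Choquard potential infinite because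
  \<open>\<mu> < N\<close> (\<open>not_integrable_norm_powr\<close>); so \<open>c = 0\<close>.
\<close>

section \<open>Integration of radial functions\<close>

lemma integrable_dominated:
  fixes f g :: "'b \<Rightarrow> real"
  assumes "integrable M g" "f \<in> borel_measurable M" "\<And>x. \<bar>f x\<bar> \<le> g x"
  shows "integrable M f"
  using assms(1,2) by (rule Bochner_Integration.integrable_bound) (auto intro!: AE_I2 order_trans[OF assms(3)])

text \<open>Polar coordinates for radial functions: both measures give a half-line the volume of a ball, which
  is the integral of its own derivative in the radius.\<close>

lemma distr_norm_lborel:
  "distr lborel lborel (norm :: 'a::euclidean_space \<Rightarrow> real) =
     density lborel (\<lambda>t. ennreal (indicator {0..} t * (unit_ball_vol (real DIM('a)) * real DIM('a) * t ^ (DIM('a) - 1))))"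
    (is "?M = ?D")
proof (rule measure_eqI_generator_eq[where E = "range (\<lambda>t. {..t::real})" and A = "\<lambda>i. {..real i}" and \<Omega> = UNIV])
  have N: "DIM('a) \<ge> 1" by (simp add: Suc_leI)
  have M: "emeasure ?M {..t} = (if t < 0 then 0 else ennreal (unit_ball_vol (real DIM('a)) * t ^ DIM('a)))" for t
  proof -
    have "emeasure ?M {..t} = emeasure lborel (cball (0::'a) t)"
      by (subst emeasure_distr) (auto intro!: arg_cong[where f = "emeasure lborel"])
    then show ?thesis
      using emeasure_cball[of t "0::'a"] by auto
  qed
  have D: "emeasure ?D {..t} = (if t < 0 then 0 else ennreal (unit_ball_vol (real DIM('a)) * t ^ DIM('a)))" for t
  proof -
    have "emeasure ?D {..t} = (\<integral>\<^sup>+x. ennreal (unit_ball_vol (real DIM('a)) * real DIM('a) * x ^ (DIM('a) - 1)) * indicator {0..t} x \<partial>lborel)"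
      by (subst emeasure_density) (auto intro!: nn_integral_cong simp: indicator_def)
    also have "\<dots> = (if t < 0 then 0 else ennreal (unit_ball_vol (real DIM('a)) * t ^ DIM('a)))"
    proof (cases "t < 0")
      case False
      have "(\<integral>\<^sup>+x. ennreal (unit_ball_vol (real DIM('a)) * real DIM('a) * x ^ (DIM('a) - 1)) * indicator {0..t} x \<partial>lborel)
        = unit_ball_vol (real DIM('a)) * t ^ DIM('a) - unit_ball_vol (real DIM('a)) * 0 ^ DIM('a)"
        using False by (intro nn_integral_FTC_Icc) (auto intro!: derivative_eq_intros)
      then show ?thesis using False N by simp
    qed simp
    finally show ?thesis .
  qed
  show "Int_stable (range (\<lambda>t::real. {..t}))"
    by (rule Int_stableI_image) (auto simp: min_def intro!: exI[of _ "min _ _"])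
  show "emeasure ?M X = emeasure ?D X" if "X \<in> range (\<lambda>t. {..t})" for X
    using that M D by auto
  show "sets ?M = sigma_sets UNIV (range (\<lambda>t. {..t}))" "sets ?D = sigma_sets UNIV (range (\<lambda>t. {..t}))"
    by (simp_all add: borel_eq_atMost)
  show "(\<Union>i. {..real i}) = UNIV" by (auto simp: real_arch_simple)
  show "emeasure ?M {..real i} \<noteq> \<infinity>" for i using M by simp
qed auto

lemma nn_integral_radial:
  assumes "f \<in> borel_measurable borel"
  shows "(\<integral>\<^sup>+z. f (norm (z::'a::euclidean_space)) \<partial>lborel) =
    (\<integral>\<^sup>+t. ennreal (indicator {0..} t * (unit_ball_vol (real DIM('a)) * real DIM('a) * t ^ (DIM('a) - 1))) * f t \<partial>lborel)"
proof -
  have "(\<integral>\<^sup>+z. f (norm (z::'a)) \<partial>lborel) = (\<integral>\<^sup>+t. f t \<partial>distr lborel lborel (norm :: 'a \<Rightarrow> real))"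
    using assms by (subst nn_integral_distr) auto
  also have "\<dots> = (\<integral>\<^sup>+t. ennreal (indicator {0..} t * (unit_ball_vol (real DIM('a)) * real DIM('a) * t ^ (DIM('a) - 1))) * f t \<partial>lborel)"
    unfolding distr_norm_lborel using assms by (subst nn_integral_density) auto
  finally show ?thesis .
qed

lemma integral_norm_powr_cball:
  fixes \<kappa> \<rho> :: real
  assumes \<kappa>: "\<kappa> < real DIM('a::euclidean_space)" and \<rho>: "0 \<le> \<rho>"
  defines "C \<equiv> unit_ball_vol (real DIM('a)) * real DIM('a) / (real DIM('a) - \<kappa>)"
  shows "has_bochner_integral lborel (\<lambda>z::'a. indicator (cball 0 \<rho>) z * norm z powr - \<kappa>) (C * \<rho> powr (real DIM('a) - \<kappa>))"
proof (rule has_bochner_integral_nn_integral)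
  let ?V = "unit_ball_vol (real DIM('a)) * real DIM('a)"
  have N: "DIM('a) \<ge> 1" by (simp add: Suc_leI)
  have V: "?V \<ge> 0" by simp
  show "0 \<le> C * \<rho> powr (real DIM('a) - \<kappa>)" using \<kappa> by (simp add: C_def)
  have "((\<lambda>x. x powr (real DIM('a) - 1 - \<kappa>)) has_integral (\<rho> powr (real DIM('a) - \<kappa>) / (real DIM('a) - \<kappa>))) {0..\<rho>}"
    using has_integral_powr_from_0[of "real DIM('a) - 1 - \<kappa>" \<rho>] \<kappa> \<rho> by simp
  from nn_integral_has_integral_lebesgue[OF _ this]
  have I: "(\<integral>\<^sup>+r. ennreal (indicator {0..\<rho>} r * r powr (real DIM('a) - 1 - \<kappa>)) \<partial>lborel) = ennreal (\<rho> powr (real DIM('a) - \<kappa>) / (real DIM('a) - \<kappa>))" by simp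
  have "(\<integral>\<^sup>+z. ennreal (indicator (cball 0 \<rho>) (z::'a) * norm z powr - \<kappa>) \<partial>lborel)
     = (\<integral>\<^sup>+z. ennreal (indicator {0..\<rho>} (norm (z::'a)) * norm z powr - \<kappa>) \<partial>lborel)"
    by (intro nn_integral_cong) (auto simp: indicator_def)
  also have "\<dots> = (\<integral>\<^sup>+t. ennreal (indicator {0..} t * (?V * t ^ (DIM('a) - 1))) * ennreal (indicator {0..\<rho>} t * t powr - \<kappa>) \<partial>lborel)"
    by (rule nn_integral_radial) auto
  also have "\<dots> = (\<integral>\<^sup>+t. ennreal ?V * ennreal (indicator {0..\<rho>} t * t powr (real DIM('a) - 1 - \<kappa>)) \<partial>lborel)"
  proof (intro nn_integral_cong_AE eventually_mono[OF AE_lborel_singleton[of 0]])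
    fix t :: real assume "t \<noteq> 0"
    moreover have "t > 0 \<Longrightarrow> t ^ (DIM('a) - 1) * t powr - \<kappa> = t powr (real DIM('a) - 1 - \<kappa>)"
      using N by (simp add: powr_diff powr_minus powr_realpow[symmetric] of_nat_diff divide_inverse)
    ultimately show "ennreal (indicator {0..} t * (?V * t ^ (DIM('a) - 1))) * ennreal (indicator {0..\<rho>} t * t powr - \<kappa>)
        = ennreal ?V * ennreal (indicator {0..\<rho>} t * t powr (real DIM('a) - 1 - \<kappa>))"
      using V by (auto simp: indicator_def mult.assoc simp flip: ennreal_mult')
  qed
  also have "\<dots> = ennreal ?V * (\<integral>\<^sup>+t. ennreal (indicator {0..\<rho>} t * t powr (real DIM('a) - 1 - \<kappa>)) \<partial>lborel)"
    by (rule nn_integral_cmult) auto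
  also have "\<dots> = ennreal (C * \<rho> powr (real DIM('a) - \<kappa>))"
    unfolding I using V \<kappa> by (simp add: C_def flip: ennreal_mult')
  finally show "(\<integral>\<^sup>+z. ennreal (indicator (cball 0 \<rho>) (z::'a) * norm z powr - \<kappa>) \<partial>lborel) = ennreal (C * \<rho> powr (real DIM('a) - \<kappa>))" .
  show "(\<lambda>z::'a. indicator (cball 0 \<rho>) z * norm z powr - \<kappa>) \<in> borel_measurable lborel"
    by (intro borel_measurable_times borel_measurable_indicator) auto
qed auto

lemma integral_norm_powr_outside:
  fixes \<kappa> \<rho> :: real
  assumes \<kappa>: "\<kappa> > real DIM('a::euclidean_space)" and \<rho>: "0 < \<rho>"
  defines "C \<equiv> unit_ball_vol (real DIM('a)) * real DIM('a) / (\<kappa> - real DIM('a))"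
  shows "has_bochner_integral lborel (\<lambda>z::'a. indicator {z. \<rho> \<le> norm z} z * norm z powr - \<kappa>) (C * \<rho> powr (real DIM('a) - \<kappa>))"
proof (rule has_bochner_integral_nn_integral)
  let ?V = "unit_ball_vol (real DIM('a)) * real DIM('a)"
  have N: "DIM('a) \<ge> 1" by (simp add: Suc_leI)
  have V: "?V \<ge> 0" by simp
  show "0 \<le> C * \<rho> powr (real DIM('a) - \<kappa>)" using \<kappa> by (simp add: C_def)
  have "((\<lambda>x. x powr (real DIM('a) - 1 - \<kappa>)) has_integral - (\<rho> powr (real DIM('a) - 1 - \<kappa> + 1)) / (real DIM('a) - 1 - \<kappa> + 1)) {\<rho>..}"
    using \<kappa> \<rho> by (intro has_integral_powr_to_inf) auto
  also have "- (\<rho> powr (real DIM('a) - 1 - \<kappa> + 1)) / (real DIM('a) - 1 - \<kappa> + 1) = \<rho> powr (real DIM('a) - \<kappa>) / (\<kappa> - real DIM('a))"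
    using \<kappa> by (simp add: field_simps)
  finally have "((\<lambda>x. x powr (real DIM('a) - 1 - \<kappa>)) has_integral \<rho> powr (real DIM('a) - \<kappa>) / (\<kappa> - real DIM('a))) {\<rho>..}" .
  from nn_integral_has_integral_lebesgue[OF _ this]
  have I: "(\<integral>\<^sup>+r. ennreal (indicator {\<rho>..} r * r powr (real DIM('a) - 1 - \<kappa>)) \<partial>lborel) = ennreal (\<rho> powr (real DIM('a) - \<kappa>) / (\<kappa> - real DIM('a)))" by simp
  have "(\<integral>\<^sup>+z. ennreal (indicator {z. \<rho> \<le> norm z} (z::'a) * norm z powr - \<kappa>) \<partial>lborel)
     = (\<integral>\<^sup>+z. ennreal (indicator {\<rho>..} (norm (z::'a)) * norm z powr - \<kappa>) \<partial>lborel)"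
    by (intro nn_integral_cong) (auto simp: indicator_def)
  also have "\<dots> = (\<integral>\<^sup>+t. ennreal (indicator {0..} t * (?V * t ^ (DIM('a) - 1))) * ennreal (indicator {\<rho>..} t * t powr - \<kappa>) \<partial>lborel)"
    by (rule nn_integral_radial) auto
  also have "\<dots> = (\<integral>\<^sup>+t. ennreal ?V * ennreal (indicator {\<rho>..} t * t powr (real DIM('a) - 1 - \<kappa>)) \<partial>lborel)"
  proof (intro nn_integral_cong)
    fix t :: real
    have "t > 0 \<Longrightarrow> t ^ (DIM('a) - 1) * t powr - \<kappa> = t powr (real DIM('a) - 1 - \<kappa>)"
      using N by (simp add: powr_diff powr_minus powr_realpow[symmetric] of_nat_diff divide_inverse)
    then show "ennreal (indicator {0..} t * (?V * t ^ (DIM('a) - 1))) * ennreal (indicator {\<rho>..} t * t powr - \<kappa>)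
        = ennreal ?V * ennreal (indicator {\<rho>..} t * t powr (real DIM('a) - 1 - \<kappa>))"
      using V \<rho> by (auto simp: indicator_def mult.assoc simp flip: ennreal_mult')
  qed
  also have "\<dots> = ennreal ?V * (\<integral>\<^sup>+t. ennreal (indicator {\<rho>..} t * t powr (real DIM('a) - 1 - \<kappa>)) \<partial>lborel)"
    by (rule nn_integral_cmult) auto
  also have "\<dots> = ennreal (C * \<rho> powr (real DIM('a) - \<kappa>))"
    unfolding I using V \<kappa> by (simp add: C_def flip: ennreal_mult')
  finally show "(\<integral>\<^sup>+z. ennreal (indicator {z. \<rho> \<le> norm z} (z::'a) * norm z powr - \<kappa>) \<partial>lborel) = ennreal (C * \<rho> powr (real DIM('a) - \<kappa>))" .
  show "(\<lambda>z::'a. indicator {z. \<rho> \<le> norm z} z * norm z powr - \<kappa>) \<in> borel_measurable lborel"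
    by (intro borel_measurable_times borel_measurable_indicator) auto
qed auto

lemma integrable_bracket_powr:
  assumes "a > real DIM('a::euclidean_space)"
  shows "integrable lborel (\<lambda>y::'a. (1 + norm y) powr - a)"
proof (rule Bochner_Integration.integrable_bound)
  let ?g = "\<lambda>y::'a. indicator (cball 0 1) y * norm y powr - 0 + indicator {z. 1 \<le> norm z} y * norm y powr - a"
  show "integrable lborel ?g"
    using integral_norm_powr_cball[where 'a = 'a, of 0 1] integral_norm_powr_outside[where 'a = 'a, of a 1] assms
    by (intro Bochner_Integration.integrable_add) (auto dest: has_bochner_integral_implies_finite_norm simp: has_bochner_integral_iff)
  show "AE y in lborel. norm ((1 + norm (y::'a)) powr - a) \<le> norm (?g y)"
  proof (rule eventually_mono[OF AE_lborel_singleton[of 0]])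
    fix y :: 'a assume y: "y \<noteq> 0"
    show "norm ((1 + norm y) powr - a) \<le> norm (?g y)"
    proof (cases "norm y \<le> 1")
      case True
      have "(1 + norm y) powr - a \<le> 1 powr - a" using assms by (intro powr_mono2') auto
      then show ?thesis using True y by (auto simp: indicator_def)
    next
      case False
      have "(1 + norm y) powr - a \<le> norm y powr - a" using assms y by (intro powr_mono2') auto
      then show ?thesis using False by (auto simp: indicator_def)
    qed
  qed
qed auto

section \<open>Second differences and the fractional Laplacian\<close>

text \<open>Up to a constant, \<open>levy\<close> is the density of the Levy measure of the stable process generated by
  minus the fractional Laplacian, and \<open>levy_tail\<close> is its part of large jumps.\<close>

definition levy :: "real \<Rightarrow> 'a::euclidean_space \<Rightarrow> real" where
  "levy s z = norm z powr - (real DIM('a) + 2 * s)"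

definition levy_tail :: "real \<Rightarrow> real \<Rightarrow> 'a::euclidean_space \<Rightarrow> real" where
  "levy_tail \<delta> s z = indicator {z. \<delta> \<le> norm z} z * levy s z"

definition sphere_area :: "'a::euclidean_space itself \<Rightarrow> real" where
  "sphere_area _ = unit_ball_vol (real DIM('a)) * real DIM('a)"

lemma sphere_area_nonneg: "sphere_area TYPE('a::euclidean_space) \<ge> 0"
  by (simp add: sphere_area_def)

lemma levy_measurable [measurable]: "levy s \<in> borel_measurable borel"
  unfolding levy_def[abs_def] by measurable

lemma levy_tail_measurable [measurable]: "levy_tail \<delta> s \<in> borel_measurable borel"
  unfolding levy_tail_def[abs_def] by measurable

lemma levy_nonneg: "levy s z \<ge> 0" by (simp add: levy_def)

lemma levy_tail_nonneg: "levy_tail \<delta> s z \<ge> 0" by (simp add: levy_tail_def levy_nonneg)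

lemma levy_minus [simp]: "levy s (- z) = levy s z" "levy_tail \<delta> s (- z) = levy_tail \<delta> s z"
  by (simp_all add: levy_def levy_tail_def indicator_def)

lemma levy_commute: "levy_tail \<delta> s (x - y) = levy_tail \<delta> s (y - x)"
  using levy_minus(2)[of \<delta> s "x - y"] by simp

lemma levy_near:
  assumes "\<gamma> > 2 * s" "\<rho> \<ge> 0"
  shows "has_bochner_integral lborel (\<lambda>z::'a::euclidean_space. indicator (cball 0 \<rho>) z * (norm z powr \<gamma> * levy s z))
     (sphere_area TYPE('a) / (\<gamma> - 2 * s) * \<rho> powr (\<gamma> - 2 * s))"
proof -
  have "norm z powr \<gamma> * levy s z = norm z powr - (real DIM('a) + 2 * s - \<gamma>)" for z :: 'a
    by (simp add: levy_def flip: powr_add) (simp add: algebra_simps)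
  then show ?thesis
    using integral_norm_powr_cball[where 'a = 'a, of "real DIM('a) + 2 * s - \<gamma>" \<rho>] assms
    by (simp add: sphere_area_def)
qed

lemma levy_far:
  assumes "s > 0" "\<rho> > 0"
  shows "has_bochner_integral lborel (levy_tail \<rho> s :: 'a::euclidean_space \<Rightarrow> real)
     (sphere_area TYPE('a) / (2 * s) * \<rho> powr - (2 * s))"
  using integral_norm_powr_outside[where 'a = 'a, of "real DIM('a) + 2 * s" \<rho>] assms
  by (simp add: sphere_area_def levy_tail_def[abs_def] levy_def[abs_def])

definition diff2 :: "('a::real_vector \<Rightarrow> real) \<Rightarrow> 'a \<Rightarrow> 'a \<Rightarrow> real" where
  "diff2 f x z = 2 * f x - f (x + z) - f (x - z)"

lemma diff2_measurable [measurable]: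
  fixes f :: "'a::euclidean_space \<Rightarrow> real"
  assumes [measurable]: "f \<in> borel_measurable borel"
  shows "diff2 f x \<in> borel_measurable borel"
  unfolding diff2_def[abs_def] by measurable

text \<open>The symmetrized form of the principal value. For functions whose second differences are
  small it converges absolutely, so that it is accessible to dominated convergence.\<close>

definition flap :: "real \<Rightarrow> ('a::euclidean_space \<Rightarrow> real) \<Rightarrow> 'a \<Rightarrow> real" where
  "flap s f x = frac_lap_const DIM('a) s / 2 * (LINT z|lborel. diff2 f x z * levy s z)"

lemma has_bochner_integral_reflect:
  fixes f :: "'a::euclidean_space \<Rightarrow> real"
  shows "has_bochner_integral lborel (\<lambda>z. f (x - z)) I \<longleftrightarrow> has_bochner_integral lborel f I"
proof -
  have "has_bochner_integral lborel (\<lambda>z. g (x - z)) I" if "has_bochner_integral lborel g I" for g :: "'a \<Rightarrow> real"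
  proof -
    have d: "distr lborel borel (\<lambda>z::'a. x - z) = lborel"
      using lborel_affine[of "-1" x] by (simp add: density_1)
    have m: "g \<in> borel_measurable borel"
      using borel_measurable_has_bochner_integral[OF that] by simp
    have "has_bochner_integral (distr lborel borel (\<lambda>z::'a. x - z)) g I"
      unfolding d by (rule that)
    then show ?thesis using m by (simp add: has_bochner_integral_iff integrable_distr_eq integral_distr)
  qed
  from this[of f] this[of "\<lambda>z. f (x - z)"] show ?thesis by auto
qed

lemma has_bochner_integral_translate:
  fixes f :: "'a::euclidean_space \<Rightarrow> real"
  shows "has_bochner_integral lborel (\<lambda>z. f (x + z)) I \<longleftrightarrow> has_bochner_integral lborel f I"
  using has_bochner_integral_reflect[of "\<lambda>z. f (x + z)" 0 I] has_bochner_integral_reflect[of f x I] by simp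

lemma lborel_integral_reflect:
  fixes f :: "'a::euclidean_space \<Rightarrow> real"
  assumes "integrable lborel (\<lambda>z. f (x + z))"
  shows "integrable lborel (\<lambda>z. f (x - z))" "(LINT z|lborel. f (x - z)) = (LINT z|lborel. f (x + z))"
  using assms has_bochner_integral_translate[of f x "LINT z|lborel. f (x + z)"]
    has_bochner_integral_reflect[of f x "LINT z|lborel. f (x + z)"]
  by (simp_all add: has_bochner_integral_iff)

text \<open>All bounds for the fractional Laplacian below come from splitting the integral at a radius
  \<open>\<rho>\<close> adapted to the point: second differences are used inside, sizes outside.\<close>

lemma diff2_levy_integral_bound:
  fixes f :: "'a::euclidean_space \<Rightarrow> real"
  assumes s: "0 < s" and \<rho>: "\<rho> > 0" and \<gamma>: "\<gamma> > 2 * s" and B: "B \<ge> 0"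
    and [measurable]: "f \<in> borel_measurable borel"
    and near: "\<And>z. norm z \<le> \<rho> \<Longrightarrow> \<bar>diff2 f x z\<bar> \<le> B * norm z powr \<gamma>"
    and far: "integrable lborel (\<lambda>z. levy_tail \<rho> s z * \<bar>f (x + z)\<bar>)"
             "(LINT z|lborel. levy_tail \<rho> s z * \<bar>f (x + z)\<bar>) \<le> E"
  shows "integrable lborel (\<lambda>z. diff2 f x z * levy s z)"
    and "(LINT z|lborel. \<bar>diff2 f x z * levy s z\<bar>) \<le>
      B * (sphere_area TYPE('a) / (\<gamma> - 2 * s) * \<rho> powr (\<gamma> - 2 * s))
      + (2 * \<bar>f x\<bar> * (sphere_area TYPE('a) / (2 * s) * \<rho> powr - (2 * s)) + 2 * E)"
proof -
  let ?g = "\<lambda>z. B * (indicator (cball 0 \<rho>) z * (norm z powr \<gamma> * levy s z))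
      + (2 * \<bar>f x\<bar> * levy_tail \<rho> s z + (levy_tail \<rho> s z * \<bar>f (x + z)\<bar> + levy_tail \<rho> s z * \<bar>f (x - z)\<bar>))"
  have tail: "levy_tail \<rho> s z * \<bar>f (x - z)\<bar> = levy_tail \<rho> s ((x - z) - x) * \<bar>f (x - z)\<bar>"
     "levy_tail \<rho> s z * \<bar>f (x + z)\<bar> = levy_tail \<rho> s ((x + z) - x) * \<bar>f (x + z)\<bar>" for z by simp_all
  have far': "integrable lborel (\<lambda>z. levy_tail \<rho> s z * \<bar>f (x - z)\<bar>)"
     "(LINT z|lborel. levy_tail \<rho> s z * \<bar>f (x - z)\<bar>) = (LINT z|lborel. levy_tail \<rho> s z * \<bar>f (x + z)\<bar>)"
    using lborel_integral_reflect[of "\<lambda>y. levy_tail \<rho> s (y - x) * \<bar>f y\<bar>" x] far(1) by simp_all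
  note nb = levy_near[OF \<gamma>, of \<rho>, where 'a = 'a] and fb = levy_far[OF s \<rho>, where 'a = 'a]
  have gi: "integrable lborel ?g"
    using nb fb far far' \<rho> by (auto intro!: Bochner_Integration.integrable_add integrable_mult_right simp: has_bochner_integral_iff)
  have le: "\<bar>diff2 f x z * levy s z\<bar> \<le> ?g z" for z
  proof (cases "norm z < \<rho>")
    case True
    have "\<bar>diff2 f x z * levy s z\<bar> \<le> B * norm z powr \<gamma> * levy s z"
      using near[of z] True by (simp add: abs_mult levy_nonneg mult_right_mono)
    moreover have "levy_tail \<rho> s z = 0" using True by (simp add: levy_tail_def)
    ultimately show ?thesis using True by (simp add: mult_ac)
  next
    case False
    have "\<bar>diff2 f x z\<bar> \<le> 2 * \<bar>f x\<bar> + (\<bar>f (x + z)\<bar> + \<bar>f (x - z)\<bar>)" by (auto simp: diff2_def)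
    then have "\<bar>diff2 f x z\<bar> * levy s z \<le> (2 * \<bar>f x\<bar> + (\<bar>f (x + z)\<bar> + \<bar>f (x - z)\<bar>)) * levy s z"
      by (intro mult_right_mono levy_nonneg)
    moreover have "levy_tail \<rho> s z = levy s z" using False by (simp add: levy_tail_def)
    moreover have "0 \<le> B * (indicator (cball 0 \<rho>) z * (norm z powr \<gamma> * levy s z))"
      using B by (simp add: levy_nonneg)
    ultimately show ?thesis by (simp add: abs_mult levy_nonneg algebra_simps)
  qed
  show i: "integrable lborel (\<lambda>z. diff2 f x z * levy s z)"
    by (rule Bochner_Integration.integrable_bound[OF gi]) (use le in \<open>auto intro!: AE_I2 order_trans[OF le]\<close>)
  have "(LINT z|lborel. \<bar>diff2 f x z * levy s z\<bar>) \<le> (LINT z|lborel. ?g z)"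
    by (rule integral_mono[OF _ gi]) (use i le in auto)
  also have "\<dots> = B * (sphere_area TYPE('a) / (\<gamma> - 2 * s) * \<rho> powr (\<gamma> - 2 * s))
      + (2 * \<bar>f x\<bar> * (sphere_area TYPE('a) / (2 * s) * \<rho> powr - (2 * s)) + 2 * (LINT z|lborel. levy_tail \<rho> s z * \<bar>f (x + z)\<bar>))"
    using nb fb far far' \<rho> by (simp add: has_bochner_integral_iff)
  finally show "(LINT z|lborel. \<bar>diff2 f x z * levy s z\<bar>) \<le>
      B * (sphere_area TYPE('a) / (\<gamma> - 2 * s) * \<rho> powr (\<gamma> - 2 * s))
      + (2 * \<bar>f x\<bar> * (sphere_area TYPE('a) / (2 * s) * \<rho> powr - (2 * s)) + 2 * E)"
    using far(2) by linarith
qed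

section \<open>Symbol classes\<close>

lemma bracket_pos [simp]: "0 < 1 + norm x" "1 + norm x \<noteq> 0"
  using norm_ge_zero[of x] by linarith+

lemma half_powr_minus: "w \<ge> 0 \<Longrightarrow> (w / 2) powr - k = 2 powr k * w powr - k" for w k :: real
  by (simp add: powr_divide powr_minus field_simps)

text \<open>The bounds on a classical symbol of order \<open>-a\<close>, stopped at order two and written with differences
  instead of derivatives: every fractional Laplacian below is an integral of second differences, and
  the cutoff functions are not twice differentiable. The increments stay below half of \<open>1 + |x|\<close>, so
  that \<open>x + z\<close> and \<open>x - z\<close> are about as far out as \<open>x\<close>.\<close>

definition symbol_bound :: "real \<Rightarrow> real \<Rightarrow> ('a::euclidean_space \<Rightarrow> real) \<Rightarrow> bool" where
  "symbol_bound a A f \<longleftrightarrow>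
     (\<forall>x. \<bar>f x\<bar> \<le> A * (1 + norm x) powr - a) \<and>
     (\<forall>x z. norm z \<le> (1 + norm x) / 2 \<longrightarrow>
        \<bar>f (x + z) - f x\<bar> \<le> A * (1 + norm x) powr (- a - 1) * norm z \<and>
        \<bar>diff2 f x z\<bar> \<le> A * (1 + norm x) powr (- a - 2) * (norm z)\<^sup>2)"

lemma symbol_boundD:
  assumes "symbol_bound a A f"
  shows "\<bar>f x\<bar> \<le> A * (1 + norm x) powr - a"
    and "norm z \<le> (1 + norm x) / 2 \<Longrightarrow> \<bar>f (x + z) - f x\<bar> \<le> A * (1 + norm x) powr (- a - 1) * norm z"
    and "norm z \<le> (1 + norm x) / 2 \<Longrightarrow> \<bar>diff2 f x z\<bar> \<le> A * (1 + norm x) powr (- a - 2) * (norm z)\<^sup>2"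
  using assms unfolding symbol_bound_def by blast+

lemma symbol_bound_nonneg: "symbol_bound a A f \<Longrightarrow> A \<ge> 0"
  using symbol_boundD(1)[of a A f 0] by simp

lemma symbol_bound_mono:
  assumes f: "symbol_bound a A f" and "A \<le> B" "b \<le> a"
  shows "symbol_bound b B f"
proof -
  have *: "A * (1 + norm x) powr (- a - d) \<le> B * (1 + norm x) powr (- b - d)" for x :: 'a and d
    using assms symbol_bound_nonneg[OF f] by (intro mult_mono powr_mono) auto
  show ?thesis
    unfolding symbol_bound_def
  proof (intro allI impI conjI)
    fix x z :: 'a
    show "\<bar>f x\<bar> \<le> B * (1 + norm x) powr - b" using symbol_boundD(1)[OF f, of x] *[of x 0] by simp
    assume z: "norm z \<le> (1 + norm x) / 2"
    show "\<bar>f (x + z) - f x\<bar> \<le> B * (1 + norm x) powr (- b - 1) * norm z"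
      by (rule order_trans[OF symbol_boundD(2)[OF f z] mult_right_mono[OF *]]) simp
    show "\<bar>diff2 f x z\<bar> \<le> B * (1 + norm x) powr (- b - 2) * (norm z)\<^sup>2"
      by (rule order_trans[OF symbol_boundD(3)[OF f z] mult_right_mono[OF *]]) simp
  qed
qed

lemma symbol_bound_cmult:
  assumes f: "symbol_bound a A f"
  shows "symbol_bound a (\<bar>c\<bar> * A) (\<lambda>x. c * f x)"
proof -
  have d: "diff2 (\<lambda>x. c * f x) x z = c * diff2 f x z" for x z by (simp add: diff2_def algebra_simps)
  show ?thesis
    unfolding symbol_bound_def d right_diff_distrib[symmetric] abs_mult mult.assoc
    using symbol_boundD[OF f] by (auto intro!: mult_left_mono simp: mult.assoc)
qed

lemma symbol_bound_add:
  assumes f: "symbol_bound a A f" and g: "symbol_bound a B g"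
  shows "symbol_bound a (A + B) (\<lambda>x. f x + g x)"
  unfolding symbol_bound_def
proof (intro allI impI conjI)
  fix x z :: 'a
  have "\<bar>p + q\<bar> \<le> (A + B) * c" if "\<bar>p\<bar> \<le> A * c" "\<bar>q\<bar> \<le> B * c" for p q c
    using that abs_triangle_ineq[of p q] by (simp add: distrib_right)
  note tri = this
  show "\<bar>f x + g x\<bar> \<le> (A + B) * (1 + norm x) powr - a"
    using symbol_boundD(1)[OF f, of x] symbol_boundD(1)[OF g, of x] by (rule tri)
  assume z: "norm z \<le> (1 + norm x) / 2"
  have "\<bar>(f (x + z) - f x) + (g (x + z) - g x)\<bar> \<le> (A + B) * ((1 + norm x) powr (- a - 1) * norm z)"
    using symbol_boundD(2)[OF f z] symbol_boundD(2)[OF g z] unfolding mult.assoc by (rule tri)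
  then show "\<bar>f (x + z) + g (x + z) - (f x + g x)\<bar> \<le> (A + B) * (1 + norm x) powr (- a - 1) * norm z"
    by (simp add: algebra_simps)
  have "\<bar>diff2 f x z + diff2 g x z\<bar> \<le> (A + B) * ((1 + norm x) powr (- a - 2) * (norm z)\<^sup>2)"
    using symbol_boundD(3)[OF f z] symbol_boundD(3)[OF g z] unfolding mult.assoc by (rule tri)
  then show "\<bar>diff2 (\<lambda>x. f x + g x) x z\<bar> \<le> (A + B) * (1 + norm x) powr (- a - 2) * (norm z)\<^sup>2"
    by (simp add: diff2_def algebra_simps)
qed

lemma symbol_bound_diff:
  assumes f: "symbol_bound a A f" and g: "symbol_bound a B g"
  shows "symbol_bound a (A + B) (\<lambda>x. f x - g x)"
  using symbol_bound_add[OF f symbol_bound_cmult[OF g, of "-1"]] by simp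

lemma diff2_mult:
  "diff2 (\<lambda>x. f x * g x) x z = f x * diff2 g x z + g x * diff2 f x z
     - (f (x + z) - f x) * (g (x + z) - g x) - (f (x - z) - f x) * (g (x - z) - g x)"
  unfolding diff2_def by algebra

lemma symbol_bound_mult:
  assumes f: "symbol_bound a A f" and g: "symbol_bound b B g"
  shows "symbol_bound (a + b) (4 * (A * B)) (\<lambda>x. f x * g x)"
  unfolding symbol_bound_def
proof (intro allI impI conjI)
  note nn = symbol_bound_nonneg[OF f] symbol_bound_nonneg[OF g]
  fix x z :: 'a
  define w where "w = 1 + norm x"
  have w: "w \<ge> 1" by (simp add: w_def)
  have P: "\<bar>p * q\<bar> \<le> A * B * (w powr (- (a + b) - (j + k)) * (m * n))"
    if "\<bar>p\<bar> \<le> A * w powr (- a - j) * m" "\<bar>q\<bar> \<le> B * w powr (- b - k) * n" "m \<ge> 0" "n \<ge> 0" for p q j k m n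
  proof -
    have "\<bar>p * q\<bar> \<le> (A * w powr (- a - j) * m) * (B * w powr (- b - k) * n)"
      unfolding abs_mult using that nn by (intro mult_mono) auto
    also have "\<dots> = A * B * ((w powr (- a - j) * w powr (- b - k)) * (m * n))" by (simp add: mult_ac)
    also have "w powr (- a - j) * w powr (- b - k) = w powr (- (a + b) - (j + k))"
      by (simp flip: powr_add add: algebra_simps)
    finally show ?thesis .
  qed
  note f1 = symbol_boundD(1)[OF f, of x, folded w_def] and g1 = symbol_boundD(1)[OF g, of x, folded w_def]
  have le1: "p \<le> 4 * (A * B) * c" if "p \<le> A * B * c" "c \<ge> 0" for p c
  proof -
    have "0 \<le> A * B * c" using nn that by simp
    then show ?thesis using that(1) by (simp add: mult.assoc)
  qed
  show "\<bar>f x * g x\<bar> \<le> 4 * (A * B) * (1 + norm x) powr - (a + b)"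
    unfolding w_def[symmetric] using P[of "f x" 0 1 "g x" 0 1] f1 g1 by (intro le1) auto
  assume z: "norm z \<le> (1 + norm x) / 2"
  then have z': "norm (- z) \<le> (1 + norm x) / 2" by simp
  note f2 = symbol_boundD(2)[OF f z, folded w_def] and g2 = symbol_boundD(2)[OF g z, folded w_def]
  note f2' = symbol_boundD(2)[OF f z', folded w_def, simplified] and g2' = symbol_boundD(2)[OF g z', folded w_def, simplified]
  note f3 = symbol_boundD(3)[OF f z, folded w_def] and g3 = symbol_boundD(3)[OF g z, folded w_def]
  let ?W = "w powr (- (a + b) - 1) * norm z"
  have e1: "\<bar>f x * (g (x + z) - g x)\<bar> \<le> A * B * ?W" using P[of "f x" 0 1 "g (x + z) - g x" 1 "norm z"] f1 g2 by simp
  have e2: "\<bar>(f (x + z) - f x) * g x\<bar> \<le> A * B * ?W" using P[of "f (x + z) - f x" 1 "norm z" "g x" 0 1] f2 g1 by simp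
  have e3: "\<bar>(f (x + z) - f x) * (g (x + z) - g x)\<bar> \<le> A * B * (w powr (- (a + b) - 2) * (norm z)\<^sup>2)"
    using P[of "f (x + z) - f x" 1 "norm z" "g (x + z) - g x" 1 "norm z"] f2 g2 by (simp add: power2_eq_square)
  have e4: "\<bar>(f (x - z) - f x) * (g (x - z) - g x)\<bar> \<le> A * B * (w powr (- (a + b) - 2) * (norm z)\<^sup>2)"
    using P[of "f (x - z) - f x" 1 "norm z" "g (x - z) - g x" 1 "norm z"] f2' g2' by (simp add: power2_eq_square)
  have e5: "\<bar>f x * diff2 g x z\<bar> \<le> A * B * (w powr (- (a + b) - 2) * (norm z)\<^sup>2)"
    using P[of "f x" 0 1 "diff2 g x z" 2 "(norm z)\<^sup>2"] f1 g3 by simp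
  have e6: "\<bar>g x * diff2 f x z\<bar> \<le> A * B * (w powr (- (a + b) - 2) * (norm z)\<^sup>2)"
    using P[of "diff2 f x z" 2 "(norm z)\<^sup>2" "g x" 0 1] g1 f3 by (simp add: mult.commute)
  have "w powr (- (a + b) - 2) * (norm z)\<^sup>2 \<le> ?W"
  proof -
    have "norm z \<le> w" using z norm_ge_zero[of x] unfolding w_def by argo
    then have "w powr (- (a + b) - 2) * norm z \<le> w powr (- (a + b) - 2) * w"
      by (intro mult_left_mono) auto
    also have "\<dots> = w powr (- (a + b) - 1)" using w powr_add[of w "- (a + b) - 2" 1] by simp
    finally show ?thesis by (simp add: power2_eq_square mult.assoc[symmetric] mult_right_mono)
  qed
  then have e3': "\<bar>(f (x + z) - f x) * (g (x + z) - g x)\<bar> \<le> A * B * ?W"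
    using e3 nn mult_left_mono[of _ ?W "A * B"] by fastforce
  have "f (x + z) * g (x + z) - f x * g x = f x * (g (x + z) - g x) + (f (x + z) - f x) * g x + (f (x + z) - f x) * (g (x + z) - g x)"
    by algebra
  then have "\<bar>f (x + z) * g (x + z) - f x * g x\<bar> \<le> 3 * (A * B * ?W)" using e1 e2 e3' by linarith
  moreover have "A * B * ?W \<ge> 0" using nn by simp
  ultimately show "\<bar>f (x + z) * g (x + z) - f x * g x\<bar> \<le> 4 * (A * B) * (1 + norm x) powr (- (a + b) - 1) * norm z"
    unfolding w_def[symmetric] mult.assoc by linarith
  show "\<bar>diff2 (\<lambda>x. f x * g x) x z\<bar> \<le> 4 * (A * B) * (1 + norm x) powr (- (a + b) - 2) * (norm z)\<^sup>2"
    unfolding w_def[symmetric] mult.assoc diff2_mult using e3 e4 e5 e6 unfolding mult.assoc by linarith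
qed

text \<open>If \<open>1 + |x|\<close> exceeds \<open>10 (1 + R)\<close> and \<open>|z|\<close> is at most half of \<open>1 + |x|\<close>, then the points \<open>x\<close> and
  \<open>x \<plusminus> z\<close> all lie outside the ball of radius \<open>R\<close>, so the weights matter on a bounded set only.\<close>

lemma symbol_bound_compact_support:
  fixes f :: "'a::euclidean_space \<Rightarrow> real"
  assumes R: "R > 0" and a: "a \<ge> 0" and supp: "\<And>x. R \<le> norm x \<Longrightarrow> f x = 0"
    and f0: "\<And>x. \<bar>f x\<bar> \<le> A" and f1: "\<And>x z. \<bar>f (x + z) - f x\<bar> \<le> A * norm z"
    and f2: "\<And>x z. \<bar>diff2 f x z\<bar> \<le> A * (norm z)\<^sup>2"
  shows "symbol_bound a (A * (10 * (1 + R)) powr (a + 2)) f"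
  unfolding symbol_bound_def
proof (intro allI impI conjI)
  have A: "A \<ge> 0" using f0[of 0] by simp
  fix x z :: 'a
  define Q where "Q = 10 * (1 + R)"
  have *: "c \<le> A * Q powr (a + 2) * (1 + norm x) powr (- a - d) * n"
    if c: "c \<le> A * n" "c \<noteq> 0 \<Longrightarrow> 1 + norm x \<le> Q" "0 \<le> d" "d \<le> 2" "n \<ge> 0" for c d n
  proof (cases "c = 0")
    case False
    then have w: "1 + norm x \<le> Q" using c by blast
    then have Q: "Q \<ge> 1" using norm_ge_zero[of x] by linarith
    have "Q powr (- a - d) \<le> (1 + norm x) powr (- a - d)" using w a that by (intro powr_mono2') auto
    then have "Q powr (a + 2) * Q powr (- a - d) \<le> Q powr (a + 2) * (1 + norm x) powr (- a - d)"
      by (intro mult_left_mono) auto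
    moreover have "1 \<le> Q powr (a + 2) * Q powr (- a - d)"
      using Q that by (simp flip: powr_add) (auto intro!: ge_one_powr_ge_zero)
    ultimately have "A * n * 1 \<le> A * n * (Q powr (a + 2) * (1 + norm x) powr (- a - d))"
      using A that by (intro mult_left_mono) auto
    with c show ?thesis by (simp add: mult_ac)
  qed (use A that in simp)
  have far0: "R \<le> norm x" if "\<not> 1 + norm x \<le> Q" using that R unfolding Q_def by argo
  have "\<bar>f x\<bar> \<le> A * Q powr (a + 2) * (1 + norm x) powr (- a - 0) * 1"
    by (rule *) (use f0[of x] far0 supp[of x] in auto)
  then show "\<bar>f x\<bar> \<le> A * (10 * (1 + R)) powr (a + 2) * (1 + norm x) powr - a"
    by (simp add: Q_def)
  assume z: "norm z \<le> (1 + norm x) / 2"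
  have far: "f x = 0 \<and> f (x + z) = 0 \<and> f (x - z) = 0" if "\<not> 1 + norm x \<le> Q"
  proof -
    have "R \<le> norm x" "R \<le> norm (x + z)" "R \<le> norm (x - z)"
      using that z R norm_triangle_ineq2[of x z] norm_triangle_ineq2[of x "- z"] unfolding Q_def by auto
    then show ?thesis using supp by blast
  qed
  have "\<bar>f (x + z) - f x\<bar> \<le> A * Q powr (a + 2) * (1 + norm x) powr (- a - 1) * norm z"
    by (rule *) (use f1[of x z] far in force)+
  then show "\<bar>f (x + z) - f x\<bar> \<le> A * (10 * (1 + R)) powr (a + 2) * (1 + norm x) powr (- a - 1) * norm z"
    by (simp add: Q_def)
  have "\<bar>diff2 f x z\<bar> \<le> A * Q powr (a + 2) * (1 + norm x) powr (- a - 2) * (norm z)\<^sup>2"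
    by (rule *) (use f2[of x z] far in \<open>force simp: diff2_def\<close>)+
  then show "\<bar>diff2 f x z\<bar> \<le> A * (10 * (1 + R)) powr (a + 2) * (1 + norm x) powr (- a - 2) * (norm z)\<^sup>2"
    by (simp add: Q_def)
qed

text \<open>The integral is split at half of \<open>1 + |x|\<close>. Outside, the kernel is at most a multiple of
  \<open>(1 + |x|)\<close> to the power \<open>-(N + 2 s)\<close>, and what it multiplies is integrable because \<open>a > N\<close>. This
  part dominates: the fractional Laplacian decays like the kernel, however fast the function
  does.\<close>

lemma symbol_diff2_levy_bound:
  fixes s a :: real
  assumes s: "0 < s" "s < 1" and a: "a > real DIM('a::euclidean_space)"
  obtains C where "C \<ge> 0"
    "\<And>A (f :: 'a \<Rightarrow> real) x. f \<in> borel_measurable borel \<Longrightarrow> symbol_bound a A f \<Longrightarrow>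
       integrable lborel (\<lambda>z. diff2 f x z * levy s z) \<and>
       (LINT z|lborel. \<bar>diff2 f x z * levy s z\<bar>) \<le> C * A * (1 + norm x) powr - (real DIM('a) + 2 * s)"
proof -
  let ?N = "real DIM('a)" and ?S = "sphere_area TYPE('a)"
  define c where "c = (LINT y|lborel. (1 + norm (y::'a)) powr - a)"
  have c: "c \<ge> 0" unfolding c_def by (intro integral_nonneg_AE) auto
  define C where "C = ?S / (2 - 2 * s) + (2 * (?S / (2 * s) * 2 powr (2 * s)) + 2 * (2 powr (?N + 2 * s) * c))"
  have "C \<ge> 0" using s c sphere_area_nonneg[where 'a = 'a] by (simp add: C_def)
  moreover have "integrable lborel (\<lambda>z. diff2 f x z * levy s z) \<and>
       (LINT z|lborel. \<bar>diff2 f x z * levy s z\<bar>) \<le> C * A * (1 + norm x) powr - (?N + 2 * s)"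
    if m[measurable]: "f \<in> borel_measurable borel" and f: "symbol_bound a A f" for A f and x :: 'a
  proof -
    have A: "A \<ge> 0" using f by (rule symbol_bound_nonneg)
    define w where "w = 1 + norm x"
    have w: "w \<ge> 1" by (simp add: w_def)
    have far0: "integrable lborel (\<lambda>z. (w / 2) powr - (?N + 2 * s) * (A * (1 + norm (x + z)) powr - a))"
       "(LINT z|lborel. (w / 2) powr - (?N + 2 * s) * (A * (1 + norm (x + z)) powr - a)) = (w / 2) powr - (?N + 2 * s) * (A * c)"
      using has_bochner_integral_translate[of "\<lambda>y. (1 + norm y) powr - a" x c] integrable_bracket_powr[OF a]
      by (auto simp: has_bochner_integral_iff c_def)
    have le: "levy_tail (w / 2) s z * \<bar>f (x + z)\<bar> \<le> (w / 2) powr - (?N + 2 * s) * (A * (1 + norm (x + z)) powr - a)" for z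
    proof -
      have "levy_tail (w / 2) s z \<le> (w / 2) powr - (?N + 2 * s)"
        using w s by (auto simp: levy_tail_def levy_def indicator_def intro!: powr_mono2')
      then show ?thesis using symbol_boundD(1)[OF f, of "x + z"] by (intro mult_mono) auto
    qed
    have i: "integrable lborel (\<lambda>z. levy_tail (w / 2) s z * \<bar>f (x + z)\<bar>)"
      by (rule integrable_dominated[OF far0(1)]) (measurable, use le in \<open>simp add: abs_mult levy_tail_nonneg\<close>)
    have E: "(LINT z|lborel. levy_tail (w / 2) s z * \<bar>f (x + z)\<bar>) \<le> (w / 2) powr - (?N + 2 * s) * (A * c)"
      unfolding far0(2)[symmetric] by (rule integral_mono[OF i far0(1) le])
    have near: "\<bar>diff2 f x z\<bar> \<le> A * w powr (- a - 2) * norm z powr 2" if "norm z \<le> w / 2" for z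
      using symbol_boundD(3)[OF f, of z x] that by (simp add: w_def powr_numeral)
    note D = diff2_levy_integral_bound[OF s(1), of "w / 2" 2 "A * w powr (- a - 2)" f x,
        OF _ _ _ m near i E]
    have W: "w powr (- a - 2 * s) \<le> w powr - (?N + 2 * s)" using w a by (intro powr_mono) auto
    have 1: "A * w powr (- a - 2) * (?S / (2 - 2 * s) * (w / 2) powr (2 - 2 * s)) \<le> ?S / (2 - 2 * s) * A * w powr - (?N + 2 * s)"
    proof -
      have "w powr (- a - 2) * (w / 2) powr (2 - 2 * s) \<le> w powr (- a - 2) * w powr (2 - 2 * s)"
        using w s by (intro mult_left_mono powr_mono2) auto
      also have "\<dots> = w powr (- a - 2 * s)" by (simp flip: powr_add)
      finally have "w powr (- a - 2) * (w / 2) powr (2 - 2 * s) \<le> w powr - (?N + 2 * s)" using W by simp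
      then have "(?S / (2 - 2 * s) * A) * (w powr (- a - 2) * (w / 2) powr (2 - 2 * s)) \<le> (?S / (2 - 2 * s) * A) * w powr - (?N + 2 * s)"
        using A s sphere_area_nonneg[where 'a = 'a] by (intro mult_left_mono) auto
      then show ?thesis by (simp add: mult_ac)
    qed
    have 2: "2 * \<bar>f x\<bar> * (?S / (2 * s) * (w / 2) powr - (2 * s)) \<le> 2 * (?S / (2 * s) * 2 powr (2 * s)) * A * w powr - (?N + 2 * s)"
    proof -
      have "\<bar>f x\<bar> * (w / 2) powr - (2 * s) \<le> (A * w powr - a) * (w / 2) powr - (2 * s)"
        using symbol_boundD(1)[OF f, of x] by (intro mult_right_mono) (auto simp: w_def)
      also have "\<dots> = A * 2 powr (2 * s) * w powr (- a - 2 * s)"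
        using w by (simp add: powr_divide powr_diff powr_minus field_simps)
      also have "\<dots> \<le> A * 2 powr (2 * s) * w powr - (?N + 2 * s)" using W A by (intro mult_left_mono) auto
      finally have fw: "\<bar>f x\<bar> * (w / 2) powr - (2 * s) \<le> A * 2 powr (2 * s) * w powr - (?N + 2 * s)" .
      have "(2 * (?S / (2 * s))) * (\<bar>f x\<bar> * (w / 2) powr - (2 * s)) \<le> (2 * (?S / (2 * s))) * (A * 2 powr (2 * s) * w powr - (?N + 2 * s))"
        using s sphere_area_nonneg[where 'a = 'a] by (intro mult_left_mono[OF fw]) auto
      then show ?thesis by (simp add: mult_ac)
    qed
    have 3: "2 * ((w / 2) powr - (?N + 2 * s) * (A * c)) = 2 * (2 powr (?N + 2 * s) * c) * A * w powr - (?N + 2 * s)"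
      using w half_powr_minus[of w "?N + 2 * s"] by (simp only: mult_ac)
    have "(LINT z|lborel. \<bar>diff2 f x z * levy s z\<bar>) \<le> C * A * w powr - (?N + 2 * s)"
    proof -
      have "(LINT z|lborel. \<bar>diff2 f x z * levy s z\<bar>) \<le> A * w powr (- a - 2) * (?S / (2 - 2 * s) * (w / 2) powr (2 - 2 * s))
         + (2 * \<bar>f x\<bar> * (?S / (2 * s) * (w / 2) powr - (2 * s)) + 2 * ((w / 2) powr - (?N + 2 * s) * (A * c)))"
        by (rule D(2)) (use w s A in auto)
      then show ?thesis using 1 2 3 unfolding C_def distrib_right by argo
    qed
    then show ?thesis using D(1) w s A by (auto simp: w_def)
  qed
  ultimately show ?thesis using that by blast
qed

text \<open>For a bump of height \<open>B\<close> and width \<open>r\<close>: scaling gives the bound \<open>B r\<^sup>-\<^sup>2\<^sup>s\<close> everywhere, and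
  at a distance the integrand is the kernel times the bump, whose mass is \<open>O(B r\<^sup>N)\<close>.\<close>

lemma bump_diff2_levy_bound:
  fixes s :: real
  assumes s: "0 < s" "s < 1"
  obtains C where "C \<ge> 0"
    "\<And>B r (f :: 'a::euclidean_space \<Rightarrow> real) x. r > 0 \<Longrightarrow> f \<in> borel_measurable borel \<Longrightarrow>
       (\<And>x. \<bar>f x\<bar> \<le> B) \<Longrightarrow> (\<And>x. 2 * r \<le> norm x \<Longrightarrow> f x = 0) \<Longrightarrow>
       (\<And>x z. \<bar>diff2 f x z\<bar> \<le> B / r\<^sup>2 * (norm z)\<^sup>2) \<Longrightarrow>
       integrable lborel (\<lambda>z. diff2 f x z * levy s z) \<and>
       (LINT z|lborel. \<bar>diff2 f x z * levy s z\<bar>) \<le> C * B * r powr - (2 * s) \<and>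
       (4 * r \<le> norm x \<longrightarrow> (LINT z|lborel. \<bar>diff2 f x z * levy s z\<bar>) \<le> C * B * r powr real DIM('a) * norm x powr - (real DIM('a) + 2 * s))"
proof -
  let ?N = "real DIM('a)" and ?S = "sphere_area TYPE('a)"
  note S = sphere_area_nonneg[where 'a = 'a]
  define C1 where "C1 = ?S / (2 - 2 * s) + (2 * (?S / (2 * s)) + 2 * (?S / (2 * s)))"
  define C2 where "C2 = 2 * (2 powr (?N + 2 * s) * (?S / ?N * 2 powr ?N))"
  have C: "C1 \<ge> 0" "C2 \<ge> 0" using s S by (simp_all add: C1_def C2_def)
  have "integrable lborel (\<lambda>z. diff2 f x z * levy s z) \<and>
       (LINT z|lborel. \<bar>diff2 f x z * levy s z\<bar>) \<le> (C1 + C2) * B * r powr - (2 * s) \<and>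
       (4 * r \<le> norm x \<longrightarrow> (LINT z|lborel. \<bar>diff2 f x z * levy s z\<bar>) \<le> (C1 + C2) * B * r powr ?N * norm x powr - (?N + 2 * s))"
    if r: "r > 0" and m[measurable]: "f \<in> borel_measurable borel" and fB: "\<And>x. \<bar>f x\<bar> \<le> B"
      and supp: "\<And>x. 2 * r \<le> norm x \<Longrightarrow> f x = 0"
      and d2: "\<And>x z. \<bar>diff2 f x z\<bar> \<le> B / r\<^sup>2 * (norm z)\<^sup>2" for B r f and x :: 'a
  proof -
    have B: "B \<ge> 0" using fB[of 0] by simp
    note lf = levy_far[OF s(1), where 'a = 'a]
    have fi: "integrable lborel (\<lambda>z. levy_tail \<rho> s z * \<bar>f (x + z)\<bar>)" if "\<rho> > 0" for \<rho>
      by (rule integrable_dominated[of _ "\<lambda>z. levy_tail \<rho> s z * B"])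
         (use lf[OF that] in \<open>simp add: has_bochner_integral_iff\<close>, measurable,
          use fB in \<open>simp add: abs_mult levy_tail_nonneg mult_left_mono\<close>)
    have E1: "(LINT z|lborel. levy_tail r s z * \<bar>f (x + z)\<bar>) \<le> B * (?S / (2 * s) * r powr - (2 * s))"
    proof -
      have "(LINT z|lborel. levy_tail r s z * \<bar>f (x + z)\<bar>) \<le> (LINT z|lborel. B * levy_tail r s (z::'a))"
        using fi[OF r] lf[OF r] fB
        by (intro integral_mono) (auto simp: has_bochner_integral_iff mult.commute[of B] intro!: mult_left_mono levy_tail_nonneg)
      then show ?thesis using lf[OF r] by (simp add: has_bochner_integral_iff)
    qed
    have near: "\<bar>diff2 f x z\<bar> \<le> B / r\<^sup>2 * norm z powr 2" for z using d2[of x z] by (simp add: powr_numeral)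
    note D = diff2_levy_integral_bound[OF s(1) r, of 2 "B / r\<^sup>2" f x, OF _ _ m near fi[OF r] E1]
    have 1: "B / r\<^sup>2 * (?S / (2 - 2 * s) * r powr (2 - 2 * s)) = ?S / (2 - 2 * s) * B * r powr - (2 * s)"
      using r by (simp add: powr_diff powr_minus powr_numeral field_simps)
    have 2: "2 * \<bar>f x\<bar> * (?S / (2 * s) * r powr - (2 * s)) \<le> 2 * B * (?S / (2 * s) * r powr - (2 * s))"
      using fB[of x] s S by (intro mult_right_mono) auto
    have "(LINT z|lborel. \<bar>diff2 f x z * levy s z\<bar>) \<le> C1 * B * r powr - (2 * s)"
    proof -
      have "C1 * B * r powr - (2 * s) = ?S / (2 - 2 * s) * B * r powr - (2 * s)
          + (2 * B * (?S / (2 * s) * r powr - (2 * s)) + 2 * (B * (?S / (2 * s) * r powr - (2 * s))))"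
        by (simp add: C1_def distrib_left distrib_right)
      moreover have "2 * s < 2" "0 \<le> B / r\<^sup>2" using s B by auto
      ultimately show ?thesis using D(2) 1 2 by linarith
    qed
    moreover have "C2 * B * r powr - (2 * s) \<ge> 0" using C B by simp
    ultimately have I1: "(LINT z|lborel. \<bar>diff2 f x z * levy s z\<bar>) \<le> (C1 + C2) * B * r powr - (2 * s)"
      by (simp add: distrib_right)
    have I2: "(LINT z|lborel. \<bar>diff2 f x z * levy s z\<bar>) \<le> (C1 + C2) * B * r powr ?N * norm x powr - (?N + 2 * s)"
      if x: "4 * r \<le> norm x"
    proof -
      define \<rho> where "\<rho> = norm x / 2"
      have \<rho>: "\<rho> > 0" unfolding \<rho>_def using x r by linarith
      have fx: "f x = 0" using x r by (intro supp) auto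
      have near: "\<bar>diff2 f x z\<bar> \<le> 0 * norm z powr 2" if "norm z \<le> \<rho>" for z
      proof -
        have "2 * r \<le> norm (x + z)" "2 * r \<le> norm (x - z)"
          using that x norm_triangle_ineq2[of x z] norm_triangle_ineq2[of x "- z"] by (auto simp: \<rho>_def)
        then show ?thesis using fx supp by (simp add: diff2_def)
      qed
      have vb: "has_bochner_integral lborel (\<lambda>y::'a. indicator (cball 0 (2 * r)) y) (?S / ?N * (2 * r) powr ?N)"
      proof (rule has_bochner_integral_discrete_difference[THEN iffD1, rotated -1])
        show "has_bochner_integral lborel (\<lambda>z::'a. indicator (cball 0 (2 * r)) z * norm z powr - 0) (?S / ?N * (2 * r) powr ?N)"
          using integral_norm_powr_cball[where 'a = 'a, of 0 "2 * r"] r by (simp add: sphere_area_def)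
        show "countable {0::'a}" by simp
      qed auto
      then have vb': "has_bochner_integral lborel (\<lambda>z::'a. indicator (cball 0 (2 * r)) (x + z)) (?S / ?N * (2 * r) powr ?N)"
        using has_bochner_integral_translate[of "indicator (cball 0 (2 * r))" x] by simp
      have "(LINT z|lborel. levy_tail \<rho> s z * \<bar>f (x + z)\<bar>) \<le> (LINT z|lborel. \<rho> powr - (?N + 2 * s) * B * indicator (cball 0 (2 * r)) (x + z))"
      proof (rule integral_mono[OF fi[OF \<rho>]])
        show "integrable lborel (\<lambda>z. \<rho> powr - (?N + 2 * s) * B * indicator (cball 0 (2 * r)) (x + z))"
          using vb' by (simp add: has_bochner_integral_iff)
        fix z :: 'a
        have "levy_tail \<rho> s z \<le> \<rho> powr - (?N + 2 * s)"
          using \<rho> s by (auto simp: levy_tail_def levy_def indicator_def intro!: powr_mono2')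
        moreover have "\<bar>f (x + z)\<bar> \<le> B * indicator (cball 0 (2 * r)) (x + z)"
          using fB[of "x + z"] supp[of "x + z"] by (auto simp: indicator_def)
        ultimately show "levy_tail \<rho> s z * \<bar>f (x + z)\<bar> \<le> \<rho> powr - (?N + 2 * s) * B * indicator (cball 0 (2 * r)) (x + z)"
          unfolding mult.assoc by (intro mult_mono) auto
      qed
      also have "\<dots> = \<rho> powr - (?N + 2 * s) * B * (?S / ?N * (2 * r) powr ?N)"
        using vb' by (simp add: has_bochner_integral_iff)
      finally have E: "(LINT z|lborel. levy_tail \<rho> s z * \<bar>f (x + z)\<bar>) \<le> \<rho> powr - (?N + 2 * s) * B * (?S / ?N * (2 * r) powr ?N)" .
      note D2 = diff2_levy_integral_bound(2)[OF s(1) \<rho>, of 2 0 f x, OF _ _ m near fi[OF \<rho>] E]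
      have "(LINT z|lborel. \<bar>diff2 f x z * levy s z\<bar>) \<le> 2 * (\<rho> powr - (?N + 2 * s) * B * (?S / ?N * (2 * r) powr ?N))"
        using D2 s fx by simp
      also have "\<rho> powr - (?N + 2 * s) = 2 powr (?N + 2 * s) * norm x powr - (?N + 2 * s)"
        unfolding \<rho>_def by (rule half_powr_minus) simp
      also have "(2 * r) powr ?N = 2 powr ?N * r powr ?N" using r by (simp add: powr_mult)
      also have "2 * (2 powr (?N + 2 * s) * norm x powr - (?N + 2 * s) * B * (?S / ?N * (2 powr ?N * r powr ?N)))
         = C2 * B * r powr ?N * norm x powr - (?N + 2 * s)" by (simp add: C2_def mult_ac)
      also have "\<dots> \<le> (C1 + C2) * B * r powr ?N * norm x powr - (?N + 2 * s)"
        using C B by (intro mult_right_mono) auto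
      finally show ?thesis .
    qed
    show ?thesis using D(1) s B I1 I2 by auto
  qed
  moreover have "C1 + C2 \<ge> 0" using C by simp
  ultimately show ?thesis using that by blast
qed

section \<open>Cutoff functions\<close>

definition pos_sq :: "real \<Rightarrow> real" where "pos_sq t = (max 0 t)\<^sup>2"

text \<open>A quadratic spline climbing from 0 to 1 on the unit interval. Its derivative is Lipschitz,
  which is all the smoothness that a fractional Laplacian of order below 2 needs.\<close>

definition spline :: "real \<Rightarrow> real" where
  "spline t = 2 * pos_sq t - 4 * pos_sq (t - 1/2) + 2 * pos_sq (t - 1)"

text \<open>The squared norm keeps the composition regular at the origin.\<close>

definition cutoff :: "real \<Rightarrow> 'a::euclidean_space \<Rightarrow> real" where
  "cutoff M x = spline (2 - (norm (x /\<^sub>R M))\<^sup>2)"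

lemma spline_0: "t \<le> 0 \<Longrightarrow> spline t = 0" by (simp add: spline_def pos_sq_def)

lemma spline_1: "t \<ge> 1 \<Longrightarrow> spline t = 1"
  by (simp add: spline_def pos_sq_def power2_eq_square algebra_simps)

lemma pos_sq_diff2_nonneg: "2 * pos_sq t \<le> pos_sq (t + b) + pos_sq (t - b)"
proof -
  have *: "2 * m\<^sup>2 \<le> p\<^sup>2 + q\<^sup>2" if "0 \<le> m" "2 * m \<le> p + q" for m p q :: real
  proof -
    have "(2 * m)\<^sup>2 \<le> (p + q)\<^sup>2" using that by (intro power_mono) auto
    moreover have "(p + q)\<^sup>2 + (p - q)\<^sup>2 = 2 * p\<^sup>2 + 2 * q\<^sup>2" by (simp add: power2_eq_square algebra_simps)
    moreover have "0 \<le> (p - q)\<^sup>2" "(2 * m)\<^sup>2 = 4 * m\<^sup>2" by simp_all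
    ultimately show ?thesis by linarith
  qed
  show ?thesis unfolding pos_sq_def by (rule *) auto
qed

lemma pos_sq_diff2: "\<bar>2 * pos_sq t - pos_sq (t + b) - pos_sq (t - b)\<bar> \<le> 2 * b\<^sup>2"
proof -
  \<comment> \<open>The squares of the positive and of the negative part are both convex, and they add up to
    \<open>t\<^sup>2\<close>, whose second difference is \<open>2 b\<^sup>2\<close>.\<close>
  have sq: "x\<^sup>2 = pos_sq x + pos_sq (- x)" for x :: real by (simp add: pos_sq_def max_def)
  have "(t + b)\<^sup>2 + (t - b)\<^sup>2 - 2 * t\<^sup>2 = 2 * b\<^sup>2" by (simp add: power2_eq_square algebra_simps)
  moreover have "- (t + b) = - t - b" "- (t - b) = - t + b" by simp_all
  ultimately show ?thesis
    using sq[of t] sq[of "t + b"] sq[of "t - b"] pos_sq_diff2_nonneg[of t b] pos_sq_diff2_nonneg[of "- t" b]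
    by simp
qed

lemma pos_sq_lipschitz:
  assumes "t \<le> 2" "t' \<le> 2"
  shows "\<bar>pos_sq t' - pos_sq t\<bar> \<le> 4 * \<bar>t' - t\<bar>"
proof -
  have "pos_sq t' - pos_sq t = (max 0 t' - max 0 t) * (max 0 t' + max 0 t)" unfolding pos_sq_def by algebra
  then have "\<bar>pos_sq t' - pos_sq t\<bar> = \<bar>max 0 t' - max 0 t\<bar> * (max 0 t' + max 0 t)"
    by (simp add: abs_mult)
  also have "\<dots> \<le> \<bar>t' - t\<bar> * 4" using assms by (intro mult_mono) auto
  finally show ?thesis by simp
qed

lemma abs_combination_le:
  fixes p q r :: real
  assumes "\<bar>p\<bar> \<le> d" "\<bar>q\<bar> \<le> d" "\<bar>r\<bar> \<le> d"
  shows "\<bar>2 * p - 4 * q + 2 * r\<bar> \<le> 8 * d"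
  using assms unfolding abs_le_iff by linarith

lemma spline_lipschitz:
  assumes "t \<le> 2" "t' \<le> 2"
  shows "\<bar>spline t' - spline t\<bar> \<le> 32 * \<bar>t' - t\<bar>"
proof -
  have *: "\<bar>pos_sq (t' - c) - pos_sq (t - c)\<bar> \<le> 4 * \<bar>t' - t\<bar>" if "c \<ge> 0" for c
    using pos_sq_lipschitz[of "t - c" "t' - c"] assms that by simp
  from abs_combination_le[OF *[of 0] *[of "1/2"] *[of 1]] show ?thesis
    by (simp add: spline_def algebra_simps)
qed

lemma spline_diff2: "\<bar>2 * spline t - spline (t + b) - spline (t - b)\<bar> \<le> 16 * b\<^sup>2"
proof -
  have *: "\<bar>2 * pos_sq (t - c) - pos_sq (t + b - c) - pos_sq (t - b - c)\<bar> \<le> 2 * b\<^sup>2" for c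
  proof -
    have "t - c + b = t + b - c" "t - c - b = t - b - c" by simp_all
    from pos_sq_diff2[of "t - c" b, unfolded this] show ?thesis .
  qed
  from abs_combination_le[OF *[of 0] *[of "1/2"] *[of 1]] show ?thesis
    by (simp add: spline_def algebra_simps)
qed

lemma spline_bound:
  assumes "t \<le> 2"
  shows "\<bar>spline t\<bar> \<le> 64"
proof (cases "t \<le> 0")
  case False
  then show ?thesis using spline_lipschitz[of 0 t] spline_0[of 0] assms by simp
qed (simp add: spline_0)

lemma cutoff_eq_0: "M > 0 \<Longrightarrow> 2 * M \<le> norm x \<Longrightarrow> cutoff M x = 0"
proof -
  assume "M > 0" "2 * M \<le> norm x"
  then have "2 \<le> norm (x /\<^sub>R M)" by (simp add: field_simps)
  then have "2 * 2 \<le> (norm (x /\<^sub>R M))\<^sup>2" unfolding power2_eq_square by (intro mult_mono) auto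
  then show ?thesis unfolding cutoff_def by (intro spline_0) simp
qed

lemma cutoff_eq_1: "M > 0 \<Longrightarrow> norm x \<le> M \<Longrightarrow> cutoff M x = 1"
proof -
  assume "M > 0" "norm x \<le> M"
  then have "norm (x /\<^sub>R M) \<le> 1" by (simp add: field_simps)
  then have "(norm (x /\<^sub>R M))\<^sup>2 \<le> 1" by (simp add: power_le_one)
  then show ?thesis unfolding cutoff_def by (intro spline_1) simp
qed

lemma cutoff_bound: "\<bar>cutoff M x\<bar> \<le> 64"
  unfolding cutoff_def by (rule spline_bound) simp

lemma cutoff_measurable [measurable]: "cutoff M \<in> borel_measurable borel"
  unfolding cutoff_def[abs_def] spline_def[abs_def] pos_sq_def[abs_def] by measurable

lemma cutoff_1_diff:
  fixes x z :: "'a::euclidean_space"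
  shows "\<bar>cutoff 1 (x + z) - cutoff 1 x\<bar> \<le> 640 * norm z"
    and "\<bar>diff2 (cutoff 1) x z\<bar> \<le> 640 * (norm z)\<^sup>2"
proof -
  define t where "t = 2 - (norm x)\<^sup>2"
  have "\<bar>cutoff 1 (x + z) - cutoff 1 x\<bar> \<le> 640 * norm z \<and> \<bar>diff2 (cutoff 1) x z\<bar> \<le> 640 * (norm z)\<^sup>2"
  proof (cases "norm z \<le> 1")
    case z: False
    then have "1 \<le> (norm z)\<^sup>2" by simp
    then show ?thesis using z cutoff_bound[of 1 x] cutoff_bound[of 1 "x + z"] cutoff_bound[of 1 "x - z"]
      unfolding diff2_def by linarith
  next
    case z: True
    show ?thesis
    proof (cases "norm x \<le> 3")
      case False
      then have "2 \<le> norm x" "2 \<le> norm (x + z)" "2 \<le> norm (x - z)"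
        using z norm_triangle_ineq2[of x z] norm_triangle_ineq2[of x "- z"] by auto
      then show ?thesis using cutoff_eq_0[of 1 x] cutoff_eq_0[of 1 "x + z"] cutoff_eq_0[of 1 "x - z"]
        by (simp add: diff2_def)
    next
      case x: True
      define b where "b = 2 * (x \<bullet> z)"
      define t0 where "t0 = t - (norm z)\<^sup>2"
      have e: "(norm (x + z))\<^sup>2 = (norm x)\<^sup>2 + b + (norm z)\<^sup>2" "(norm (x - z))\<^sup>2 = (norm x)\<^sup>2 - b + (norm z)\<^sup>2"
        by (simp_all add: b_def power2_norm_eq_inner inner_add_left inner_add_right inner_diff_left inner_diff_right inner_commute)
      have c: "cutoff 1 x = spline t" "cutoff 1 (x + z) = spline (t0 - b)" "cutoff 1 (x - z) = spline (t0 + b)"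
        unfolding cutoff_def t0_def t_def by (simp_all add: e) (simp_all add: algebra_simps)
      have le2: "t \<le> 2" "t0 - b \<le> 2" "t0 \<le> 2" using e(1) zero_le_power2[of "norm (x + z)"]
        by (auto simp: t_def t0_def)
      have "\<bar>b\<bar> \<le> 2 * (norm x * norm z)" using Cauchy_Schwarz_ineq2[of x z] by (simp add: b_def)
      also have "\<dots> \<le> 2 * (3 * norm z)" using x by (intro mult_left_mono mult_right_mono) auto
      finally have b: "\<bar>b\<bar> \<le> 6 * norm z" by simp
      have zz: "(norm z)\<^sup>2 \<le> norm z" using z by (simp add: power2_eq_square mult_left_le)
      have bb: "b\<^sup>2 \<le> 36 * (norm z)\<^sup>2" using power_mono[OF b, of 2] by (simp add: power_mult_distrib)
      have 1: "\<bar>spline (t0 - b) - spline t\<bar> \<le> 32 * \<bar>t0 - b - t\<bar>" using le2 by (intro spline_lipschitz)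
      have 2: "\<bar>spline t0 - spline t\<bar> \<le> 32 * \<bar>t0 - t\<bar>" using le2 by (intro spline_lipschitz)
      have 3: "\<bar>t0 - b - t\<bar> \<le> 7 * norm z" using b zz zero_le_power2[of "norm z"] unfolding t0_def by linarith
      have 4: "\<bar>t0 - t\<bar> = (norm z)\<^sup>2" by (simp add: t0_def)
      have 5: "norm z \<ge> 0" "(norm z)\<^sup>2 \<ge> 0" by simp_all
      have "\<bar>spline (t0 - b) - spline t\<bar> \<le> 640 * norm z" using order_trans[OF 1, of "32 * (7 * norm z)"] 3 5 by simp
      moreover have "\<bar>2 * spline t - spline (t0 - b) - spline (t0 + b)\<bar> \<le> 640 * (norm z)\<^sup>2"
        using spline_diff2[of t0 b] bb 2 5 unfolding 4 abs_le_iff by argo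
      ultimately show ?thesis unfolding diff2_def c by simp
    qed
  qed
  then show "\<bar>cutoff 1 (x + z) - cutoff 1 x\<bar> \<le> 640 * norm z" "\<bar>diff2 (cutoff 1) x z\<bar> \<le> 640 * (norm z)\<^sup>2" by auto
qed

lemma cutoff_diff:
  fixes x z :: "'a::euclidean_space"
  assumes M: "M > 0"
  shows "\<bar>cutoff M (x + z) - cutoff M x\<bar> \<le> 640 / M * norm z"
    and "\<bar>diff2 (cutoff M) x z\<bar> \<le> 640 / M\<^sup>2 * (norm z)\<^sup>2"
proof -
  have c: "cutoff M y = cutoff 1 (y /\<^sub>R M)" for y :: 'a by (simp add: cutoff_def)
  show "\<bar>cutoff M (x + z) - cutoff M x\<bar> \<le> 640 / M * norm z"
    using cutoff_1_diff(1)[of "x /\<^sub>R M" "z /\<^sub>R M"] M unfolding c by (simp add: scaleR_add_right divide_inverse mult_ac)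
  show "\<bar>diff2 (cutoff M) x z\<bar> \<le> 640 / M\<^sup>2 * (norm z)\<^sup>2"
    using cutoff_1_diff(2)[of "x /\<^sub>R M" "z /\<^sub>R M"] M unfolding c diff2_def
    by (simp add: scaleR_add_right scaleR_diff_right divide_inverse power_mult_distrib power_inverse mult_ac)
qed

text \<open>The constant is bounded as \<open>M\<close> grows, so that cutoffs at infinity are uniform in the class.\<close>

lemma cutoff_symbol_bound:
  assumes M: "M > 0"
  shows "symbol_bound 0 (64000 * (1 + 1 / M)\<^sup>2) (cutoff M :: 'a::euclidean_space \<Rightarrow> real)"
  unfolding symbol_bound_def
proof (intro allI impI conjI)
  fix x z :: 'a
  define Q where "Q = 1 + 1 / M"
  have Q: "Q \<ge> 1" using M by (simp add: Q_def)
  then have Q2: "1 \<le> Q\<^sup>2" "Q \<le> Q\<^sup>2"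
    using Q mult_mono[of 1 Q 1 Q] mult_right_mono[of 1 Q Q] by (auto simp: power2_eq_square)
  have x1: "1 + norm x > 0" by simp
  show "\<bar>cutoff M x\<bar> \<le> 64000 * (1 + 1 / M)\<^sup>2 * (1 + norm x) powr - 0"
    using cutoff_bound[of M x] Q2 by (simp add: Q_def[symmetric])
  assume z: "norm z \<le> (1 + norm x) / 2"
  show "\<bar>cutoff M (x + z) - cutoff M x\<bar> \<le> 64000 * (1 + 1 / M)\<^sup>2 * (1 + norm x) powr (- 0 - 1) * norm z"
    "\<bar>diff2 (cutoff M) x z\<bar> \<le> 64000 * (1 + 1 / M)\<^sup>2 * (1 + norm x) powr (- 0 - 2) * (norm z)\<^sup>2"
  proof -
    have p: "(1 + norm x) powr (- 0 - 1) = 1 / (1 + norm x)" "(1 + norm x) powr (- 0 - 2) = 1 / (1 + norm x)\<^sup>2"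
      by (simp_all add: powr_minus divide_inverse powr_numeral)
    have "\<bar>cutoff M (x + z) - cutoff M x\<bar> \<le> 64000 * Q\<^sup>2 * (1 / (1 + norm x)) * norm z \<and>
      \<bar>diff2 (cutoff M) x z\<bar> \<le> 64000 * Q\<^sup>2 * (1 / (1 + norm x)\<^sup>2) * (norm z)\<^sup>2"
    proof (cases "1 + norm x \<le> 10 * (1 + M)")
      case False
      have "2 * M \<le> norm x" "2 * M \<le> norm (x + z)" "2 * M \<le> norm (x - z)"
        using z False M norm_triangle_ineq2[of x z] norm_triangle_ineq2[of x "- z"] by auto
      then show ?thesis using M by (simp add: cutoff_eq_0 diff2_def)
    next
      case True
      have i: "1 / M \<le> 10 * Q * (1 / (1 + norm x))"
      proof -
        have "(1 + norm x) / M \<le> 10 * (1 + M) / M" using True M by (intro divide_right_mono) auto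
        also have "\<dots> = 10 * Q" using M by (simp add: Q_def field_simps)
        finally have "(1 + norm x) / M * (1 / (1 + norm x)) \<le> 10 * Q * (1 / (1 + norm x))"
          by (intro mult_right_mono) auto
        then show ?thesis by simp
      qed
      have "640 / M * norm z \<le> 640 * (10 * Q * (1 / (1 + norm x))) * norm z"
        using mult_right_mono[OF i, of "640 * norm z"] by (simp add: mult_ac)
      also have "\<dots> \<le> 64000 * Q\<^sup>2 * (1 / (1 + norm x)) * norm z"
      proof -
        have "6400 * Q \<le> 64000 * Q\<^sup>2" using Q Q2 by simp
        from mult_right_mono[OF this, of "1 / (1 + norm x) * norm z"] x1 show ?thesis by (simp add: mult_ac)
      qed
      finally have 1: "640 / M * norm z \<le> 64000 * Q\<^sup>2 * (1 / (1 + norm x)) * norm z" .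
      have "(1 / M)\<^sup>2 \<le> (10 * Q * (1 / (1 + norm x)))\<^sup>2" using i M by (intro power_mono) auto
      then have "1 / M\<^sup>2 \<le> 100 * Q\<^sup>2 * (1 / (1 + norm x)\<^sup>2)" by (simp add: power_mult_distrib power_divide)
      from mult_right_mono[OF this, of "640 * (norm z)\<^sup>2"]
      have 2: "640 / M\<^sup>2 * (norm z)\<^sup>2 \<le> 64000 * Q\<^sup>2 * (1 / (1 + norm x)\<^sup>2) * (norm z)\<^sup>2" by (simp add: mult_ac)
      show ?thesis using cutoff_diff[OF M, of x z] 1 2 by linarith
    qed
    then show "\<bar>cutoff M (x + z) - cutoff M x\<bar> \<le> 64000 * (1 + 1 / M)\<^sup>2 * (1 + norm x) powr (- 0 - 1) * norm z"
      "\<bar>diff2 (cutoff M) x z\<bar> \<le> 64000 * (1 + 1 / M)\<^sup>2 * (1 + norm x) powr (- 0 - 2) * (norm z)\<^sup>2"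
      unfolding p Q_def[symmetric] by auto
  qed
qed

section \<open>Truncated operators and their symmetry\<close>

text \<open>For Borel functions this is membership in \<open>Ls_space s\<close>, with a weight that behaves well under
  translations.\<close>

definition tempered :: "real \<Rightarrow> ('a::euclidean_space \<Rightarrow> real) \<Rightarrow> bool" where
  "tempered s g \<longleftrightarrow> g \<in> borel_measurable borel \<and>
     integrable lborel (\<lambda>y. (1 + norm y) powr - (real DIM('a) + 2 * s) * g y)"

lemma temperedD:
  fixes g :: "'a::euclidean_space \<Rightarrow> real"
  assumes "tempered s g"
  shows tempered_measurable: "g \<in> borel_measurable borel"
    and tempered_integrable: "integrable lborel (\<lambda>y. (1 + norm y) powr - (real DIM('a) + 2 * s) * g y)"
  using assms by (simp_all add: tempered_def)

lemma powr_bracket_le: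
  fixes n k :: real
  assumes "k \<ge> 0" "n \<ge> 0"
  shows "(1 + n) powr - k \<le> 2 / (1 + n powr k)"
proof -
  have p: "1 + n powr k > 0" by (intro add_pos_nonneg) auto
  have "1 powr k \<le> (1 + n) powr k" "n powr k \<le> (1 + n) powr k"
    using assms by (intro powr_mono2; simp)+
  then have le: "1 + n powr k \<le> 2 * (1 + n) powr k" by simp
  have pp: "0 < (1 + n) powr k" using assms by simp
  have "1 / P \<le> 2 / Q" if "0 < P" "0 < Q" "Q \<le> 2 * P" for P Q :: real using that by (simp add: field_simps)
  from this[OF pp p le] show ?thesis by (simp only: powr_minus_divide)
qed

lemma Ls_space_imp_tempered:
  fixes u :: "'a::euclidean_space \<Rightarrow> real"
  assumes s: "s > 0" and u: "u \<in> Ls_space s" and c: "continuous_on (- {0}) u"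
  shows "tempered s u"
proof -
  have m[measurable]: "u \<in> borel_measurable borel"
  proof -
    have "(\<lambda>x. if x \<in> - {0} then u x else u 0) \<in> borel_measurable borel"
      using c by (intro borel_measurable_continuous_on_if) auto
    also have "(\<lambda>x. if x \<in> - {0} then u x else u 0) = u" by auto
    finally show ?thesis .
  qed
  let ?K = "real DIM('a) + 2 * s"
  have i: "integrable lborel (\<lambda>x. 2 * (\<bar>u x\<bar> / (1 + norm x powr ?K)))"
  proof -
    have "integrable lebesgue (\<lambda>x. \<bar>u x\<bar> / (1 + norm x powr ?K))" using u by (simp add: Ls_space_def)
    then have "integrable lborel (\<lambda>x. \<bar>u x\<bar> / (1 + norm x powr ?K))"
      by (subst (asm) integrable_completion) auto
    then show ?thesis by (intro integrable_mult_right)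
  qed
  show ?thesis
    unfolding tempered_def
  proof (intro conjI m, rule integrable_dominated[OF i])
    fix x :: 'a
    have w: "(1 + norm x) powr - ?K \<le> 2 / (1 + norm x powr ?K)"
      using s by (intro powr_bracket_le) auto
    have "(1 + norm x) powr - ?K * \<bar>u x\<bar> \<le> 2 / (1 + norm x powr ?K) * \<bar>u x\<bar>" by (intro mult_right_mono w) auto
    then show "\<bar>(1 + norm x) powr - ?K * u x\<bar> \<le> 2 * (\<bar>u x\<bar> / (1 + norm x powr ?K))" by (simp add: abs_mult)
  qed measurable
qed

text \<open>For \<open>|z| \<ge> \<delta>\<close> one has \<open>1 + |x + z| \<le> (1 + (1 + |x|) / \<delta>) |z|\<close>.\<close>

lemma levy_tail_le:
  fixes x z :: "'a::euclidean_space"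
  assumes s: "s > 0" and \<delta>: "\<delta> > 0"
  shows "levy_tail \<delta> s z \<le> (1 + (1 + norm x) / \<delta>) powr (real DIM('a) + 2 * s) * (1 + norm (x + z)) powr - (real DIM('a) + 2 * s)"
proof (cases "\<delta> \<le> norm z")
  case True
  let ?K = "real DIM('a) + 2 * s" and ?c = "1 + (1 + norm x) / \<delta>"
  have c: "?c > 0" using \<delta> by (intro add_pos_nonneg) auto
  have "1 + norm x = (1 + norm x) / \<delta> * \<delta>" using \<delta> by simp
  also have "\<dots> \<le> (1 + norm x) / \<delta> * norm z" using True \<delta> by (intro mult_left_mono) auto
  finally have "1 + norm (x + z) \<le> ?c * norm z"
    using norm_triangle_ineq[of x z] unfolding distrib_right by argo
  then have "(?c * norm z) powr - ?K \<le> (1 + norm (x + z)) powr - ?K"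
    using s by (intro powr_mono2') auto
  then have "?c powr ?K * (?c * norm z) powr - ?K \<le> ?c powr ?K * (1 + norm (x + z)) powr - ?K"
    by (intro mult_left_mono) auto
  moreover have "?c powr ?K * (?c * norm z) powr - ?K = norm z powr - ?K"
  proof -
    have "(?c * norm z) powr - ?K = ?c powr - ?K * norm z powr - ?K" by (rule powr_mult)
    moreover have "?c powr ?K * ?c powr - ?K = 1" using c by (simp flip: powr_add)
    ultimately show ?thesis by (simp only: mult.assoc[symmetric] mult_1)
  qed
  ultimately show ?thesis using True by (simp add: levy_tail_def levy_def)
qed (simp add: levy_tail_def)

lemma levy_tail_tempered:
  fixes g :: "'a::euclidean_space \<Rightarrow> real"
  assumes s: "s > 0" and \<delta>: "\<delta> > 0" and g: "tempered s g"
  shows "integrable lborel (\<lambda>z. levy_tail \<delta> s z * g (x + z))"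
    and "integrable lborel (\<lambda>z. levy_tail \<delta> s z * \<bar>g (x + z)\<bar>)"
    and "(LINT z|lborel. levy_tail \<delta> s z * \<bar>g (x + z)\<bar>) \<le>
      (1 + (1 + norm x) / \<delta>) powr (real DIM('a) + 2 * s) * (LINT y|lborel. (1 + norm y) powr - (real DIM('a) + 2 * s) * \<bar>g y\<bar>)"
proof -
  note [measurable] = tempered_measurable[OF g]
  let ?K = "real DIM('a) + 2 * s"
  let ?c = "(1 + (1 + norm x) / \<delta>) powr ?K"
  let ?g = "\<lambda>y. (1 + norm y) powr - ?K * \<bar>g y\<bar>"
  have "integrable lborel (\<lambda>y. \<bar>(1 + norm y) powr - ?K * g y\<bar>)"
    using tempered_integrable[OF g] by (rule integrable_abs)
  then have gi: "integrable lborel ?g" by (simp add: abs_mult)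
  then have "has_bochner_integral lborel (\<lambda>z. ?g (x + z)) (integral\<^sup>L lborel ?g)"
    unfolding has_bochner_integral_translate[of ?g] by (simp add: has_bochner_integral_iff)
  then have gx: "integrable lborel (\<lambda>z. ?c * ?g (x + z))" "(LINT z|lborel. ?c * ?g (x + z)) = ?c * integral\<^sup>L lborel ?g"
    by (simp_all add: has_bochner_integral_iff)
  have le: "levy_tail \<delta> s z * \<bar>g (x + z)\<bar> \<le> ?c * ?g (x + z)" for z
    using mult_right_mono[OF levy_tail_le[OF s \<delta>, of z x], of "\<bar>g (x + z)\<bar>"] by (simp add: mult.assoc)
  show i: "integrable lborel (\<lambda>z. levy_tail \<delta> s z * \<bar>g (x + z)\<bar>)"
    by (rule integrable_dominated[OF gx(1)]) (measurable, use le in \<open>simp add: abs_mult levy_tail_nonneg\<close>)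
  show "integrable lborel (\<lambda>z. levy_tail \<delta> s z * g (x + z))"
    by (rule integrable_dominated[OF gx(1)]) (measurable, use le in \<open>simp add: abs_mult levy_tail_nonneg\<close>)
  have "(LINT z|lborel. levy_tail \<delta> s z * \<bar>g (x + z)\<bar>) \<le> (LINT z|lborel. ?c * ?g (x + z))"
    by (rule integral_mono[OF i gx(1) le])
  then show "(LINT z|lborel. levy_tail \<delta> s z * \<bar>g (x + z)\<bar>) \<le> ?c * integral\<^sup>L lborel ?g"
    unfolding gx(2) .
qed

lemma divide_norm_powr_levy: "c / norm (z :: 'a::euclidean_space) powr (real DIM('a) + 2 * s) = levy s z * c"
  by (simp only: levy_def powr_minus divide_inverse mult.commute)

text \<open>The first form separates a multiple of \<open>g\<close> from a convolution and serves Fubini's theorem; the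
  second one stays bounded as \<open>\<delta>\<close> tends to zero.\<close>

lemma frac_lap_trunc_eq:
  fixes g :: "'a::euclidean_space \<Rightarrow> real"
  assumes s: "s > 0" and \<delta>: "\<delta> > 0" and g: "tempered s g"
  shows "frac_lap_trunc s \<delta> g x = frac_lap_const DIM('a) s *
     (integral\<^sup>L lborel (levy_tail \<delta> s :: 'a \<Rightarrow> real) * g x - (LINT z|lborel. levy_tail \<delta> s z * g (x + z)))" (is ?A)
    and "frac_lap_trunc s \<delta> g x = frac_lap_const DIM('a) s / 2 *
     (LINT z|lborel. indicator {z. \<delta> \<le> norm z} z * (diff2 g x z * levy s z))" (is ?B)
proof -
  note [measurable] = tempered_measurable[OF g]
  let ?C = "frac_lap_const DIM('a) s" and ?I = "integral\<^sup>L lborel (levy_tail \<delta> s :: 'a \<Rightarrow> real)"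
  have tl: "integrable lborel (levy_tail \<delta> s :: 'a \<Rightarrow> real)"
    using levy_far[OF s \<delta>, where 'a = 'a] by (simp add: has_bochner_integral_iff)
  note li = levy_tail_tempered(1)[OF s \<delta> g, of x]
  have h: "has_bochner_integral lborel (\<lambda>z. levy_tail \<delta> s z * (g x - g (x + z)))
     (?I * g x - (LINT z|lborel. levy_tail \<delta> s z * g (x + z)))"
    unfolding right_diff_distrib using tl li by (intro has_bochner_integral_diff) (auto simp: has_bochner_integral_iff)
  have "(LINT y:{y. \<delta> \<le> norm (x - y)}|lebesgue. (g x - g y) / norm (x - y) powr (real DIM('a) + 2 * s))
    = (LINT y|lebesgue. levy_tail \<delta> s (y - x) * (g x - g y))"
    unfolding set_lebesgue_integral_def
    by (intro Bochner_Integration.integral_cong refl)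
       (simp add: divide_norm_powr_levy levy_tail_def indicator_def norm_minus_commute levy_minus(1)[of s "_ - x", symmetric] del: levy_minus)
  also have "\<dots> = (LINT y|lborel. levy_tail \<delta> s (y - x) * (g x - g y))"
    by (intro integral_completion) measurable
  also have "\<dots> = ?I * g x - (LINT z|lborel. levy_tail \<delta> s z * g (x + z))"
    using has_bochner_integral_translate[of "\<lambda>y. levy_tail \<delta> s (y - x) * (g x - g y)" x] h
    by (simp add: has_bochner_integral_iff)
  finally show A: ?A unfolding frac_lap_trunc_def by simp
  have r: "integrable lborel (\<lambda>z. levy_tail \<delta> s z * g (x - z))"
     "(LINT z|lborel. levy_tail \<delta> s z * g (x - z)) = (LINT z|lborel. levy_tail \<delta> s z * g (x + z))"
    using lborel_integral_reflect[of "\<lambda>y. levy_tail \<delta> s (y - x) * g y" x] li by simp_all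
  have "(LINT z|lborel. indicator {z. \<delta> \<le> norm z} z * (diff2 g x z * levy s z)) =
     (LINT z|lborel. levy_tail \<delta> s z * (2 * g x) - (levy_tail \<delta> s z * g (x + z) + levy_tail \<delta> s z * g (x - z)))"
    by (intro Bochner_Integration.integral_cong refl) (simp add: levy_tail_def diff2_def algebra_simps)
  also have "\<dots> = 2 * (?I * g x - (LINT z|lborel. levy_tail \<delta> s z * g (x + z)))"
    using tl li r by simp
  finally have B: "(LINT z|lborel. indicator {z. \<delta> \<le> norm z} z * (diff2 g x z * levy s z)) =
     2 * (?I * g x - (LINT z|lborel. levy_tail \<delta> s z * g (x + z)))" .
  show ?B unfolding A B by simp
qed

lemma frac_lap_trunc_le:
  fixes g :: "'a::euclidean_space \<Rightarrow> real"
  assumes s: "s > 0" and \<delta>: "\<delta> > 0" and g: "tempered s g"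
    and i: "integrable lborel (\<lambda>z. diff2 g x z * levy s z)"
  shows "\<bar>frac_lap_trunc s \<delta> g x\<bar> \<le> \<bar>frac_lap_const DIM('a) s\<bar> / 2 * (LINT z|lborel. \<bar>diff2 g x z * levy s z\<bar>)"
proof -
  note [measurable] = tempered_measurable[OF g]
  have "\<bar>LINT z|lborel. indicator {z. \<delta> \<le> norm z} z * (diff2 g x z * levy s z)\<bar> \<le> (LINT z|lborel. \<bar>diff2 g x z * levy s z\<bar>)"
    by (rule integral_abs_bound_integral)
       (use i in \<open>auto intro!: integrable_dominated[OF integrable_abs[OF i]] split: split_indicator\<close>)
  then show ?thesis unfolding frac_lap_trunc_eq(2)[OF s \<delta> g] abs_mult by (intro mult_mono) auto
qed

lemma has_frac_lap_flap:
  fixes g :: "'a::euclidean_space \<Rightarrow> real"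
  assumes s: "s > 0" and g: "tempered s g"
    and i: "integrable lborel (\<lambda>z. diff2 g x z * levy s z)"
  shows "has_frac_lap s g x (flap s g x)"
  unfolding has_frac_lap_def
proof (rule tendsto_at_right_sequentially)
  note [measurable] = tempered_measurable[OF g]
  fix S :: "nat \<Rightarrow> real" assume S: "\<And>n. 0 < S n" "S \<longlonglongrightarrow> 0"
  have "(\<lambda>n. LINT z|lborel. indicator {z. S n \<le> norm z} z * (diff2 g x z * levy s z)) \<longlonglongrightarrow> (LINT z|lborel. diff2 g x z * levy s z)"
  proof (rule integral_dominated_convergence)
    show "integrable lborel (\<lambda>z. \<bar>diff2 g x z * levy s z\<bar>)" using i by (rule integrable_abs)
    show "AE z in lborel. (\<lambda>n. indicator {z. S n \<le> norm z} z * (diff2 g x z * levy s z)) \<longlonglongrightarrow> diff2 g x z * levy s z"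
    proof (rule eventually_mono[OF AE_lborel_singleton[of 0]])
      fix z :: 'a assume "z \<noteq> 0"
      then have "eventually (\<lambda>n. S n < norm z) sequentially" using S(2) by (intro order_tendstoD(2)[of S 0]) auto
      then show "(\<lambda>n. indicator {z. S n \<le> norm z} z * (diff2 g x z * levy s z)) \<longlonglongrightarrow> diff2 g x z * levy s z"
        by (intro tendsto_eventually, elim eventually_mono) simp
    qed
  qed (auto split: split_indicator)
  then show "(\<lambda>n. frac_lap_trunc s (S n) g x) \<longlonglongrightarrow> flap s g x"
    unfolding frac_lap_trunc_eq(2)[OF s S(1) g] flap_def by (rule tendsto_mult_left)
qed (rule zero_less_one)

lemma frac_lap_eq_flap:
  assumes "s > 0" "tempered s g" "integrable lborel (\<lambda>z. diff2 g x z * levy s z)"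
  shows "frac_lap s g x = flap s g x"
  unfolding frac_lap_def
proof (rule the_equality)
  show lim: "has_frac_lap s g x (flap s g x)" using assms by (rule has_frac_lap_flap)
  show "l = flap s g x" if "has_frac_lap s g x l" for l
    using that lim unfolding has_frac_lap_def by (rule tendsto_unique[OF trivial_limit_at_right_real])
qed

text \<open>The convolution kernel is even, so exchanging the two integrations moves it from \<open>\<phi>\<close> to \<open>u\<close>.\<close>

lemma frac_lap_trunc_symmetric:
  fixes u \<phi> :: "'a::euclidean_space \<Rightarrow> real"
  assumes s: "s > 0" and \<delta>: "\<delta> > 0" and u: "tempered s u" and \<phi>: "tempered s \<phi>"
    and b: "\<And>x. \<bar>\<phi> x\<bar> \<le> A" and supp: "\<And>x. R < norm x \<Longrightarrow> \<phi> x = 0"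
    and i: "integrable lborel (\<lambda>x. u x * \<phi> x)"
  shows "(LINT x|lborel. u x * frac_lap_trunc s \<delta> \<phi> x) = (LINT x|lborel. \<phi> x * frac_lap_trunc s \<delta> u x)"
proof -
  note [measurable] = tempered_measurable[OF u] tempered_measurable[OF \<phi>]
  let ?C = "frac_lap_const DIM('a) s" and ?I = "integral\<^sup>L lborel (levy_tail \<delta> s :: 'a \<Rightarrow> real)"
  let ?f = "\<lambda>(y, x). \<phi> y * (levy_tail \<delta> s (x - y) * u x)"
  let ?c = "(1 + (1 + R) / \<delta>) powr (real DIM('a) + 2 * s) * (LINT y|lborel. (1 + norm (y::'a)) powr - (real DIM('a) + 2 * s) * \<bar>u y\<bar>)"
  have A: "A \<ge> 0" using b[of 0] by simp
  have tr: "integrable lborel (\<lambda>x. levy_tail \<delta> s (x - y) * g x)" "(LINT x|lborel. levy_tail \<delta> s (x - y) * g x) = (LINT z|lborel. levy_tail \<delta> s z * g (y + z))"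
    if "integrable lborel (\<lambda>z. levy_tail \<delta> s z * g (y + z))" for g and y :: 'a
    using has_bochner_integral_translate[of "\<lambda>x. levy_tail \<delta> s (x - y) * g x" y] that by (auto simp: has_bochner_integral_iff)
  have fi: "integrable (lborel \<Otimes>\<^sub>M lborel) ?f"
  proof (rule lborel_pair.Fubini_integrable)
    show "integrable lborel (\<lambda>y. LINT x|lborel. norm (?f (y, x)))"
    proof (rule integrable_dominated)
      show "integrable lborel (\<lambda>y. A * ?c * indicator (cball 0 R) (y::'a))"
        by (intro integrable_mult_right integrable_real_indicator) (use emeasure_lborel_cball_finite[of "0::'a" R] in \<open>auto simp: infinity_ennreal_def\<close>)
      show "(\<lambda>y. LINT x|lborel. norm (?f (y, x))) \<in> borel_measurable lborel" by measurable
      fix y :: 'a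
      have "(LINT x|lborel. norm (?f (y, x))) = \<bar>\<phi> y\<bar> * (LINT z|lborel. levy_tail \<delta> s z * \<bar>u (y + z)\<bar>)"
        using tr(2)[OF levy_tail_tempered(2)[OF s \<delta> u, of y]] by (simp add: abs_mult levy_tail_nonneg)
      also have "\<dots> \<le> A * ?c * indicator (cball 0 R) y"
      proof (cases "norm y \<le> R")
        case True
        have "(LINT z|lborel. levy_tail \<delta> s z * \<bar>u (y + z)\<bar>) \<le> ?c"
        proof (rule order_trans[OF levy_tail_tempered(3)[OF s \<delta> u]], rule mult_right_mono)
          show "(1 + (1 + norm y) / \<delta>) powr (real DIM('a) + 2 * s) \<le> (1 + (1 + R) / \<delta>) powr (real DIM('a) + 2 * s)"
            using True \<delta> s by (intro powr_mono2) (auto intro!: divide_right_mono add_nonneg_nonneg)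
        qed (auto intro!: integral_nonneg_AE)
        then show ?thesis using True A b[of y]
          by (auto intro!: mult_mono integral_nonneg_AE simp: levy_tail_nonneg)
      qed (use supp in simp)
      finally show "\<bar>LINT x|lborel. norm (?f (y, x))\<bar> \<le> A * ?c * indicator (cball 0 R) y"
        by (simp add: abs_of_nonneg integral_nonneg_AE)
    qed
    show "AE y in lborel. integrable lborel (\<lambda>x. ?f (y, x))"
      using tr(1)[OF levy_tail_tempered(1)[OF s \<delta> u]] by auto
  qed measurable
  have "(LINT x|lborel. u x * (LINT z|lborel. levy_tail \<delta> s z * \<phi> (x + z))) = (LINT x|lborel. LINT y|lborel. ?f (y, x))"
  proof (intro Bochner_Integration.integral_cong refl)
    fix x :: 'a
    have "(LINT y|lborel. ?f (y, x)) = (LINT y|lborel. u x * (levy_tail \<delta> s (y - x) * \<phi> y))"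
      by (intro Bochner_Integration.integral_cong refl) (simp add: levy_commute[of _ _ x] mult_ac)
    then show "u x * (LINT z|lborel. levy_tail \<delta> s z * \<phi> (x + z)) = (LINT y|lborel. ?f (y, x))"
      using tr(2)[OF levy_tail_tempered(1)[OF s \<delta> \<phi>, of x]] by simp
  qed
  also have "\<dots> = (LINT y|lborel. LINT x|lborel. ?f (y, x))"
    using lborel_pair.Fubini_integral[of "\<lambda>x y. ?f (y, x)"] lborel_pair.integrable_product_swap[OF fi] by (simp add: case_prod_beta')
  also have "\<dots> = (LINT x|lborel. \<phi> x * (LINT z|lborel. levy_tail \<delta> s z * u (x + z)))"
    using tr(2)[OF levy_tail_tempered(1)[OF s \<delta> u]] by simp
  finally have eq: "(LINT x|lborel. u x * (LINT z|lborel. levy_tail \<delta> s z * \<phi> (x + z))) = (LINT x|lborel. \<phi> x * (LINT z|lborel. levy_tail \<delta> s z * u (x + z)))" .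
  have i1: "integrable lborel (\<lambda>x. \<phi> x * (LINT z|lborel. levy_tail \<delta> s z * u (x + z)))"
    using lborel_pair.integrable_fst'[OF fi] tr(2)[OF levy_tail_tempered(1)[OF s \<delta> u]] by simp
  have i2: "integrable lborel (\<lambda>x. u x * (LINT z|lborel. levy_tail \<delta> s z * \<phi> (x + z)))"
  proof -
    have "integrable lborel (\<lambda>x. LINT y|lborel. ?f (y, x))" using lborel_pair.integrable_fst'[OF lborel_pair.integrable_product_swap[OF fi]] by (simp add: case_prod_beta')
    moreover have "(LINT y|lborel. ?f (y, x)) = u x * (LINT z|lborel. levy_tail \<delta> s z * \<phi> (x + z))" for x
    proof -
      have "(LINT y|lborel. ?f (y, x)) = (LINT y|lborel. u x * (levy_tail \<delta> s (y - x) * \<phi> y))"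
        by (intro Bochner_Integration.integral_cong refl) (simp add: levy_commute[of _ _ x] mult_ac)
      then show ?thesis using tr(2)[OF levy_tail_tempered(1)[OF s \<delta> \<phi>, of x]] by simp
    qed
    ultimately show ?thesis by simp
  qed
  have "(LINT x|lborel. u x * frac_lap_trunc s \<delta> \<phi> x) = (LINT x|lborel. ?C * (?I * (u x * \<phi> x)) - ?C * (u x * (LINT z|lborel. levy_tail \<delta> s z * \<phi> (x + z))))"
    unfolding frac_lap_trunc_eq(1)[OF s \<delta> \<phi>] by (intro Bochner_Integration.integral_cong refl) (simp add: algebra_simps)
  also have "\<dots> = ?C * (?I * (LINT x|lborel. u x * \<phi> x)) - ?C * (LINT x|lborel. u x * (LINT z|lborel. levy_tail \<delta> s z * \<phi> (x + z)))"
    using i i2 by simp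
  also have "\<dots> = ?C * (?I * (LINT x|lborel. u x * \<phi> x)) - ?C * (LINT x|lborel. \<phi> x * (LINT z|lborel. levy_tail \<delta> s z * u (x + z)))"
    unfolding eq ..
  also have "\<dots> = (LINT x|lborel. ?C * (?I * (u x * \<phi> x)) - ?C * (\<phi> x * (LINT z|lborel. levy_tail \<delta> s z * u (x + z))))"
    using i i1 by simp
  also have "\<dots> = (LINT x|lborel. \<phi> x * frac_lap_trunc s \<delta> u x)"
    unfolding frac_lap_trunc_eq(1)[OF s \<delta> u] by (intro Bochner_Integration.integral_cong refl) (simp add: algebra_simps)
  finally show ?thesis .
qed

text \<open>The equation, tested against functions supported away from the origin. The pointwise limit
  defining the fractional Laplacian of \<open>u\<close> is dominated on the support of \<open>\<phi>\<close> because the second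
  differences of \<open>u\<close> are uniformly small there.\<close>

lemma frac_lap_pairing_local:
  fixes u \<phi> F :: "'a::euclidean_space \<Rightarrow> real"
  assumes s: "0 < s" "s < 1" and u: "tempered s u"
    and \<phi>m: "\<phi> \<in> borel_measurable borel" and \<phi>: "symbol_bound a A \<phi>" and a: "a > real DIM('a)"
    and K: "\<And>x. x \<in> K \<Longrightarrow> norm x \<le> R" "\<And>x. x \<notin> K \<Longrightarrow> \<phi> x = 0"
    and \<gamma>: "\<gamma> > 2 * s" and r: "r > 0" and B: "B \<ge> 0"
    and d2: "\<And>x z. x \<in> K \<Longrightarrow> norm z \<le> r \<Longrightarrow> \<bar>diff2 u x z\<bar> \<le> B * norm z powr \<gamma>"
    and U: "\<And>x. x \<in> K \<Longrightarrow> \<bar>u x\<bar> \<le> U"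
    and F: "\<And>x. x \<in> K \<Longrightarrow> has_frac_lap s u x (F x)"
  shows "integrable lborel (\<lambda>x. \<phi> x * F x)"
    and "(LINT x|lborel. u x * flap s \<phi> x) = (LINT x|lborel. \<phi> x * F x)"
proof -
  note um[measurable] = tempered_measurable[OF u] and \<phi>m[measurable]
  let ?N = "real DIM('a)" and ?S = "sphere_area TYPE('a)" and ?C = "frac_lap_const DIM('a) s"
  have A: "A \<ge> 0" using \<phi> by (rule symbol_bound_nonneg)
  have \<phi>0: "\<bar>\<phi> x\<bar> \<le> A" for x
  proof -
    have "(1 + norm x) powr - a \<le> (1 + norm x) powr 0" using a by (intro powr_mono) auto
    then show ?thesis using order_trans[OF symbol_boundD(1)[OF \<phi>, of x] mult_left_mono[OF _ A, of _ 1]] by simp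
  qed
  have \<phi>R: "R < norm x \<Longrightarrow> \<phi> x = 0" for x using K(1)[of x] K(2)[of x] by linarith
  have cb: "integrable lborel (indicator (cball 0 R) :: 'a \<Rightarrow> real)"
    by (intro integrable_real_indicator) (use emeasure_lborel_cball_finite[of "0::'a" R] in \<open>auto simp: infinity_ennreal_def\<close>)
  have \<phi>t: "tempered s \<phi>"
    unfolding tempered_def
  proof (intro conjI \<phi>m, rule integrable_dominated)
    show "integrable lborel (\<lambda>y::'a. A * indicator (cball 0 R) y)" using cb by simp
    fix y :: 'a
    have "(1 + norm y) powr - (?N + 2 * s) \<le> (1 + norm y) powr 0" using s by (intro powr_mono) auto
    then have "(1 + norm y) powr - (?N + 2 * s) * \<bar>\<phi> y\<bar> \<le> 1 * A"
      using \<phi>0[of y] by (intro mult_mono) auto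
    then show "\<bar>(1 + norm y) powr - (?N + 2 * s) * \<phi> y\<bar> \<le> A * indicator (cball 0 R) y"
      using \<phi>R[of y] by (auto simp: abs_mult indicator_def)
  qed measurable
  have ui: "integrable lborel (\<lambda>x. u x * \<phi> x)"
  proof (rule integrable_dominated)
    show "integrable lborel (\<lambda>y::'a. (\<bar>U\<bar> * A) * indicator (cball 0 R) y)" using cb by simp
    fix y :: 'a
    show "\<bar>u y * \<phi> y\<bar> \<le> \<bar>U\<bar> * A * indicator (cball 0 R) y"
    proof (cases "y \<in> K")
      case True
      then have "\<bar>u y\<bar> * \<bar>\<phi> y\<bar> \<le> \<bar>U\<bar> * A" using U[of y] \<phi>0[of y] A by (intro mult_mono) auto
      then show ?thesis using K(1)[OF True] by (simp add: abs_mult)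
    qed (use K(2) A in simp)
  qed measurable
  obtain C1 where C1: "C1 \<ge> 0" "\<And>x. integrable lborel (\<lambda>z. diff2 \<phi> x z * levy s z)"
    "\<And>x. (LINT z|lborel. \<bar>diff2 \<phi> x z * levy s z\<bar>) \<le> C1 * A * (1 + norm x) powr - (?N + 2 * s)"
  proof -
    obtain C1 where C1: "C1 \<ge> 0" "\<And>A (f :: 'a \<Rightarrow> real) x. f \<in> borel_measurable borel \<Longrightarrow> symbol_bound a A f \<Longrightarrow>
       integrable lborel (\<lambda>z. diff2 f x z * levy s z) \<and>
       (LINT z|lborel. \<bar>diff2 f x z * levy s z\<bar>) \<le> C1 * A * (1 + norm x) powr - (?N + 2 * s)"
      using symbol_diff2_levy_bound[OF s a] by blast
    show thesis using that[of C1] C1(1) C1(2)[OF \<phi>m \<phi>] by blast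
  qed
  define C2 where "C2 = \<bar>?C\<bar> / 2 * (B * (?S / (\<gamma> - 2 * s) * r powr (\<gamma> - 2 * s))
      + (2 * U * (?S / (2 * s) * r powr - (2 * s))
       + 2 * ((1 + (1 + R) / r) powr (?N + 2 * s) * (LINT y|lborel. (1 + norm y) powr - (?N + 2 * s) * \<bar>u y\<bar>))))"
  have C2: "\<bar>frac_lap_trunc s \<delta> u x\<bar> \<le> C2" if x: "x \<in> K" and \<delta>: "\<delta> > 0" for x \<delta>
  proof -
    note S = sphere_area_nonneg[where 'a = 'a]
    have E: "(LINT z|lborel. levy_tail r s z * \<bar>u (x + z)\<bar>) \<le> (1 + (1 + R) / r) powr (?N + 2 * s) * (LINT y|lborel. (1 + norm y) powr - (?N + 2 * s) * \<bar>u y\<bar>)"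
    proof (rule order_trans[OF levy_tail_tempered(3)[OF s(1) r u]], rule mult_right_mono)
      show "(1 + (1 + norm x) / r) powr (real DIM('a) + 2 * s) \<le> (1 + (1 + R) / r) powr (real DIM('a) + 2 * s)"
        using K(1)[OF x] r s by (intro powr_mono2) (auto intro!: divide_right_mono add_nonneg_nonneg)
    qed (auto intro!: integral_nonneg_AE)
    have near: "\<bar>diff2 u x z\<bar> \<le> B * norm z powr \<gamma>" if "norm z \<le> r" for z using d2[OF x that] .
    have D1: "integrable lborel (\<lambda>z. diff2 u x z * levy s z)"
      using diff2_levy_integral_bound(1)[OF s(1) r \<gamma> B um near levy_tail_tempered(2)[OF s(1) r u] E] by blast
    let ?V = "?S / (2 * s) * r powr - (2 * s)"
    let ?E = "(1 + (1 + R) / r) powr (?N + 2 * s) * (LINT y|lborel. (1 + norm y) powr - (?N + 2 * s) * \<bar>u y\<bar>)"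
    let ?P = "B * (?S / (\<gamma> - 2 * s) * r powr (\<gamma> - 2 * s))"
    have D2: "(LINT z|lborel. \<bar>diff2 u x z * levy s z\<bar>) \<le> ?P + (2 * \<bar>u x\<bar> * ?V + 2 * ?E)"
      using diff2_levy_integral_bound(2)[OF s(1) r \<gamma> B um near levy_tail_tempered(2)[OF s(1) r u] E] by blast
    have "2 * \<bar>u x\<bar> * ?V \<le> 2 * U * ?V"
      using U[OF x] S s by (intro mult_right_mono) auto
    then have "?P + (2 * \<bar>u x\<bar> * ?V + 2 * ?E) \<le> ?P + (2 * U * ?V + 2 * ?E)"
      by (rule add_left_mono[OF add_right_mono])
    from mult_left_mono[OF order_trans[OF D2 this], of "\<bar>?C\<bar> / 2"]
    show ?thesis
      unfolding C2_def by (rule order_trans[OF frac_lap_trunc_le[OF s(1) \<delta> u D1]]) simp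
  qed
  define \<delta> where "\<delta> n = inverse (real (Suc n))" for n
  have \<delta>: "\<delta> n > 0" for n by (simp add: \<delta>_def)
  have \<delta>0: "filterlim \<delta> (at_right 0) sequentially"
    unfolding filterlim_at \<delta>_def using LIMSEQ_inverse_real_of_nat by auto
  have tm: "frac_lap_trunc s (\<delta> n) g \<in> borel_measurable borel" if "tempered s g" for n and g :: "'a \<Rightarrow> real"
  proof -
    have [measurable]: "g \<in> borel_measurable borel" using that by (rule tempered_measurable)
    show ?thesis unfolding frac_lap_trunc_eq(1)[OF s(1) \<delta> that, abs_def] by measurable
  qed
  note [measurable] = tm[OF u] tm[OF \<phi>t]
  have L: "(\<lambda>n. LINT x|lborel. u x * frac_lap_trunc s (\<delta> n) \<phi> x) \<longlonglongrightarrow> (LINT x|lborel. u x * flap s \<phi> x)"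
  proof -
    let ?w = "\<lambda>x. \<bar>?C\<bar> / 2 * (C1 * A) * \<bar>(1 + norm x) powr - (?N + 2 * s) * u x\<bar>"
    have w: "integrable lborel ?w" by (intro integrable_mult_right integrable_abs tempered_integrable u)
    have lim: "(\<lambda>n. u x * frac_lap_trunc s (\<delta> n) \<phi> x) \<longlonglongrightarrow> u x * flap s \<phi> x" for x
      using has_frac_lap_flap[OF s(1) \<phi>t C1(2)] \<delta>0 unfolding has_frac_lap_def
      by (intro tendsto_mult_left) (rule filterlim_compose)
    have bd: "norm (u x * frac_lap_trunc s (\<delta> n) \<phi> x) \<le> ?w x" for n x
    proof -
      have "\<bar>frac_lap_trunc s (\<delta> n) \<phi> x\<bar> \<le> \<bar>?C\<bar> / 2 * (C1 * A * (1 + norm x) powr - (?N + 2 * s))"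
        by (rule order_trans[OF frac_lap_trunc_le[OF s(1) \<delta> \<phi>t C1(2)] mult_left_mono[OF C1(3)]]) simp
      from mult_left_mono[OF this, of "\<bar>u x\<bar>"] show ?thesis by (simp add: abs_mult mult_ac)
    qed
    have fm: "(\<lambda>x. u x * flap s \<phi> x) \<in> borel_measurable lborel"
      unfolding flap_def[abs_def] diff2_def[abs_def] by measurable
    show "(\<lambda>n. LINT x|lborel. u x * frac_lap_trunc s (\<delta> n) \<phi> x) \<longlonglongrightarrow> (LINT x|lborel. u x * flap s \<phi> x)"
      by (rule integral_dominated_convergence[OF fm _ w]) (measurable, use lim bd in auto)
  qed
  have R: "(\<lambda>n. LINT x|lborel. \<phi> x * frac_lap_trunc s (\<delta> n) u x) \<longlonglongrightarrow> (LINT x|lborel. \<phi> x * F x)"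
    "integrable lborel (\<lambda>x. \<phi> x * F x)"
  proof -
    let ?w = "\<lambda>x::'a. A * \<bar>C2\<bar> * indicator (cball 0 R) x"
    have w: "integrable lborel ?w" using cb by simp
    have lim: "(\<lambda>n. \<phi> x * frac_lap_trunc s (\<delta> n) u x) \<longlonglongrightarrow> \<phi> x * F x" for x
    proof (cases "x \<in> K")
      case True
      then show ?thesis using F[OF True] \<delta>0 unfolding has_frac_lap_def
        by (intro tendsto_mult_left) (rule filterlim_compose)
    qed (simp add: K)
    have bd: "norm (\<phi> x * frac_lap_trunc s (\<delta> n) u x) \<le> ?w x" for n x
    proof (cases "x \<in> K")
      case True
      then show ?thesis using \<phi>0[of x] C2[OF True \<delta>, of n] K(1)[OF True] A
        by (auto simp: abs_mult intro!: mult_mono)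
    qed (use A in \<open>simp add: K\<close>)
    have fm: "(\<lambda>x. \<phi> x * F x) \<in> borel_measurable lborel"
      by (rule borel_measurable_LIMSEQ_real[of _ "\<lambda>n x. \<phi> x * frac_lap_trunc s (\<delta> n) u x"]) (use lim in auto)
    show "(\<lambda>n. LINT x|lborel. \<phi> x * frac_lap_trunc s (\<delta> n) u x) \<longlonglongrightarrow> (LINT x|lborel. \<phi> x * F x)"
      by (rule integral_dominated_convergence[OF fm _ w]) (measurable, use lim bd in auto)
    show "integrable lborel (\<lambda>x. \<phi> x * F x)"
      by (rule integrable_dominated_convergence[where s = "\<lambda>n x. \<phi> x * frac_lap_trunc s (\<delta> n) u x", OF fm _ w]) (measurable, use lim bd in auto)
  qed
  show "integrable lborel (\<lambda>x. \<phi> x * F x)" by (rule R(2))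
  have "(LINT x|lborel. u x * frac_lap_trunc s (\<delta> n) \<phi> x) = (LINT x|lborel. \<phi> x * frac_lap_trunc s (\<delta> n) u x)" for n
    using frac_lap_trunc_symmetric[OF s(1) \<delta> u \<phi>t \<phi>0 _ ui] \<phi>R by blast
  then show "(LINT x|lborel. u x * flap s \<phi> x) = (LINT x|lborel. \<phi> x * F x)"
    using L R(1) LIMSEQ_unique by simp
qed

section \<open>Second differences of Hoelder functions\<close>

lemma frechet_derivative_basis_bound:
  fixes f :: "'a::euclidean_space \<Rightarrow> real"
  assumes "f differentiable at x"
  shows "frechet_derivative f (at x) z = (\<Sum>b\<in>Basis. (z \<bullet> b) * frechet_derivative f (at x) b)"
proof -
  have l: "linear (frechet_derivative f (at x))" using assms by (rule linear_frechet_derivative)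
  have "frechet_derivative f (at x) z = frechet_derivative f (at x) (\<Sum>b\<in>Basis. (z \<bullet> b) *\<^sub>R b)"
    by (simp only: euclidean_representation)
  also have "\<dots> = (\<Sum>b\<in>Basis. frechet_derivative f (at x) ((z \<bullet> b) *\<^sub>R b))" by (rule linear_sum[OF l])
  also have "\<dots> = (\<Sum>b\<in>Basis. (z \<bullet> b) * frechet_derivative f (at x) b)" by (simp add: linear_cmul[OF l])
  finally show ?thesis .
qed

lemma line_has_derivative:
  fixes f :: "'a::euclidean_space \<Rightarrow> real"
  assumes "f differentiable at (x + t *\<^sub>R z)"
  shows "((\<lambda>t. f (x + t *\<^sub>R z)) has_real_derivative frechet_derivative f (at (x + t *\<^sub>R z)) z) (at t)"
proof -
  let ?D = "frechet_derivative f (at (x + t *\<^sub>R z))"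
  have f: "(f has_derivative ?D) (at (x + t *\<^sub>R z))" using assms by (simp add: frechet_derivative_works)
  have "((\<lambda>t. f (x + t *\<^sub>R z)) has_derivative (\<lambda>h. ?D (h *\<^sub>R z))) (at t)"
    by (rule has_derivative_compose[of "\<lambda>t. x + t *\<^sub>R z" "\<lambda>h. h *\<^sub>R z" t UNIV f ?D, OF _ f]) (auto intro!: derivative_eq_intros)
  moreover have "?D (h *\<^sub>R z) = ?D z * h" for h
    using linear_cmul[OF linear_frechet_derivative[OF assms], of h z] by simp
  ultimately show ?thesis by (simp add: has_field_derivative_def)
qed

lemma compact_neighbourhood:
  fixes K :: "'a::euclidean_space set"
  assumes "compact K"
  shows "compact (\<Union>x\<in>K. cball x r)"
proof -
  have cb: "cball x r = (\<Union>y\<in>cball 0 r. {x + y})" for x :: 'a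
  proof safe
    fix p assume "p \<in> cball x r"
    then show "p \<in> (\<Union>y\<in>cball 0 r. {x + y})"
      by (intro UN_I[of "p - x"]) (auto simp: dist_norm norm_minus_commute)
  qed (auto simp: dist_norm)
  have "(\<Union>x\<in>K. cball x r) = (\<Union>x\<in>K. \<Union>y\<in>cball 0 r. {x + y})"
    by (rule SUP_cong[OF refl cb])
  then show ?thesis using compact_sums'[OF assms compact_cball] by simp
qed

lemma derivative_bound_unit_interval:
  fixes g :: "real \<Rightarrow> real"
  assumes "\<And>t. 0 \<le> t \<Longrightarrow> t \<le> 1 \<Longrightarrow> (g has_real_derivative g' t) (at t)"
    and "\<And>t. 0 \<le> t \<Longrightarrow> t \<le> 1 \<Longrightarrow> \<bar>g' t\<bar> \<le> M"
  shows "\<bar>g 1 - g 0\<bar> \<le> M"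
proof -
  obtain t where "0 < t" "t < 1" "g 1 - g 0 = (1 - 0) * g' t"
    using MVT2[of 0 1 g g'] assms(1) by auto
  then show ?thesis using assms(2)[of t] by simp
qed

text \<open>The mean value theorem along segments: these stay inside one ball, whatever the shape of \<open>K\<close>.\<close>

lemma C1_imp_locally_lipschitz:
  fixes h :: "'a::euclidean_space \<Rightarrow> real"
  assumes \<Omega>: "(\<Union>x\<in>K. cball x r) \<subseteq> \<Omega>" and K: "compact K"
    and d: "\<And>x. x \<in> \<Omega> \<Longrightarrow> h differentiable at x"
    and c: "\<And>b. b \<in> Basis \<Longrightarrow> continuous_on \<Omega> (\<lambda>x. frechet_derivative h (at x) b)"
  obtains C where "C \<ge> 0" "\<And>x y y'. x \<in> K \<Longrightarrow> y \<in> cball x r \<Longrightarrow> y' \<in> cball x r \<Longrightarrow> \<bar>h y - h y'\<bar> \<le> C * norm (y - y')"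
proof -
  let ?K = "\<Union>x\<in>K. cball x r"
  have "\<exists>M\<ge>0. \<forall>x\<in>?K. \<bar>frechet_derivative h (at x) b\<bar> \<le> M" if "b \<in> Basis" for b
  proof -
    have "bounded ((\<lambda>x. frechet_derivative h (at x) b) ` ?K)"
      using compact_continuous_image[OF continuous_on_subset[OF c[OF that] \<Omega>] compact_neighbourhood[OF K]]
      by (rule compact_imp_bounded)
    then obtain M where M: "\<forall>y\<in>(\<lambda>x. frechet_derivative h (at x) b) ` ?K. norm y \<le> M"
      unfolding bounded_iff by blast
    have "\<bar>frechet_derivative h (at x) b\<bar> \<le> \<bar>M\<bar>" if "x \<in> ?K" for x
      using bspec[OF M imageI[OF that]] by simp
    then show ?thesis by (intro exI[of _ "\<bar>M\<bar>"]) simp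
  qed
  then obtain M where M: "\<And>b. b \<in> Basis \<Longrightarrow> M b \<ge> 0" "\<And>b x. b \<in> Basis \<Longrightarrow> x \<in> ?K \<Longrightarrow> \<bar>frechet_derivative h (at x) b\<bar> \<le> M b"
    by metis
  have D: "\<bar>frechet_derivative h (at x) z\<bar> \<le> sum M Basis * norm z" if "x \<in> ?K" for x z
  proof -
    have "\<bar>frechet_derivative h (at x) z\<bar> \<le> (\<Sum>b\<in>Basis. \<bar>(z \<bullet> b) * frechet_derivative h (at x) b\<bar>)"
      unfolding frechet_derivative_basis_bound[OF d[OF subsetD[OF \<Omega> that]], of z] by (rule sum_abs)
    also have "\<dots> \<le> (\<Sum>b\<in>Basis. norm z * M b)"
      unfolding abs_mult using M that Basis_le_norm by (intro sum_mono mult_mono) auto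
    finally show ?thesis by (simp add: sum_distrib_left mult.commute)
  qed
  have "\<bar>h y - h y'\<bar> \<le> sum M Basis * norm (y - y')" if x: "x \<in> K" and y: "y \<in> cball x r" "y' \<in> cball x r" for x y y'
  proof -
    have in_K: "y' + t *\<^sub>R (y - y') \<in> ?K" if "0 \<le> t" "t \<le> 1" for t
    proof -
      have "y' + t *\<^sub>R (y - y') = (1 - t) *\<^sub>R y' + t *\<^sub>R y" by (simp add: algebra_simps)
      then have "y' + t *\<^sub>R (y - y') \<in> cball x r"
        using convexD[OF convex_cball y(2,1), of "1 - t" t] that by simp
      then show ?thesis using x by blast
    qed
    have "\<bar>h (y' + 1 *\<^sub>R (y - y')) - h (y' + 0 *\<^sub>R (y - y'))\<bar> \<le> sum M Basis * norm (y - y')"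
    proof (rule derivative_bound_unit_interval[of "\<lambda>t. h (y' + t *\<^sub>R (y - y'))"])
      fix t :: real assume "0 \<le> t" "t \<le> 1"
      then have t': "y' + t *\<^sub>R (y - y') \<in> ?K" by (rule in_K)
      show "((\<lambda>t. h (y' + t *\<^sub>R (y - y'))) has_real_derivative frechet_derivative h (at (y' + t *\<^sub>R (y - y'))) (y - y')) (at t)"
        by (rule line_has_derivative[OF d[OF subsetD[OF \<Omega> t']]])
      show "\<bar>frechet_derivative h (at (y' + t *\<^sub>R (y - y'))) (y - y')\<bar> \<le> sum M Basis * norm (y - y')"
        by (rule D[OF t'])
    qed
    then show ?thesis by simp
  qed
  moreover have "sum M Basis \<ge> 0" using M by (intro sum_nonneg) auto
  ultimately show ?thesis using that by blast
qed

text \<open>The function \<open>t \<mapsto> f (x + t z) + f (x - t z)\<close> has the derivative \<open>\<nabla>f (x + t z) \<bullet> z - \<nabla>f (x - t z) \<bullet> z\<close>,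
  which is of the order \<open>|z|\<^sup>1\<^sup>+\<^sup>\<alpha>\<close>.\<close>

lemma holder_partials_imp_diff2_bound:
  fixes f :: "'a::euclidean_space \<Rightarrow> real"
  assumes \<alpha>: "0 \<le> \<alpha>" "\<alpha> \<le> 1" and d: "\<And>x. x \<in> \<Omega> \<Longrightarrow> f differentiable at x"
    and \<Omega>: "(\<Union>x\<in>K. cball x r) \<subseteq> \<Omega>"
    and h: "\<And>b. b \<in> Basis \<Longrightarrow> \<exists>C\<ge>0. \<forall>x\<in>K. \<forall>y\<in>cball x r. \<forall>y'\<in>cball x r.
       \<bar>frechet_derivative f (at y) b - frechet_derivative f (at y') b\<bar> \<le> C * norm (y - y') powr \<alpha>"
  obtains B where "B \<ge> 0" "\<And>x z. x \<in> K \<Longrightarrow> norm z \<le> r \<Longrightarrow> \<bar>diff2 f x z\<bar> \<le> B * norm z powr (1 + \<alpha>)"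
proof -
  obtain C where C: "\<And>b. b \<in> Basis \<Longrightarrow> C b \<ge> 0"
    "\<And>b x y y'. b \<in> Basis \<Longrightarrow> x \<in> K \<Longrightarrow> y \<in> cball x r \<Longrightarrow> y' \<in> cball x r \<Longrightarrow>
       \<bar>frechet_derivative f (at y) b - frechet_derivative f (at y') b\<bar> \<le> C b * norm (y - y') powr \<alpha>"
    using h by metis
  have "\<bar>diff2 f x z\<bar> \<le> (2 * sum C Basis) * norm z powr (1 + \<alpha>)" if x: "x \<in> K" and z: "norm z \<le> r" for x z
  proof -
    define g where "g t = f (x + t *\<^sub>R z) + f (x + t *\<^sub>R (- z))" for t
    let ?g' = "\<lambda>t. frechet_derivative f (at (x + t *\<^sub>R z)) z + frechet_derivative f (at (x + t *\<^sub>R (- z))) (- z)"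
    have "\<bar>g 1 - g 0\<bar> \<le> 2 * sum C Basis * norm z powr (1 + \<alpha>)"
    proof (rule derivative_bound_unit_interval[of g ?g'])
      fix t :: real assume t: "0 \<le> t" "t \<le> 1"
      let ?p = "x + t *\<^sub>R z" and ?q = "x + t *\<^sub>R (- z)"
      have "t * norm z \<le> 1 * norm z" using t by (intro mult_right_mono) auto
      then have pq: "?p \<in> cball x r" "?q \<in> cball x r" using z t by (auto simp: dist_norm)
      then have pq': "?p \<in> \<Omega>" "?q \<in> \<Omega>" using x \<Omega> by blast+
      let ?D = "frechet_derivative f (at ?p) z + frechet_derivative f (at ?q) (- z)"
      show "(g has_real_derivative ?D) (at t)"
        unfolding g_def by (intro DERIV_add line_has_derivative d pq')
      have D: "?D = (\<Sum>b\<in>Basis. (z \<bullet> b) * (frechet_derivative f (at ?p) b - frechet_derivative f (at ?q) b))"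
        unfolding frechet_derivative_basis_bound[OF d[OF pq'(1)], of z] frechet_derivative_basis_bound[OF d[OF pq'(2)], of "- z"]
        by (simp add: sum.distrib[symmetric] algebra_simps)
      have "\<bar>?D\<bar> \<le> (\<Sum>b\<in>Basis. \<bar>(z \<bullet> b) * (frechet_derivative f (at ?p) b - frechet_derivative f (at ?q) b)\<bar>)"
        unfolding D by (rule sum_abs)
      also have "\<dots> \<le> (\<Sum>b\<in>Basis. norm z * (C b * (2 * norm z powr \<alpha>)))"
      proof (rule sum_mono, unfold abs_mult, rule mult_mono)
        fix b :: 'a assume b: "b \<in> Basis"
        show "\<bar>z \<bullet> b\<bar> \<le> norm z" using b by (rule Basis_le_norm)
        have "norm (?p - ?q) = 2 * t * norm z"
        proof -
          have "?p - ?q = (2 * t) *\<^sub>R z" by (simp add: scaleR_2[symmetric] algebra_simps)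
          then show ?thesis using t by simp
        qed
        also have "(2 * t * norm z) powr \<alpha> \<le> (2 * norm z) powr \<alpha>" using t \<alpha> by (intro powr_mono2) (auto simp: mult_left_le_one_le)
        also have "(2 * norm z) powr \<alpha> = 2 powr \<alpha> * norm z powr \<alpha>" by (simp add: powr_mult)
        also have "\<dots> \<le> 2 powr 1 * norm z powr \<alpha>" using \<alpha> by (intro mult_right_mono powr_mono) auto
        finally have "norm (?p - ?q) powr \<alpha> \<le> 2 * norm z powr \<alpha>" by simp
        then show "\<bar>frechet_derivative f (at ?p) b - frechet_derivative f (at ?q) b\<bar> \<le> C b * (2 * norm z powr \<alpha>)"
          by (intro order_trans[OF C(2)[OF b x pq]] mult_left_mono C(1)[OF b])
      qed auto
      also have "\<dots> = 2 * sum C Basis * norm z powr (1 + \<alpha>)"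
        by (cases "z = 0") (simp_all add: powr_add sum_distrib_left sum_distrib_right mult_ac)
      finally show "\<bar>?D\<bar> \<le> 2 * sum C Basis * norm z powr (1 + \<alpha>)" .
    qed
    moreover have "g 1 - g 0 = - diff2 f x z" by (simp add: g_def diff2_def)
    ultimately show ?thesis by simp
  qed
  moreover have "2 * sum C Basis \<ge> 0" using C by (intro mult_nonneg_nonneg sum_nonneg) auto
  ultimately show ?thesis using that by blast
qed

lemma Ck_Holder_loc_imp_continuous_on:
  fixes h :: "'a::euclidean_space \<Rightarrow> real"
  assumes \<Omega>: "open \<Omega>" and \<alpha>: "\<alpha> > 0" and h: "Ck_Holder_loc k \<alpha> \<Omega> h"
  shows "continuous_on \<Omega> h"
proof (cases k)
  case (Suc j)
  then show ?thesis using h by (auto intro!: continuous_at_imp_continuous_on differentiable_imp_continuous_within)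
next
  case 0
  show ?thesis
  proof (rule continuous_at_imp_continuous_on, rule ballI)
    fix x assume "x \<in> \<Omega>"
    then obtain e where e: "e > 0" "cball x e \<subseteq> \<Omega>" using \<Omega> open_contains_cball by blast
    then have "\<exists>C. \<forall>x'\<in>cball x e. \<forall>y\<in>cball x e. \<bar>h x' - h y\<bar> \<le> C * dist x' y powr \<alpha>"
      using h 0 compact_cball[of x e] by simp
    then obtain C where "\<forall>x'\<in>cball x e. \<forall>y\<in>cball x e. \<bar>h x' - h y\<bar> \<le> C * dist x' y powr \<alpha>" ..
    then have C: "\<bar>h y - h x\<bar> \<le> C * dist y x powr \<alpha>" if "y \<in> cball x e" for y
      using that e(1) by (metis centre_in_cball less_imp_le)
    have "((\<lambda>y. h y - h x) \<longlongrightarrow> 0) (at x)"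
    proof (rule tendsto_0_le)
      have "((\<lambda>y. dist y x) \<longlongrightarrow> dist x x) (at x)" by (intro tendsto_intros)
      then show "((\<lambda>y. dist y x powr \<alpha>) \<longlongrightarrow> 0) (at x)"
        using tendsto_zero_powrI[of "\<lambda>y. dist y x" "at x" "\<lambda>_. \<alpha>" \<alpha>] \<alpha> by simp
      show "\<forall>\<^sub>F y in at x. norm (h y - h x) \<le> norm (dist y x powr \<alpha>) * C"
        using e(1) C by (auto simp: eventually_at dist_commute mult.commute intro!: exI[of _ e])
    qed
    then show "isCont h x" unfolding isCont_def by (simp add: LIM_zero_iff)
  qed
qed

text \<open>The exponent is \<open>\<gamma>\<close> itself below 2. Above 2 the second differences are only quadratically small,
  which is enough because \<open>\<sigma> < 2\<close>.\<close>

lemma Holder_loc_imp_diff2_bound: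
  fixes u :: "'a::euclidean_space \<Rightarrow> real"
  assumes \<Omega>: "open \<Omega>" and K: "compact K" "K \<subseteq> \<Omega>" and u: "Holder_loc \<gamma> \<Omega> u"
    and \<gamma>: "\<gamma> > \<sigma>" "\<gamma> \<notin> \<nat>" and \<sigma>: "0 < \<sigma>" "\<sigma> < 2"
  obtains \<gamma>' r B where "\<gamma>' > \<sigma>" "r > 0" "B \<ge> 0"
    "\<And>x z. x \<in> K \<Longrightarrow> norm z \<le> r \<Longrightarrow> \<bar>diff2 u x z\<bar> \<le> B * norm z powr \<gamma>'"
proof -
  let ?\<alpha> = "frac \<gamma>"
  have \<alpha>: "0 < ?\<alpha>" "?\<alpha> < 1"
  proof -
    have "\<gamma> \<notin> \<int>" using \<gamma> \<sigma> by (auto simp: Nats_altdef2)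
    then show "0 < ?\<alpha>" by (simp add: frac_gt_0_iff)
  qed (simp add: frac_lt_1)
  obtain r where r: "r > 0" "(\<Union>x\<in>K. cball x r) \<subseteq> \<Omega>"
    using compact_subset_open_imp_cball_epsilon_subset[OF K(1) \<Omega> K(2)] by blast
  let ?K = "\<Union>x\<in>K. cball x r"
  have cK: "compact ?K" by (rule compact_neighbourhood[OF K(1)])
  have u': "Ck_Holder_loc (nat \<lfloor>\<gamma>\<rfloor>) ?\<alpha> \<Omega> u" using u by (simp add: Holder_loc_def)
  consider "nat \<lfloor>\<gamma>\<rfloor> = 0" | "nat \<lfloor>\<gamma>\<rfloor> = 1" | j where "nat \<lfloor>\<gamma>\<rfloor> = Suc (Suc j)"
    by (metis One_nat_def not0_implies_Suc)
  then show ?thesis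
  proof cases
    case 1
    moreover have "0 \<le> \<lfloor>\<gamma>\<rfloor>" using \<gamma> \<sigma> by simp
    ultimately have "\<lfloor>\<gamma>\<rfloor> = 0" by (metis nat_0_iff order_antisym)
    then have g: "?\<alpha> = \<gamma>" by (simp add: frac_def)
    have "\<forall>K. compact K \<and> K \<subseteq> \<Omega> \<longrightarrow> (\<exists>C. \<forall>x\<in>K. \<forall>y\<in>K. \<bar>u x - u y\<bar> \<le> C * dist x y powr \<gamma>)"
      using u' unfolding 1 g by simp
    then obtain C where C: "\<forall>x\<in>?K. \<forall>y\<in>?K. \<bar>u x - u y\<bar> \<le> C * dist x y powr \<gamma>"
      using cK r(2) by blast
    have "\<bar>diff2 u x z\<bar> \<le> (2 * \<bar>C\<bar>) * norm z powr \<gamma>" if "x \<in> K" "norm z \<le> r" for x z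
    proof -
      have "x \<in> ?K" "x + z \<in> ?K" "x - z \<in> ?K" using that r(1) by (force simp: dist_norm)+
      then have "\<bar>u x - u (x + z)\<bar> \<le> C * norm z powr \<gamma>" "\<bar>u x - u (x - z)\<bar> \<le> C * norm z powr \<gamma>"
        using bspec[OF bspec[OF C, of x], of "x + z"] bspec[OF bspec[OF C, of x], of "x - z"] by (simp_all add: dist_norm)
      moreover have "C * norm z powr \<gamma> \<le> \<bar>C\<bar> * norm z powr \<gamma>" by (intro mult_right_mono) auto
      ultimately show ?thesis unfolding diff2_def by linarith
    qed
    then show ?thesis using that[of \<gamma> r "2 * \<bar>C\<bar>"] \<gamma> r by auto
  next
    case 2
    then have "\<lfloor>\<gamma>\<rfloor> = 1" by linarith
    then have g: "1 + ?\<alpha> = \<gamma>" by (simp add: frac_def)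
    have d: "\<And>x. x \<in> \<Omega> \<Longrightarrow> u differentiable at x" using u' 2 by simp
    have h: "\<exists>C\<ge>0. \<forall>x\<in>K. \<forall>y\<in>cball x r. \<forall>y'\<in>cball x r.
       \<bar>frechet_derivative u (at y) b - frechet_derivative u (at y') b\<bar> \<le> C * norm (y - y') powr ?\<alpha>" if b: "b \<in> Basis" for b
    proof -
      have "\<forall>K. compact K \<and> K \<subseteq> \<Omega> \<longrightarrow> (\<exists>C. \<forall>x\<in>K. \<forall>y\<in>K.
          \<bar>frechet_derivative u (at x) b - frechet_derivative u (at y) b\<bar> \<le> C * dist x y powr ?\<alpha>)"
        using u' b unfolding 2 by simp
      then obtain C where C: "\<forall>x\<in>?K. \<forall>y\<in>?K. \<bar>frechet_derivative u (at x) b - frechet_derivative u (at y) b\<bar> \<le> C * dist x y powr ?\<alpha>"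
        using cK r(2) by blast
      have "\<bar>frechet_derivative u (at y) b - frechet_derivative u (at y') b\<bar> \<le> \<bar>C\<bar> * norm (y - y') powr ?\<alpha>"
        if "x \<in> K" "y \<in> cball x r" "y' \<in> cball x r" for x y y'
      proof -
        have "C * norm (y - y') powr ?\<alpha> \<le> \<bar>C\<bar> * norm (y - y') powr ?\<alpha>" by (intro mult_right_mono) auto
        moreover have "y \<in> ?K" "y' \<in> ?K" using that by blast+
        ultimately show ?thesis using bspec[OF bspec[OF C, of y], of y'] by (simp add: dist_norm)
      qed
      then show ?thesis by (intro exI[of _ "\<bar>C\<bar>"]) auto
    qed
    obtain B where "B \<ge> 0" "\<And>x z. x \<in> K \<Longrightarrow> norm z \<le> r \<Longrightarrow> \<bar>diff2 u x z\<bar> \<le> B * norm z powr (1 + ?\<alpha>)"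
      by (rule holder_partials_imp_diff2_bound[where \<alpha> = ?\<alpha>, OF _ _ d r(2) h]) (use \<alpha> in auto)
    then show ?thesis using that[of \<gamma> r B] \<gamma> r g by auto
  next
    case (3 j)
    have d: "\<And>x. x \<in> \<Omega> \<Longrightarrow> u differentiable at x" using u' 3 by simp
    have h: "\<exists>C\<ge>0. \<forall>x\<in>K. \<forall>y\<in>cball x r. \<forall>y'\<in>cball x r.
       \<bar>frechet_derivative u (at y) b - frechet_derivative u (at y') b\<bar> \<le> C * norm (y - y') powr 1" if b: "b \<in> Basis" for b
    proof -
      let ?h = "\<lambda>x. frechet_derivative u (at x) b"
      have d': "\<And>x. x \<in> \<Omega> \<Longrightarrow> ?h differentiable at x" using u' 3 b by simp
      have c': "continuous_on \<Omega> (\<lambda>x. frechet_derivative ?h (at x) b')" if "b' \<in> Basis" for b'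
        using u' 3 b that by (intro Ck_Holder_loc_imp_continuous_on[OF \<Omega> \<alpha>(1), of j]) auto
      obtain C where "C \<ge> 0" "\<And>x y y'. x \<in> K \<Longrightarrow> y \<in> cball x r \<Longrightarrow> y' \<in> cball x r \<Longrightarrow> \<bar>?h y - ?h y'\<bar> \<le> C * norm (y - y')"
        by (rule C1_imp_locally_lipschitz[OF r(2) K(1) d' c']) auto
      then show ?thesis by (intro exI[of _ C]) auto
    qed
    obtain B where "B \<ge> 0" "\<And>x z. x \<in> K \<Longrightarrow> norm z \<le> r \<Longrightarrow> \<bar>diff2 u x z\<bar> \<le> B * norm z powr (1 + 1)"
      by (rule holder_partials_imp_diff2_bound[where \<alpha> = 1, OF _ _ d r(2) h]) auto
    then show ?thesis using that[of 2 r B] \<sigma> r by auto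
  qed
qed

lemma test_function_symbol_bound:
  fixes \<phi> :: "'a::euclidean_space \<Rightarrow> real"
  assumes \<phi>: "test_function \<phi>" and a: "a \<ge> 0"
  obtains A where "symbol_bound a A \<phi>" "\<phi> \<in> borel_measurable borel"
proof -
  have Ck: "Ck_on k UNIV \<phi>" for k using \<phi> by (simp add: test_function_def)
  have "continuous_on UNIV \<phi>" using Ck[of 0] by simp
  then have m: "\<phi> \<in> borel_measurable borel" by (rule borel_measurable_continuous_onI)
  have d: "\<phi> differentiable at x" for x using Ck[of 1] by simp
  have c: "b \<in> Basis \<Longrightarrow> continuous_on UNIV (\<lambda>x. frechet_derivative \<phi> (at x) b)" for b using Ck[of 1] by simp
  have d2: "b \<in> Basis \<Longrightarrow> (\<lambda>x. frechet_derivative \<phi> (at x) b) differentiable at x" for b x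
    using Ck[of "Suc (Suc 0)"] by simp
  have c2: "b \<in> Basis \<Longrightarrow> b' \<in> Basis \<Longrightarrow> continuous_on UNIV (\<lambda>x. frechet_derivative (\<lambda>x. frechet_derivative \<phi> (at x) b) (at x) b')" for b b'
    using Ck[of "Suc (Suc 0)"] by simp
  have "bounded (closure {x. \<phi> x \<noteq> 0})" using \<phi> by (simp add: test_function_def compact_imp_bounded)
  then obtain R0 where R0: "\<And>x. x \<in> closure {x. \<phi> x \<noteq> 0} \<Longrightarrow> norm x \<le> R0" unfolding bounded_iff by blast
  define R where "R = \<bar>R0\<bar> + 1"
  have R: "R > 0" by (simp add: R_def)
  have supp: "\<phi> x = 0" if "R \<le> norm x" for x
  proof (rule ccontr)
    assume "\<phi> x \<noteq> 0"
    then have "norm x \<le> R0" using closure_subset[of "{x. \<phi> x \<noteq> 0}"] by (intro R0) auto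
    then show False using that unfolding R_def by linarith
  qed
  let ?K = "cball (0::'a) (R + 1)"
  have sub: "(\<Union>x\<in>?K. cball x 1) \<subseteq> (UNIV :: 'a set)" by simp
  obtain C1 where C1: "C1 \<ge> 0" "\<And>x y y'. x \<in> ?K \<Longrightarrow> y \<in> cball x 1 \<Longrightarrow> y' \<in> cball x 1 \<Longrightarrow> \<bar>\<phi> y - \<phi> y'\<bar> \<le> C1 * norm (y - y')"
    by (rule C1_imp_locally_lipschitz[OF sub compact_cball d c]) auto
  have h: "\<exists>C\<ge>0. \<forall>x\<in>?K. \<forall>y\<in>cball x 1. \<forall>y'\<in>cball x 1.
       \<bar>frechet_derivative \<phi> (at y) b - frechet_derivative \<phi> (at y') b\<bar> \<le> C * norm (y - y') powr 1" if b: "b \<in> Basis" for b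
  proof -
    obtain C where "C \<ge> 0" "\<And>x y y'. x \<in> ?K \<Longrightarrow> y \<in> cball x 1 \<Longrightarrow> y' \<in> cball x 1 \<Longrightarrow>
        \<bar>frechet_derivative \<phi> (at y) b - frechet_derivative \<phi> (at y') b\<bar> \<le> C * norm (y - y')"
      by (rule C1_imp_locally_lipschitz[OF sub compact_cball d2[OF b] c2[OF b]]) auto
    then show ?thesis by (intro exI[of _ C]) auto
  qed
  obtain C2 where C2: "C2 \<ge> 0" "\<And>x z. x \<in> ?K \<Longrightarrow> norm z \<le> 1 \<Longrightarrow> \<bar>diff2 \<phi> x z\<bar> \<le> C2 * norm z powr (1 + 1)"
    by (rule holder_partials_imp_diff2_bound[where \<alpha> = 1, OF _ _ d sub h]) auto
  have "bounded (\<phi> ` ?K)"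
    by (intro compact_imp_bounded compact_continuous_image continuous_on_subset[OF \<open>continuous_on UNIV \<phi>\<close>]) auto
  then obtain C0 where "\<forall>y\<in>\<phi> ` ?K. norm y \<le> C0" unfolding bounded_iff by blast
  then have C0: "\<bar>\<phi> x\<bar> \<le> C0" if "x \<in> ?K" for x using that by (metis imageI real_norm_def)
  have C0': "\<bar>\<phi> x\<bar> \<le> \<bar>C0\<bar>" for x
  proof (cases "x \<in> ?K")
    case True then show ?thesis using C0[OF True] by linarith
  qed (use supp in auto)
  define A where "A = 4 * \<bar>C0\<bar> + C1 + C2"
  have A: "\<bar>C0\<bar> \<le> A" "4 * \<bar>C0\<bar> \<le> A" "C1 \<le> A" "C2 \<le> A" "A \<ge> 0" using C1(1) C2(1) by (auto simp: A_def)
  have zero: "\<phi> x = 0 \<and> \<phi> (x + z) = 0 \<and> \<phi> (x - z) = 0" if "x \<notin> ?K" "norm z \<le> 1" for x z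
    using that norm_triangle_ineq2[of x z] norm_triangle_ineq2[of x "- z"] by (auto intro!: supp)
  have f1: "\<bar>\<phi> (x + z) - \<phi> x\<bar> \<le> A * norm z" for x z
  proof (cases "norm z \<le> 1")
    case True
    show ?thesis
    proof (cases "x \<in> ?K")
      case xK: True
      have "\<bar>\<phi> (x + z) - \<phi> x\<bar> \<le> C1 * norm z" using C1(2)[OF xK, of "x + z" x] True by (simp add: dist_norm)
      also have "\<dots> \<le> A * norm z" using A by (intro mult_right_mono) auto
      finally show ?thesis .
    qed (use zero[of x z] True A in simp)
  next
    case False
    then have "A * 1 \<le> A * norm z" using A by (intro mult_left_mono) auto
    then show ?thesis using C0'[of x] C0'[of "x + z"] A by linarith
  qed
  have f2: "\<bar>diff2 \<phi> x z\<bar> \<le> A * (norm z)\<^sup>2" for x z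
  proof (cases "norm z \<le> 1")
    case True
    show ?thesis
    proof (cases "x \<in> ?K")
      case xK: True
      have "\<bar>diff2 \<phi> x z\<bar> \<le> C2 * (norm z)\<^sup>2" using C2(2)[OF xK, of z] True by (simp add: powr_numeral)
      also have "\<dots> \<le> A * (norm z)\<^sup>2" using A by (intro mult_right_mono) auto
      finally show ?thesis .
    qed (use zero[of x z] True A in \<open>simp add: diff2_def\<close>)
  next
    case False
    then have "A * 1 \<le> A * (norm z)\<^sup>2" using A by (intro mult_left_mono) (auto simp: one_le_power)
    moreover have "\<bar>diff2 \<phi> x z\<bar> \<le> 2 * \<bar>\<phi> x\<bar> + \<bar>\<phi> (x + z)\<bar> + \<bar>\<phi> (x - z)\<bar>" unfolding diff2_def by linarith
    ultimately show ?thesis using C0'[of x] C0'[of "x + z"] C0'[of "x - z"] A(2) by linarith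
  qed
  have "\<bar>\<phi> x\<bar> \<le> A" for x using C0'[of x] A(1) by linarith
  from symbol_bound_compact_support[OF R a supp this f1 f2] show ?thesis using that m by blast
qed

section \<open>The distributional equation across the origin\<close>

lemma flap_measurable [measurable]:
  fixes f :: "'a::euclidean_space \<Rightarrow> real"
  assumes [measurable]: "f \<in> borel_measurable borel"
  shows "flap s f \<in> borel_measurable borel"
  unfolding flap_def[abs_def] diff2_def[abs_def] by measurable

lemma flap_abs_le:
  fixes f :: "'a::euclidean_space \<Rightarrow> real"
  assumes "(LINT z|lborel. \<bar>diff2 f x z * levy s z\<bar>) \<le> c"
  shows "\<bar>flap s f x\<bar> \<le> \<bar>frac_lap_const DIM('a) s\<bar> / 2 * c"
proof -
  have "\<bar>LINT z|lborel. diff2 f x z * levy s z\<bar> \<le> c"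
    using order_trans[OF integral_abs_bound assms] .
  then show ?thesis unfolding flap_def abs_mult by (intro mult_mono) auto
qed

lemma flap_cmult: "flap s (\<lambda>x. c * f x) x = c * flap s f x"
proof -
  have eq: "diff2 (\<lambda>x. c * f x) x z * levy s z = c * (diff2 f x z * levy s z)" for z
    by (simp add: diff2_def algebra_simps)
  show ?thesis by (simp only: flap_def eq) simp
qed

lemma flap_diff:
  assumes "integrable lborel (\<lambda>z. diff2 f x z * levy s z)" "integrable lborel (\<lambda>z. diff2 g x z * levy s z)"
  shows "flap s (\<lambda>x. f x - g x) x = flap s f x - flap s g x"
proof -
  have eq: "diff2 (\<lambda>x. f x - g x) x z * levy s z = diff2 f x z * levy s z - diff2 g x z * levy s z" for z
    by (simp add: diff2_def algebra_simps)
  show ?thesis using assms by (simp only: flap_def eq) (simp add: right_diff_distrib)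
qed

text \<open>A common symbol bound dominates the integrand: quadratically near zero, by the supremum and the
  tail of the kernel elsewhere.\<close>

lemma flap_tendsto:
  fixes f :: "'a::euclidean_space \<Rightarrow> real"
  assumes s: "0 < s" "s < 1" and a: "a \<ge> 0"
    and [measurable]: "\<And>n. fn n \<in> borel_measurable borel" "f \<in> borel_measurable borel"
    and fn: "\<And>n. symbol_bound a A (fn n)" and lim: "\<And>x. (\<lambda>n. fn n x) \<longlonglongrightarrow> f x"
  shows "(\<lambda>n. flap s (fn n) x) \<longlonglongrightarrow> flap s f x"
proof -
  have A: "A \<ge> 0" using fn[of 0] by (rule symbol_bound_nonneg)
  define w where "w = (1 + norm x) / 2"
  have w: "w > 0" by (simp add: w_def)
  have b: "\<bar>fn n y\<bar> \<le> A" for n y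
  proof -
    have "(1 + norm y) powr - a \<le> (1 + norm y) powr 0" using a by (intro powr_mono) auto
    then show ?thesis using order_trans[OF symbol_boundD(1)[OF fn, of n y] mult_left_mono[OF _ A, of _ 1]] by simp
  qed
  let ?g = "\<lambda>z::'a. A * (indicator (cball 0 w) z * (norm z powr 2 * levy s z)) + 4 * A * levy_tail w s z"
  have g: "integrable lborel ?g"
    using levy_near[of s 2 w, where 'a = 'a] levy_far[OF s(1) w, where 'a = 'a] s w
    by (intro Bochner_Integration.integrable_add integrable_mult_right) (auto simp: has_bochner_integral_iff)
  have "\<bar>diff2 (fn n) x z * levy s z\<bar> \<le> ?g z" for n z
  proof (cases "norm z < w")
    case True
    have "(1 + norm x) powr (- a - 2) \<le> (1 + norm x) powr 0" using a by (intro powr_mono) auto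
    then have "A * (1 + norm x) powr (- a - 2) * (norm z)\<^sup>2 \<le> A * 1 * (norm z)\<^sup>2"
      using A by (intro mult_right_mono mult_left_mono) auto
    then have "\<bar>diff2 (fn n) x z\<bar> \<le> A * norm z powr 2"
      using symbol_boundD(3)[OF fn, of z x n] True by (simp add: w_def powr_numeral)
    then have "\<bar>diff2 (fn n) x z\<bar> * levy s z \<le> A * norm z powr 2 * levy s z" by (intro mult_right_mono levy_nonneg)
    moreover have "levy_tail w s z = 0" using True by (simp add: levy_tail_def)
    ultimately show ?thesis using True by (simp add: abs_mult levy_nonneg mult_ac)
  next
    case False
    have "\<bar>diff2 (fn n) x z\<bar> \<le> 2 * \<bar>fn n x\<bar> + \<bar>fn n (x + z)\<bar> + \<bar>fn n (x - z)\<bar>" unfolding diff2_def by linarith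
    then have "\<bar>diff2 (fn n) x z\<bar> \<le> 4 * A" using b[of n x] b[of n "x + z"] b[of n "x - z"] by linarith
    then have "\<bar>diff2 (fn n) x z\<bar> * levy s z \<le> 4 * A * levy s z" by (intro mult_right_mono levy_nonneg)
    moreover have "levy_tail w s z = levy s z" using False by (simp add: levy_tail_def)
    moreover have "0 \<le> A * (indicator (cball 0 w) z * (norm z powr 2 * levy s z))" using A by (simp add: levy_nonneg)
    ultimately show ?thesis by (simp add: abs_mult levy_nonneg)
  qed
  then have "(\<lambda>n. LINT z|lborel. diff2 (fn n) x z * levy s z) \<longlonglongrightarrow> (LINT z|lborel. diff2 f x z * levy s z)"
    by (intro integral_dominated_convergence[where w = ?g] g AE_I2)
       (auto simp: diff2_def intro!: tendsto_intros lim)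
  then show ?thesis unfolding flap_def by (rule tendsto_mult_left)
qed

text \<open>The setting for the distributional equation; \<open>u\<close> and \<open>F\<close> may change sign. The number \<open>dec\<close> is the decay of a
  difference of two bubbles; it is a parameter because a constant of type \<open>real\<close> cannot depend on the
  dimension of the space. Its role is to exceed \<open>N\<close>, which makes fractional Laplacians integrable
  against \<open>u\<close>, and \<open>N - 2 s\<close>, which makes the functions themselves integrable against \<open>F\<close>.\<close>

locale punctured_equation =
  fixes s dec :: real and u F :: "'a::euclidean_space \<Rightarrow> real"
  assumes dec_def: "dec = real DIM('a) + 2 - 2 * s" and s: "0 < s" "s < 1" and N2s: "2 * s < real DIM('a)"
    and u: "tempered s u"
    and u_cont: "continuous_on (- {0}) u"
    and u_reg: "\<And>K. compact K \<Longrightarrow> K \<subseteq> - {0} \<Longrightarrow>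
       \<exists>\<gamma>>2 * s. \<exists>r>0. \<exists>B\<ge>0. \<forall>x\<in>K. \<forall>z. norm z \<le> r \<longrightarrow> \<bar>diff2 u x z\<bar> \<le> B * norm z powr \<gamma>"
    and eq: "\<And>x. x \<noteq> 0 \<Longrightarrow> has_frac_lap s u x (F x)"
    and F_int: "integrable lebesgue (\<lambda>y. F y * (1 + norm y) powr - (real DIM('a) - 2 * s))"
    and u_bound: "\<exists>C r. 0 < r \<and> (\<forall>x. x \<noteq> 0 \<longrightarrow> norm x \<le> r \<longrightarrow> \<bar>u x\<bar> \<le> C * norm x powr - (real DIM('a) - 2 * s))"
begin

lemma dec: "dec > real DIM('a)" "dec \<ge> 0" "dec \<ge> real DIM('a) - 2 * s"
  using s unfolding dec_def by auto

lemma u_measurable [measurable]: "u \<in> borel_measurable borel"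
  using u by (rule tempered_measurable)

lemma F_measurable [measurable]: "F \<in> borel_measurable lebesgue"
proof -
  have "(\<lambda>y. F y * (1 + norm y) powr - (real DIM('a) - 2 * s) * (1 + norm y) powr (real DIM('a) - 2 * s)) \<in> borel_measurable lebesgue"
    by (rule borel_measurable_times[OF borel_measurable_integrable[OF F_int]]) (intro measurable_completion, simp)
  also have "(\<lambda>y. F y * (1 + norm y) powr - (real DIM('a) - 2 * s) * (1 + norm y) powr (real DIM('a) - 2 * s)) = F"
    by (simp add: fun_eq_iff mult.assoc powr_add[symmetric])
  finally show ?thesis .
qed

lemma F_mult_integrable:
  assumes [measurable]: "f \<in> borel_measurable borel" and f: "\<And>y. \<bar>f y\<bar> \<le> A * (1 + norm y) powr - (real DIM('a) - 2 * s)"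
  shows "integrable lebesgue (\<lambda>y. F y * f y)"
proof (rule integrable_dominated)
  show "integrable lebesgue (\<lambda>y. A * \<bar>F y * (1 + norm y) powr - (real DIM('a) - 2 * s)\<bar>)"
    using F_int by simp
  show "(\<lambda>y. F y * f y) \<in> borel_measurable lebesgue"
    by (intro borel_measurable_times F_measurable measurable_completion) simp
  fix y
  show "\<bar>F y * f y\<bar> \<le> A * \<bar>F y * (1 + norm y) powr - (real DIM('a) - 2 * s)\<bar>"
    using mult_left_mono[OF f, of "\<bar>F y\<bar>" y] by (simp add: abs_mult mult_ac)
qed

lemma symbol_le:
  assumes "symbol_bound dec A f"
  shows "\<bar>f y\<bar> \<le> A * (1 + norm y) powr - (real DIM('a) - 2 * s)"
  using symbol_boundD(1)[OF symbol_bound_mono[OF assms order_refl dec(3)], of y] .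

lemma symbol_F_integrable:
  assumes "f \<in> borel_measurable borel" "symbol_bound dec A f"
  shows "integrable lebesgue (\<lambda>y. F y * f y)"
  using F_mult_integrable[OF assms(1) symbol_le[OF assms(2)]] .

lemma flap_bound:
  "\<exists>C. \<forall>A f x. f \<in> borel_measurable borel \<longrightarrow> symbol_bound dec A f \<longrightarrow>
       \<bar>flap s f (x :: 'a)\<bar> \<le> C * A * (1 + norm x) powr - (real DIM('a) + 2 * s)"
proof -
  obtain C where C: "C \<ge> 0"
    "\<And>A (f :: 'a \<Rightarrow> real) x. f \<in> borel_measurable borel \<Longrightarrow> symbol_bound dec A f \<Longrightarrow>
       integrable lborel (\<lambda>z. diff2 f x z * levy s z) \<and>
       (LINT z|lborel. \<bar>diff2 f x z * levy s z\<bar>) \<le> C * A * (1 + norm x) powr - (real DIM('a) + 2 * s)"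
    using symbol_diff2_levy_bound[OF s dec(1)] by blast
  let ?c = "\<bar>frac_lap_const DIM('a) s\<bar> / 2"
  have "\<bar>flap s f x\<bar> \<le> ?c * C * A * (1 + norm x) powr - (real DIM('a) + 2 * s)"
    if "f \<in> borel_measurable borel" "symbol_bound dec A f" for A and f :: "'a \<Rightarrow> real" and x
    using flap_abs_le[of f x s "C * A * (1 + norm x) powr - (real DIM('a) + 2 * s)"] C(2)[OF that, of x] by (simp add: mult.assoc)
  then show ?thesis by blast
qed

lemma symbol_levy_integrable:
  fixes f :: "'a \<Rightarrow> real"
  assumes "f \<in> borel_measurable borel" "symbol_bound dec A f"
  shows "integrable lborel (\<lambda>z. diff2 f x z * levy s z)"
proof -
  obtain C where C: "C \<ge> 0"
    "\<And>A (f :: 'a \<Rightarrow> real) x. f \<in> borel_measurable borel \<Longrightarrow> symbol_bound dec A f \<Longrightarrow>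
       integrable lborel (\<lambda>z. diff2 f x z * levy s z) \<and>
       (LINT z|lborel. \<bar>diff2 f x z * levy s z\<bar>) \<le> C * A * (1 + norm x) powr - (real DIM('a) + 2 * s)"
    using symbol_diff2_levy_bound[OF s dec(1)] by blast
  show ?thesis using C(2)[OF assms] by blast
qed

lemma symbol_u_integrable:
  assumes [measurable]: "f \<in> borel_measurable borel" and f: "symbol_bound dec A f"
  shows "integrable lborel (\<lambda>x. u x * flap s f x)"
proof -
  obtain C where C': "\<forall>A f x. f \<in> borel_measurable borel \<longrightarrow> symbol_bound dec A f \<longrightarrow>
       \<bar>flap s f (x :: 'a)\<bar> \<le> C * A * (1 + norm x) powr - (real DIM('a) + 2 * s)"
    using flap_bound by blast
  have C: "\<bar>flap s f x\<bar> \<le> C * A * (1 + norm x) powr - (real DIM('a) + 2 * s)" for x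
    using C' assms by blast
  show ?thesis
  proof (rule integrable_dominated)
    show "integrable lborel (\<lambda>x. C * A * \<bar>(1 + norm x) powr - (real DIM('a) + 2 * s) * u x\<bar>)"
      using tempered_integrable[OF u] by simp
    fix x show "\<bar>u x * flap s f x\<bar> \<le> C * A * \<bar>(1 + norm x) powr - (real DIM('a) + 2 * s) * u x\<bar>"
      using mult_left_mono[OF C[of x], of "\<bar>u x\<bar>"] by (simp add: abs_mult mult_ac)
  qed measurable
qed

text \<open>The defect in the distributional equation. On functions supported away from the
  origin it vanishes, so that it can only see the behaviour at one point.\<close>

definition defect :: "('a \<Rightarrow> real) \<Rightarrow> real" where
  "defect f = (LINT x|lborel. u x * flap s f x) - (LINT x|lebesgue. F x * f x)"

lemma defect_cmult: "defect (\<lambda>x. c * f x) = c * defect f"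
proof -
  have "(LINT x|lborel. u x * flap s (\<lambda>x. c * f x) x) = c * (LINT x|lborel. u x * flap s f x)"
    unfolding flap_cmult by (simp add: mult.left_commute)
  moreover have "(LINT x|lebesgue. F x * (c * f x)) = c * (LINT x|lebesgue. F x * f x)"
    by (simp add: mult.left_commute)
  ultimately show ?thesis by (simp add: defect_def right_diff_distrib)
qed

lemma defect_diff:
  assumes f: "f \<in> borel_measurable borel" "symbol_bound dec A f"
    and g: "g \<in> borel_measurable borel" "symbol_bound dec B g"
  shows "defect (\<lambda>x. f x - g x) = defect f - defect g"
proof -
  have "flap s (\<lambda>x. f x - g x) x = flap s f x - flap s g x" for x
    using symbol_levy_integrable[OF f] symbol_levy_integrable[OF g] by (rule flap_diff)
  then have "(LINT x|lborel. u x * flap s (\<lambda>x. f x - g x) x) = (LINT x|lborel. u x * flap s f x) - (LINT x|lborel. u x * flap s g x)"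
    using symbol_u_integrable[OF f] symbol_u_integrable[OF g] by (simp add: right_diff_distrib)
  moreover have "(LINT x|lebesgue. F x * (f x - g x)) = (LINT x|lebesgue. F x * f x) - (LINT x|lebesgue. F x * g x)"
    using symbol_F_integrable[OF f] symbol_F_integrable[OF g] by (simp add: right_diff_distrib)
  ultimately show ?thesis unfolding defect_def by simp
qed

lemma defect_tendsto:
  assumes m[measurable]: "\<And>n. fn n \<in> borel_measurable borel" "f \<in> borel_measurable borel"
    and fn: "\<And>n. symbol_bound dec A (fn n)" and lim: "\<And>x. (\<lambda>n. fn n x) \<longlonglongrightarrow> f x"
  shows "(\<lambda>n. defect (fn n)) \<longlonglongrightarrow> defect f"
  unfolding defect_def
proof (rule tendsto_diff)
  obtain C where C': "\<forall>A f x. f \<in> borel_measurable borel \<longrightarrow> symbol_bound dec A f \<longrightarrow>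
       \<bar>flap s f (x :: 'a)\<bar> \<le> C * A * (1 + norm x) powr - (real DIM('a) + 2 * s)"
    using flap_bound by blast
  have C: "\<bar>flap s (fn n) x\<bar> \<le> C * A * (1 + norm x) powr - (real DIM('a) + 2 * s)" for n x
    using C' m(1)[of n] fn[of n] by blast
  show "(\<lambda>n. LINT x|lborel. u x * flap s (fn n) x) \<longlonglongrightarrow> (LINT x|lborel. u x * flap s f x)"
  proof (rule integral_dominated_convergence[where w = "\<lambda>x. C * A * \<bar>(1 + norm x) powr - (real DIM('a) + 2 * s) * u x\<bar>"])
    show "integrable lborel (\<lambda>x. C * A * \<bar>(1 + norm x) powr - (real DIM('a) + 2 * s) * u x\<bar>)"
      using tempered_integrable[OF u] by simp
    show "AE x in lborel. norm (u x * flap s (fn n) x) \<le> C * A * \<bar>(1 + norm x) powr - (real DIM('a) + 2 * s) * u x\<bar>" for n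
    proof (rule AE_I2)
      fix x show "norm (u x * flap s (fn n) x) \<le> C * A * \<bar>(1 + norm x) powr - (real DIM('a) + 2 * s) * u x\<bar>"
        using mult_left_mono[OF C[of n x], of "\<bar>u x\<bar>"] by (simp add: abs_mult mult_ac)
    qed
    show "AE x in lborel. (\<lambda>n. u x * flap s (fn n) x) \<longlonglongrightarrow> u x * flap s f x"
      by (intro AE_I2 tendsto_mult_left flap_tendsto[OF s dec(2) m fn lim])
  qed measurable
  show "(\<lambda>n. LINT x|lebesgue. F x * fn n x) \<longlonglongrightarrow> (LINT x|lebesgue. F x * f x)"
  proof (rule integral_dominated_convergence[where w = "\<lambda>y. A * \<bar>F y * (1 + norm y) powr - (real DIM('a) - 2 * s)\<bar>"])
    show "integrable lebesgue (\<lambda>y. A * \<bar>F y * (1 + norm y) powr - (real DIM('a) - 2 * s)\<bar>)"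
      using F_int by simp
    show "AE y in lebesgue. norm (F y * fn n y) \<le> A * \<bar>F y * (1 + norm y) powr - (real DIM('a) - 2 * s)\<bar>" for n
    proof (rule AE_I2)
      fix y show "norm (F y * fn n y) \<le> A * \<bar>F y * (1 + norm y) powr - (real DIM('a) - 2 * s)\<bar>"
        using mult_left_mono[OF symbol_le[OF fn[of n], of y], of "\<bar>F y\<bar>"] by (simp add: abs_mult mult_ac)
    qed
    show "AE x in lebesgue. (\<lambda>n. F x * fn n x) \<longlonglongrightarrow> F x * f x"
      by (intro AE_I2 tendsto_mult_left lim)
  qed (intro borel_measurable_times F_measurable measurable_completion; simp)+
qed

text \<open>On the annulus the regularity of \<open>u\<close> is uniform, and the local pairing identity applies.\<close>

lemma defect_annulus:
  assumes f: "f \<in> borel_measurable borel" "symbol_bound dec A f" and \<rho>: "\<rho> > 0"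
    and supp: "\<And>x. norm x < \<rho> \<Longrightarrow> f x = 0" "\<And>x. R < norm x \<Longrightarrow> f x = 0"
  shows "defect f = 0"
proof -
  define K where "K = {x::'a. \<rho> \<le> norm x \<and> norm x \<le> R}"
  have "K = cball 0 R - ball 0 \<rho>" by (auto simp: K_def)
  then have K: "compact K" by (simp add: compact_diff)
  have K0: "K \<subseteq> - {0}" using \<rho> by (auto simp: K_def)
  obtain \<gamma> r B where reg: "\<gamma> > 2 * s" "r > 0" "B \<ge> 0" "\<And>x z. x \<in> K \<Longrightarrow> norm z \<le> r \<Longrightarrow> \<bar>diff2 u x z\<bar> \<le> B * norm z powr \<gamma>"
    using u_reg[OF K K0] by blast
  have "bounded (u ` K)"
    by (intro compact_imp_bounded compact_continuous_image continuous_on_subset[OF u_cont K0] K)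
  then obtain U where "\<forall>y\<in>u ` K. norm y \<le> U" unfolding bounded_iff by blast
  then have U: "\<bar>u x\<bar> \<le> U" if "x \<in> K" for x using that by (metis imageI real_norm_def)
  have KR: "norm x \<le> R" if "x \<in> K" for x using that by (simp add: K_def)
  have Kf: "f x = 0" if "x \<notin> K" for x using that supp[of x] by (force simp: K_def)
  have eqK: "has_frac_lap s u x (F x)" if "x \<in> K" for x using that K0 by (intro eq) auto
  have 1: "(LINT x|lborel. u x * flap s f x) = (LINT x|lborel. f x * F x)"
    by (rule frac_lap_pairing_local(2)[where K = K and R = R and \<gamma> = \<gamma> and r = r and B = B and U = U and a = dec and A = A])
       (use s u f dec(1) KR Kf reg U eqK in blast)+
  have 2: "integrable lborel (\<lambda>x. f x * F x)"
    by (rule frac_lap_pairing_local(1)[where u = u and s = s and K = K and R = R and \<gamma> = \<gamma> and r = r and B = B and U = U and a = dec and A = A])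
       (use s u f dec(1) KR Kf reg U eqK in blast)+
  have "(LINT x|lebesgue. F x * f x) = (LINT x|lborel. F x * f x)"
    using 2 by (intro integral_completion) (auto simp: mult.commute dest: borel_measurable_integrable)
  then show ?thesis unfolding defect_def 1 by (simp add: mult.commute)
qed

text \<open>Cutoffs at larger and larger radii reduce this to annuli; they satisfy a common symbol bound.\<close>

lemma defect_vanishing_near_0:
  assumes f[measurable]: "f \<in> borel_measurable borel" and fA: "symbol_bound dec A f" and \<rho>: "\<rho> > 0"
    and supp: "\<And>x. norm x < \<rho> \<Longrightarrow> f x = 0"
  shows "defect f = 0"
proof -
  define fn where "fn n x = f x * cutoff (real (Suc n)) x" for n x
  have "symbol_bound dec (4 * (A * 256000)) (fn n)" for n
  proof -
    have "1 / real (Suc n) \<le> 1" by simp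
    then have "(1 + 1 / real (Suc n))\<^sup>2 \<le> 2\<^sup>2" by (intro power_mono) auto
    then have "symbol_bound 0 256000 (cutoff (real (Suc n)) :: 'a \<Rightarrow> real)"
      by (intro symbol_bound_mono[OF cutoff_symbol_bound]) auto
    from symbol_bound_mult[OF fA this] show ?thesis by (simp add: fn_def[abs_def] del: of_nat_Suc)
  qed
  note fnb = this
  have fnm: "fn n \<in> borel_measurable borel" for n unfolding fn_def[abs_def] by measurable
  have lim: "(\<lambda>n. fn n x) \<longlonglongrightarrow> f x" for x
  proof (rule tendsto_eventually)
    obtain k where k: "norm x \<le> real k" using real_arch_simple by blast
    show "\<forall>\<^sub>F n in sequentially. fn n x = f x"
      using eventually_ge_at_top[of k] by eventually_elim (use k in \<open>simp add: fn_def cutoff_eq_1\<close>)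
  qed
  have "defect (fn n) = 0" for n
    by (rule defect_annulus[OF fnm fnb \<rho>, of _ "2 * real (Suc n)"]) (auto simp: fn_def supp cutoff_eq_0)
  then show ?thesis using LIMSEQ_unique[OF defect_tendsto[OF fnm f fnb lim]] by simp
qed

text \<open>Unlike \<open>cutoff_symbol_bound\<close>, this has the full decay, at the price of a constant that depends
  on the radius.\<close>

lemma cutoff_symbol_dec:
  assumes "r > 0"
  shows "\<exists>A. symbol_bound dec A (cutoff r :: 'a \<Rightarrow> real)"
proof -
  define A where "A = 64 + 640 / r + 640 / r\<^sup>2"
  have A: "64 \<le> A" "640 / r \<le> A" "640 / r\<^sup>2 \<le> A" using assms by (auto simp: A_def)
  have "symbol_bound dec (A * (10 * (1 + 2 * r)) powr (dec + 2)) (cutoff r :: 'a \<Rightarrow> real)"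
  proof (rule symbol_bound_compact_support[OF _ dec(2)])
    show "\<bar>cutoff r (x :: 'a)\<bar> \<le> A" for x using cutoff_bound[of r x] A(1) by linarith
    show "\<bar>cutoff r (x + z) - cutoff r x\<bar> \<le> A * norm z" for x z :: 'a
      by (rule order_trans[OF cutoff_diff(1)[OF assms] mult_right_mono[OF A(2)]]) simp
    show "\<bar>diff2 (cutoff r) x z\<bar> \<le> A * (norm z)\<^sup>2" for x z :: 'a
      by (rule order_trans[OF cutoff_diff(2)[OF assms] mult_right_mono[OF A(3)]]) simp
  qed (use assms cutoff_eq_0 in auto)
  then show ?thesis ..
qed

text \<open>The difference \<open>f (1 - cutoff r)\<close> vanishes near the origin.\<close>

lemma defect_localize:
  assumes f[measurable]: "f \<in> borel_measurable borel" and fA: "symbol_bound dec A f" and r: "r > 0"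
  shows "defect f = defect (\<lambda>x. f x * cutoff r x)" "\<exists>B. symbol_bound dec B (\<lambda>x. f x * cutoff r x)"
proof -
  have b: "symbol_bound dec (4 * (A * (64000 * (1 + 1 / r)\<^sup>2))) (\<lambda>x. f x * cutoff r x)"
    using symbol_bound_mult[OF fA cutoff_symbol_bound[OF r]] by simp
  then show "\<exists>B. symbol_bound dec B (\<lambda>x. f x * cutoff r x)" ..
  have m: "(\<lambda>x. f x * cutoff r x) \<in> borel_measurable borel" by measurable
  have m2: "(\<lambda>x. f x - f x * cutoff r x) \<in> borel_measurable borel" by measurable
  have "defect (\<lambda>x. f x - f x * cutoff r x) = 0"
    by (rule defect_vanishing_near_0[OF m2 symbol_bound_diff[OF fA b] r]) (use r in \<open>simp add: cutoff_eq_1\<close>)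
  then show "defect f = defect (\<lambda>x. f x * cutoff r x)" using defect_diff[OF f fA m b] by simp
qed

text \<open>A symbol cut down to the scale \<open>r\<close>, after subtracting its value at the origin, is a bump of
  size \<open>O(r)\<close>.\<close>

lemma cutoff_remainder_bump:
  fixes f :: "'a \<Rightarrow> real"
  assumes fA: "symbol_bound dec A f" and r: "0 < r" "r \<le> 1"
  defines "g \<equiv> \<lambda>x. (f x - f 0) * cutoff r x"
  shows "\<bar>g x\<bar> \<le> 20000 * A * r" and "2 * r \<le> norm x \<Longrightarrow> g x = 0"
    and "\<bar>diff2 g x z\<bar> \<le> 20000 * A * r / r\<^sup>2 * (norm z)\<^sup>2"
proof -
  have A: "A \<ge> 0" using fA by (rule symbol_bound_nonneg)
  have w: "A * (1 + norm y) powr e \<le> A" if "e \<le> 0" for e and y :: 'a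
    using mult_left_mono[OF powr_mono[of e 0 "1 + norm y"] A] that by simp
  have f0: "\<bar>f y\<bar> \<le> A" for y using order_trans[OF symbol_boundD(1)[OF fA, of y] w[of "- dec" y]] dec(2) by simp
  have f1: "\<bar>f (y + z) - f y\<bar> \<le> 4 * A * norm z" for y z
  proof (cases "norm z \<le> (1 + norm y) / 2")
    case True
    have "\<bar>f (y + z) - f y\<bar> \<le> A * norm z"
      using order_trans[OF symbol_boundD(2)[OF fA True] mult_right_mono[OF w[of "- dec - 1" y]]] dec(2) by simp
    also have "\<dots> \<le> 4 * A * norm z" using A by (intro mult_right_mono) auto
    finally show ?thesis .
  next
    case False
    then have "1 / 2 \<le> norm z" using norm_ge_zero[of y] by argo
    then have "4 * A * (1 / 2) \<le> 4 * A * norm z" using A by (intro mult_left_mono) auto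
    then show ?thesis using f0[of y] f0[of "y + z"] by linarith
  qed
  have f2: "\<bar>diff2 f y z\<bar> \<le> 16 * A * (norm z)\<^sup>2" for y z
  proof (cases "norm z \<le> (1 + norm y) / 2")
    case True
    have "\<bar>diff2 f y z\<bar> \<le> A * (norm z)\<^sup>2"
      using order_trans[OF symbol_boundD(3)[OF fA True] mult_right_mono[OF w[of "- dec - 2" y]]] dec(2) by simp
    also have "\<dots> \<le> 16 * A * (norm z)\<^sup>2" using A by (intro mult_right_mono) auto
    finally show ?thesis .
  next
    case False
    then have "1 / 2 \<le> norm z" using norm_ge_zero[of y] by argo
    then have "(1 / 2)\<^sup>2 \<le> (norm z)\<^sup>2" by (intro power_mono) auto
    then have "16 * A * (1 / 4) \<le> 16 * A * (norm z)\<^sup>2" using A by (intro mult_left_mono) (auto simp: power2_eq_square)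
    moreover have "\<bar>diff2 f y z\<bar> \<le> 2 * \<bar>f y\<bar> + \<bar>f (y + z)\<bar> + \<bar>f (y - z)\<bar>" unfolding diff2_def by linarith
    ultimately show ?thesis using f0[of y] f0[of "y + z"] f0[of "y - z"] by linarith
  qed
  have fx: "\<bar>f y - f 0\<bar> \<le> 4 * A * norm y" for y using f1[of 0 y] by simp
  show g0: "g x = 0" if "2 * r \<le> norm x" for x using that r by (simp add: g_def cutoff_eq_0)
  have gb: "\<bar>g x\<bar> \<le> 512 * A * r" for x
  proof (cases "2 * r \<le> norm x")
    case False
    have "\<bar>f x - f 0\<bar> \<le> 4 * A * (2 * r)" using order_trans[OF fx[of x] mult_left_mono[of "norm x" "2 * r" "4 * A"]] False A by simp
    then have "\<bar>f x - f 0\<bar> * \<bar>cutoff r x\<bar> \<le> 4 * A * (2 * r) * 64" using cutoff_bound[of r x] A r by (intro mult_mono) auto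
    then show ?thesis by (simp add: g_def abs_mult)
  qed (use g0 A r in simp)
  have Ar: "0 \<le> A * r" using A r by simp
  show "\<bar>g x\<bar> \<le> 20000 * A * r" for x using gb[of x] Ar by linarith
  have r2: "20000 * A * r / r\<^sup>2 = 20000 * (A / r)" using r by (simp add: power2_eq_square)
  have zz: "0 \<le> A / r * (norm z)\<^sup>2" using A r by simp
  have "\<bar>diff2 g x z\<bar> \<le> 20000 * (A / r * (norm z)\<^sup>2)"
  proof (cases "norm x \<le> 4 * r")
    case True
    let ?h = "\<lambda>x. f x - f 0"
    have "diff2 g x z = ?h x * diff2 (cutoff r) x z + cutoff r x * diff2 ?h x z
       - (?h (x + z) - ?h x) * (cutoff r (x + z) - cutoff r x) - (?h (x - z) - ?h x) * (cutoff r (x - z) - cutoff r x)"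
      unfolding g_def by (rule diff2_mult)
    moreover have "diff2 ?h x z = diff2 f x z" by (simp add: diff2_def)
    ultimately have e: "diff2 g x z = ?h x * diff2 (cutoff r) x z + cutoff r x * diff2 f x z
       - (f (x + z) - f x) * (cutoff r (x + z) - cutoff r x) - (f (x - z) - f x) * (cutoff r (x - z) - cutoff r x)" by simp
    have "\<bar>?h x * diff2 (cutoff r) x z\<bar> \<le> (4 * A * (4 * r)) * (640 / r\<^sup>2 * (norm z)\<^sup>2)"
    proof (unfold abs_mult, rule mult_mono)
      show "\<bar>?h x\<bar> \<le> 4 * A * (4 * r)" using order_trans[OF fx[of x] mult_left_mono[of "norm x" "4 * r" "4 * A"]] True A by simp
    qed (use cutoff_diff(2)[OF r(1)] A r in auto)
    also have "\<dots> = 10240 * (A / r * (norm z)\<^sup>2)" using r by (simp add: power2_eq_square)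
    finally have 1: "\<bar>?h x * diff2 (cutoff r) x z\<bar> \<le> 10240 * (A / r * (norm z)\<^sup>2)" .
    have "\<bar>cutoff r x * diff2 f x z\<bar> \<le> 64 * (16 * A * (norm z)\<^sup>2)"
      unfolding abs_mult using cutoff_bound[of r x] f2[of x z] by (intro mult_mono) auto
    also have "\<dots> \<le> 1024 * (A / r * (norm z)\<^sup>2)"
    proof -
      have "A \<le> A / r" using A r by (simp add: le_divide_eq mult_left_le)
      then have "A * (norm z)\<^sup>2 \<le> A / r * (norm z)\<^sup>2" by (intro mult_right_mono) auto
      then show ?thesis by simp
    qed
    finally have 2: "\<bar>cutoff r x * diff2 f x z\<bar> \<le> 1024 * (A / r * (norm z)\<^sup>2)" .
    have 3: "\<bar>(f (x + z) - f x) * (cutoff r (x + z) - cutoff r x)\<bar> \<le> 2560 * (A / r * (norm z)\<^sup>2)" for z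
    proof -
      have "\<bar>(f (x + z) - f x) * (cutoff r (x + z) - cutoff r x)\<bar> \<le> (4 * A * norm z) * (640 / r * norm z)"
        unfolding abs_mult using f1 cutoff_diff(1)[OF r(1)] A by (intro mult_mono) auto
      then show ?thesis by (simp add: power2_eq_square mult_ac)
    qed
    have 4: "\<bar>(f (x - z) - f x) * (cutoff r (x - z) - cutoff r x)\<bar> \<le> 2560 * (A / r * (norm z)\<^sup>2)"
      using 3[of "- z"] by simp
    show ?thesis using 1 2 3[of z] 4 zz unfolding e abs_le_iff by argo
  next
    case False
    have gx: "g x = 0" using False r by (intro g0) auto
    show ?thesis
    proof (cases "norm z \<le> 2 * r")
      case True
      have "2 * r \<le> norm (x + z)" "2 * r \<le> norm (x - z)"
        using True False norm_triangle_ineq2[of x z] norm_triangle_ineq2[of x "- z"] by auto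
      then have "diff2 g x z = 0" using gx g0 by (simp add: diff2_def)
      then show ?thesis using zz by simp
    next
      case z: False
      then have "(2 * r)\<^sup>2 \<le> (norm z)\<^sup>2" using r by (intro power_mono) auto
      then have "A / r * (2 * r)\<^sup>2 \<le> A / r * (norm z)\<^sup>2" using A r by (intro mult_left_mono) auto
      then have "4 * (A * r) \<le> A / r * (norm z)\<^sup>2" using r by (simp add: power2_eq_square)
      moreover have "\<bar>diff2 g x z\<bar> \<le> \<bar>g (x + z)\<bar> + \<bar>g (x - z)\<bar>" using gx unfolding diff2_def by linarith
      ultimately show ?thesis using gb[of "x + z"] gb[of "x - z"] zz by linarith
    qed
  qed
  then show "\<bar>diff2 g x z\<bar> \<le> 20000 * A * r / r\<^sup>2 * (norm z)\<^sup>2" unfolding r2 by (simp add: mult.assoc)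
qed

text \<open>This is the use of the growth bound on \<open>u\<close>: a bump of size one at scale \<open>r\<close> has
  a fractional Laplacian which pairs with \<open>u\<close> to something bounded as \<open>r\<close> shrinks.\<close>

lemma u_bump_pairing_bounded:
  "\<exists>J. \<exists>r0. 0 < r0 \<and> (\<forall>r c h. 0 < r \<longrightarrow> r \<le> r0 \<longrightarrow> 0 \<le> c \<longrightarrow> h \<in> borel_measurable borel \<longrightarrow>
       (\<forall>x. \<bar>h x\<bar> \<le> c * r powr - (2 * s)) \<longrightarrow>
       (\<forall>x. 4 * r \<le> norm x \<longrightarrow> \<bar>h x\<bar> \<le> c * r powr real DIM('a) * norm x powr - (real DIM('a) + 2 * s)) \<longrightarrow>
       (LINT x|lborel. \<bar>u x * h x\<bar>) \<le> c * J)"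
proof -
  let ?N = "real DIM('a)"
  obtain C' R where R: "0 < R" and C': "\<And>x. x \<noteq> 0 \<Longrightarrow> norm x \<le> R \<Longrightarrow> \<bar>u x\<bar> \<le> C' * norm x powr - (?N - 2 * s)"
    using u_bound by blast
  define C where "C = \<bar>C'\<bar>"
  have C: "C \<ge> 0" "\<And>x. x \<noteq> 0 \<Longrightarrow> norm x \<le> R \<Longrightarrow> \<bar>u x\<bar> \<le> C * norm x powr - (?N - 2 * s)"
  proof -
    fix x :: 'a assume "x \<noteq> 0" "norm x \<le> R"
    then have "\<bar>u x\<bar> \<le> C' * norm x powr - (?N - 2 * s)" by (rule C')
    also have "\<dots> \<le> C * norm x powr - (?N - 2 * s)" unfolding C_def by (intro mult_right_mono) auto
    finally show "\<bar>u x\<bar> \<le> C * norm x powr - (?N - 2 * s)" .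
  qed (simp add: C_def)
  define V where "V = unit_ball_vol ?N * ?N"
  have V: "V \<ge> 0" by (simp add: V_def)
  have N: "?N > 0" by simp
  define c0 where "c0 = (1 + 1 / R) powr (?N + 2 * s)"
  define M where "M = (LINT y|lborel. (1 + norm y) powr - (?N + 2 * s) * \<bar>u y\<bar>)"
  have M: "M \<ge> 0" unfolding M_def by (intro integral_nonneg_AE) auto
  define J where "J = C * (V / (2 * s) * 4 powr (2 * s)) + C * (V / ?N * 4 powr - ?N) + c0 * M"
  have J: "J \<ge> 0" using C(1) V s M N by (simp add: J_def c0_def)
  define r0 where "r0 = min 1 (R / 4)"
  have r0: "r0 > 0" using R by (simp add: r0_def)
  have key: "(LINT x|lborel. \<bar>u x * h x\<bar>) \<le> c * J"
    if r: "0 < r" "r \<le> r0" and c: "0 \<le> c" and [measurable]: "h \<in> borel_measurable borel"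
      and h1: "\<forall>x. \<bar>h x\<bar> \<le> c * r powr - (2 * s)"
      and h2: "\<forall>x. 4 * r \<le> norm x \<longrightarrow> \<bar>h x\<bar> \<le> c * r powr ?N * norm x powr - (?N + 2 * s)" for r c h
  proof -
    have r4: "4 * r \<le> R" "r \<le> 1" using r by (auto simp: r0_def)
    let ?g1 = "\<lambda>x::'a. indicator (cball 0 (4 * r)) x * norm x powr - (?N - 2 * s)"
    let ?g2 = "\<lambda>x::'a. indicator {x. 4 * r \<le> norm x} x * norm x powr - (2 * ?N)"
    let ?g3 = "\<lambda>x::'a. (1 + norm x) powr - (?N + 2 * s) * \<bar>u x\<bar>"
    let ?g = "\<lambda>x. c * (C * r powr - (2 * s) * ?g1 x + C * r powr ?N * ?g2 x + c0 * ?g3 x)"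
    have g1: "has_bochner_integral lborel ?g1 (V / (2 * s) * (4 * r) powr (2 * s))"
      using integral_norm_powr_cball[where 'a = 'a, of "?N - 2 * s" "4 * r"] s r by (simp add: V_def)
    have g2: "has_bochner_integral lborel ?g2 (V / ?N * (4 * r) powr - ?N)"
      using integral_norm_powr_outside[where 'a = 'a, of "2 * ?N" "4 * r"] r by (simp add: V_def)
    have g3: "integrable lborel ?g3"
      using integrable_abs[OF tempered_integrable[OF u]] by (simp add: abs_mult)
    have gi: "integrable lborel ?g"
      using g1 g2 g3 by (intro integrable_mult_right Bochner_Integration.integrable_add) (auto simp: has_bochner_integral_iff)
    have le: "\<bar>u x * h x\<bar> \<le> ?g x" if x: "x \<noteq> 0" for x
    proof -
      have nn: "0 \<le> C * r powr - (2 * s) * ?g1 x" "0 \<le> C * r powr ?N * ?g2 x" "0 \<le> c0 * ?g3 x"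
        using C(1) by (auto simp: c0_def)
      \<comment> \<open>The three regions: at the bump, where the size of \<open>u\<close> is integrated over a ball of radius
        \<open>4 r\<close>; around it, where the growth bound still holds; and far away, where \<open>u\<close> is only
        tempered.\<close>
      consider "norm x \<le> 4 * r" | "4 * r < norm x" "norm x \<le> R" | "R < norm x" by linarith
      then have "\<exists>d. \<bar>u x * h x\<bar> \<le> c * d \<and> d \<le> C * r powr - (2 * s) * ?g1 x + C * r powr ?N * ?g2 x + c0 * ?g3 x"
      proof cases
        case 1
        have "\<bar>u x * h x\<bar> \<le> (C * norm x powr - (?N - 2 * s)) * (c * r powr - (2 * s))"
          unfolding abs_mult using C(2)[OF x] 1 r4 h1[rule_format, of x] C(1) by (intro mult_mono) auto
        also have "\<dots> = c * (C * r powr - (2 * s) * ?g1 x)" using 1 by simp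
        finally show ?thesis using nn by (intro exI[of _ "C * r powr - (2 * s) * ?g1 x"]) auto
      next
        case 2
        have "\<bar>u x * h x\<bar> \<le> (C * norm x powr - (?N - 2 * s)) * (c * r powr ?N * norm x powr - (?N + 2 * s))"
          unfolding abs_mult using C(2)[OF x] 2 h2[rule_format, of x] C(1) by (intro mult_mono) auto
        also have "\<dots> = c * (C * r powr ?N * (norm x powr - (?N - 2 * s) * norm x powr - (?N + 2 * s)))" by (simp only: mult_ac)
        also have "norm x powr - (?N - 2 * s) * norm x powr - (?N + 2 * s) = norm x powr - (2 * ?N)" by (simp flip: powr_add)
        also have "\<dots> = ?g2 x" using 2 by simp
        finally show ?thesis using nn by (intro exI[of _ "C * r powr ?N * ?g2 x"]) auto
      next
        case 3
        have "\<bar>h x\<bar> \<le> c * r powr ?N * norm x powr - (?N + 2 * s)" using 3 r4 by (intro h2[rule_format]) auto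
        also have "\<dots> \<le> c * 1 * norm x powr - (?N + 2 * s)"
          using c r r4 powr_mono2[of ?N r 1] by (intro mult_right_mono mult_left_mono) auto
        also have "norm x powr - (?N + 2 * s) \<le> c0 * (1 + norm x) powr - (?N + 2 * s)"
          using levy_tail_le[OF s(1) R, of x 0] 3 by (simp add: levy_tail_def levy_def c0_def)
        finally have "\<bar>h x\<bar> \<le> c * (c0 * (1 + norm x) powr - (?N + 2 * s))" using c by (simp add: mult_left_mono)
        from mult_left_mono[OF this, of "\<bar>u x\<bar>"] have "\<bar>u x * h x\<bar> \<le> c * (c0 * ?g3 x)" by (simp add: abs_mult mult_ac)
        then show ?thesis using nn by (intro exI[of _ "c0 * ?g3 x"]) auto
      qed
      then obtain d where d: "\<bar>u x * h x\<bar> \<le> c * d" "d \<le> C * r powr - (2 * s) * ?g1 x + C * r powr ?N * ?g2 x + c0 * ?g3 x" by blast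
      show ?thesis by (rule order_trans[OF d(1) mult_left_mono[OF d(2) c]])
    qed
    have AE: "AE x in lborel. \<bar>u x * h x\<bar> \<le> ?g x"
      by (rule eventually_mono[OF AE_lborel_singleton[of 0]]) (rule le)
    have ui: "integrable lborel (\<lambda>x. \<bar>u x * h x\<bar>)"
    proof (rule Bochner_Integration.integrable_bound[OF gi])
      show "AE x in lborel. norm \<bar>u x * h x\<bar> \<le> norm (?g x)"
        using AE by eventually_elim simp
    qed measurable
    have "(LINT x|lborel. \<bar>u x * h x\<bar>) \<le> (LINT x|lborel. ?g x)"
      by (rule integral_mono_AE[OF ui gi AE])
    also have "\<dots> = c * (C * r powr - (2 * s) * (V / (2 * s) * (4 * r) powr (2 * s)) + C * r powr ?N * (V / ?N * (4 * r) powr - ?N) + c0 * M)"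
      using g1 g2 g3 by (simp add: has_bochner_integral_iff M_def)
    also have "\<dots> = c * J"
    proof -
      have "r powr - (2 * s) * r powr (2 * s) = 1" "r powr ?N * r powr - ?N = 1" using r by (simp_all flip: powr_add)
      moreover have "C * r powr - (2 * s) * (V / (2 * s) * (4 * r) powr (2 * s)) = C * (V / (2 * s) * 4 powr (2 * s)) * (r powr - (2 * s) * r powr (2 * s))"
        "C * r powr ?N * (V / ?N * (4 * r) powr - ?N) = C * (V / ?N * 4 powr - ?N) * (r powr ?N * r powr - ?N)"
        by (simp_all only: powr_mult mult_ac)
      ultimately have "C * r powr - (2 * s) * (V / (2 * s) * (4 * r) powr (2 * s)) = C * (V / (2 * s) * 4 powr (2 * s))"
        "C * r powr ?N * (V / ?N * (4 * r) powr - ?N) = C * (V / ?N * 4 powr - ?N)"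
        by (simp_all only: mult_1_right)
      then show ?thesis by (simp only: J_def)
    qed
    finally show ?thesis .
  qed
  show ?thesis by (rule exI[of _ J], rule exI[of _ r0]) (intro conjI allI impI r0 key; blast)
qed

text \<open>The coefficient is the defect of a cutoff, which by localization is the same at every scale. The
  remainder \<open>(f - f 0) cutoff r\<close> is a bump of height \<open>O(r)\<close>, so its defect is \<open>O(r)\<close>; since the left
  side does not depend on \<open>r\<close>, it is zero.\<close>

theorem defect_eq_point_mass:
  "\<exists>m. \<forall>A f. f \<in> borel_measurable borel \<longrightarrow> symbol_bound dec A f \<longrightarrow> defect f = m * f 0"
proof (rule bump_diff2_levy_bound[OF s, where 'a = 'a])
  fix C :: real
  assume C: "C \<ge> 0"
    "\<And>B r (f :: 'a \<Rightarrow> real) x. r > 0 \<Longrightarrow> f \<in> borel_measurable borel \<Longrightarrow>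
       (\<And>x. \<bar>f x\<bar> \<le> B) \<Longrightarrow> (\<And>x. 2 * r \<le> norm x \<Longrightarrow> f x = 0) \<Longrightarrow>
       (\<And>x z. \<bar>diff2 f x z\<bar> \<le> B / r\<^sup>2 * (norm z)\<^sup>2) \<Longrightarrow>
       integrable lborel (\<lambda>z. diff2 f x z * levy s z) \<and>
       (LINT z|lborel. \<bar>diff2 f x z * levy s z\<bar>) \<le> C * B * r powr - (2 * s) \<and>
       (4 * r \<le> norm x \<longrightarrow> (LINT z|lborel. \<bar>diff2 f x z * levy s z\<bar>) \<le> C * B * r powr real DIM('a) * norm x powr - (real DIM('a) + 2 * s))"
  define m where "m = defect (cutoff 1)"
  obtain A1 where A1: "symbol_bound dec A1 (cutoff 1 :: 'a \<Rightarrow> real)" using cutoff_symbol_dec[of 1] by auto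
  obtain J where "\<exists>r0. 0 < r0 \<and> (\<forall>r c h. 0 < r \<longrightarrow> r \<le> r0 \<longrightarrow> 0 \<le> c \<longrightarrow> h \<in> borel_measurable borel \<longrightarrow>
       (\<forall>x. \<bar>h x\<bar> \<le> c * r powr - (2 * s)) \<longrightarrow>
       (\<forall>x. 4 * r \<le> norm x \<longrightarrow> \<bar>h x\<bar> \<le> c * r powr real DIM('a) * norm x powr - (real DIM('a) + 2 * s)) \<longrightarrow>
       (LINT x|lborel. \<bar>u x * h x\<bar>) \<le> c * J)" using u_bump_pairing_bounded ..
  then obtain r0 where r0J: "0 < r0 \<and> (\<forall>r c h. 0 < r \<longrightarrow> r \<le> r0 \<longrightarrow> 0 \<le> c \<longrightarrow> h \<in> borel_measurable borel \<longrightarrow>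
       (\<forall>x. \<bar>h x\<bar> \<le> c * r powr - (2 * s)) \<longrightarrow>
       (\<forall>x. 4 * r \<le> norm x \<longrightarrow> \<bar>h x\<bar> \<le> c * r powr real DIM('a) * norm x powr - (real DIM('a) + 2 * s)) \<longrightarrow>
       (LINT x|lborel. \<bar>u x * h x\<bar>) \<le> c * J)" ..
  note r0 = conjunct1[OF r0J] and J = conjunct2[OF r0J]
  let ?c = "\<bar>frac_lap_const DIM('a) s\<bar> / 2"
  have "defect f = m * f 0" if fm[measurable]: "f \<in> borel_measurable borel" and fA: "symbol_bound dec A f" for A f
  proof -
    have A: "A \<ge> 0" using fA by (rule symbol_bound_nonneg)
    have Fi: "integrable lebesgue (\<lambda>x. F x * indicator (cball 0 2) x)"
    proof (rule F_mult_integrable)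
      show "\<bar>indicator (cball 0 2) y\<bar> \<le> 3 powr (real DIM('a) - 2 * s) * (1 + norm y) powr - (real DIM('a) - 2 * s)" for y :: 'a
      proof (cases "norm y \<le> 2")
        case True
        have "3 powr - (real DIM('a) - 2 * s) \<le> (1 + norm y) powr - (real DIM('a) - 2 * s)"
          using True N2s by (intro powr_mono2') auto
        then have "3 powr (real DIM('a) - 2 * s) * 3 powr - (real DIM('a) - 2 * s)
           \<le> 3 powr (real DIM('a) - 2 * s) * (1 + norm y) powr - (real DIM('a) - 2 * s)" by (intro mult_left_mono) auto
        moreover have "(3::real) powr (real DIM('a) - 2 * s) * 3 powr - (real DIM('a) - 2 * s) = 1" by (simp flip: powr_add)
        ultimately have "1 \<le> 3 powr (real DIM('a) - 2 * s) * (1 + norm y) powr - (real DIM('a) - 2 * s)"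
          by (simp only:)
        then show ?thesis using True by simp
      qed simp
    qed (intro borel_measurable_indicator, simp)
    define MF where "MF = (LINT x|lebesgue. \<bar>F x * indicator (cball 0 2) x\<bar>)"
    define K where "K = ?c * (C * (20000 * A)) * J + 20000 * A * MF"
    have est: "\<bar>defect f - m * f 0\<bar> \<le> K * r" if r: "0 < r" "r \<le> r0" "r \<le> 1 / 2" for r
    proof -
      define g where "g x = (f x - f 0) * cutoff r x" for x
      have gdef: "g = (\<lambda>x. (f x - f 0) * cutoff r x)" by (simp add: g_def fun_eq_iff)
      have gm[measurable]: "g \<in> borel_measurable borel" unfolding gdef by measurable
      define B where "B = 20000 * A * r"
      have B: "B \<ge> 0" using A r by (simp add: B_def)
      have r': "r \<le> 1" using r by simp
      have g: "\<bar>g x\<bar> \<le> B" "2 * r \<le> norm x \<Longrightarrow> g x = 0" "\<bar>diff2 g x z\<bar> \<le> B / r\<^sup>2 * (norm z)\<^sup>2" for x z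
        unfolding gdef B_def using cutoff_remainder_bump[OF fA r(1) r'] by auto
      obtain B1 where B1: "symbol_bound dec B1 (\<lambda>x. f x * cutoff r x)" using defect_localize(2)[OF fm fA r(1)] by blast
      obtain B2 where B2: "symbol_bound dec B2 (cutoff r :: 'a \<Rightarrow> real)" using cutoff_symbol_dec[OF r(1)] by blast
      have c1: "cutoff 1 x * cutoff r x = cutoff r x" for x :: 'a
      proof (cases "norm x \<le> 1")
        case False
        then show ?thesis using r by (simp add: cutoff_eq_0)
      qed (simp add: cutoff_eq_1)
      have mr: "m = defect (cutoff r)"
        unfolding m_def using defect_localize(1)[OF cutoff_measurable A1 r(1)] by (simp only: c1)
      have "defect g = defect (\<lambda>x. f x * cutoff r x - f 0 * cutoff r x)"
        by (intro arg_cong[where f = defect]) (simp add: g_def fun_eq_iff left_diff_distrib)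
      also have "\<dots> = defect (\<lambda>x. f x * cutoff r x) - defect (\<lambda>x. f 0 * cutoff r x)"
        by (rule defect_diff[OF _ B1 _ symbol_bound_cmult[OF B2]]) measurable
      also have "\<dots> = defect f - m * f 0"
        unfolding defect_cmult mr using defect_localize(1)[OF fm fA r(1)] by simp
      finally have dg: "defect f - m * f 0 = defect g" ..
      have fl1: "\<bar>flap s g x\<bar> \<le> ?c * (C * B) * r powr - (2 * s)" for x
      proof -
        have "(LINT z|lborel. \<bar>diff2 g x z * levy s z\<bar>) \<le> C * B * r powr - (2 * s)"
          using C(2)[OF r(1) gm g(1) g(2) g(3), of x] by blast
        from flap_abs_le[OF this] show ?thesis by (simp add: mult.assoc)
      qed
      have fl2: "\<bar>flap s g x\<bar> \<le> ?c * (C * B) * r powr real DIM('a) * norm x powr - (real DIM('a) + 2 * s)" if "4 * r \<le> norm x" for x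
      proof -
        have "(LINT z|lborel. \<bar>diff2 g x z * levy s z\<bar>) \<le> C * B * r powr real DIM('a) * norm x powr - (real DIM('a) + 2 * s)"
          using C(2)[OF r(1) gm g(1) g(2) g(3), of x] that by blast
        from flap_abs_le[OF this] show ?thesis by (simp add: mult.assoc)
      qed
      have cB: "0 \<le> ?c * (C * B)" using C(1) B by simp
      have flm: "flap s g \<in> borel_measurable borel" by measurable
      have "(LINT x|lborel. \<bar>u x * flap s g x\<bar>) \<le> ?c * (C * B) * J"
        using J r(1,2) cB flm fl1 fl2 by blast
      then have 1: "\<bar>LINT x|lborel. u x * flap s g x\<bar> \<le> ?c * (C * B) * J"
        by (rule order_trans[OF integral_abs_bound])
      have 2: "\<bar>LINT x|lebesgue. F x * g x\<bar> \<le> B * MF"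
      proof -
        have "\<bar>LINT x|lebesgue. F x * g x\<bar> \<le> (LINT x|lebesgue. B * \<bar>F x * indicator (cball 0 2) x\<bar>)"
        proof (rule integral_abs_bound_integral)
          have le: "\<bar>F x * g x\<bar> \<le> B * \<bar>F x * indicator (cball 0 2) x\<bar>" for x
          proof (cases "norm x \<le> 2")
            case True
            then show ?thesis using mult_left_mono[OF g(1)[of x], of "\<bar>F x\<bar>"] by (simp add: abs_mult mult.commute)
          next
            case False
            then show ?thesis using g(2)[of x] r by simp
          qed
          then show "\<And>x. \<bar>F x * g x\<bar> \<le> B * \<bar>F x * indicator (cball 0 2) x\<bar>" .
          show b: "integrable lebesgue (\<lambda>x. B * \<bar>F x * indicator (cball 0 2) x\<bar>)" using Fi by simp
          show "integrable lebesgue (\<lambda>x. F x * g x)"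
            by (rule integrable_dominated[OF b _ le]) (intro borel_measurable_times F_measurable measurable_completion; simp)
        qed
        then show ?thesis by (simp add: MF_def)
      qed
      have "\<bar>defect g\<bar> \<le> ?c * (C * B) * J + B * MF" using 1 2 unfolding defect_def by linarith
      also have "\<dots> = K * r" by (simp add: K_def B_def algebra_simps)
      finally show ?thesis unfolding dg .
    qed
    show ?thesis
    proof (rule ccontr)
      assume "defect f \<noteq> m * f 0"
      then have D: "\<bar>defect f - m * f 0\<bar> > 0" by simp
      define r where "r = min (min r0 (1 / 2)) (\<bar>defect f - m * f 0\<bar> / (2 * (\<bar>K\<bar> + 1)))"
      have r: "0 < r" "r \<le> r0" "r \<le> 1 / 2" "r \<le> \<bar>defect f - m * f 0\<bar> / (2 * (\<bar>K\<bar> + 1))"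
      proof -
        show "0 < r" using r0 D by (simp add: r_def)
        show "r \<le> r0" unfolding r_def by (rule order_trans[OF min.cobounded1 min.cobounded1])
        show "r \<le> 1 / 2" unfolding r_def by (rule order_trans[OF min.cobounded1 min.cobounded2])
        show "r \<le> \<bar>defect f - m * f 0\<bar> / (2 * (\<bar>K\<bar> + 1))" unfolding r_def by (rule min.cobounded2)
      qed
      have "\<bar>defect f - m * f 0\<bar> \<le> K * r" using r by (intro est)
      also have "\<dots> \<le> (\<bar>K\<bar> + 1) * r" using r by (intro mult_right_mono) auto
      also have "\<dots> \<le> (\<bar>K\<bar> + 1) * (\<bar>defect f - m * f 0\<bar> / (2 * (\<bar>K\<bar> + 1)))" using r by (intro mult_left_mono) auto
      also have "\<dots> = \<bar>defect f - m * f 0\<bar> / 2" by (simp add: field_simps)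
      finally show False using D by argo
    qed
  qed
  then show ?thesis by blast
qed

end

section \<open>Bubbles as superpositions of Gaussians\<close>

lemma has_bochner_integral_powr_exp:
  fixes a c :: real
  assumes "a > 0" "c > 0"
  shows "has_bochner_integral lborel (\<lambda>r. indicator {0<..} r * r powr (a - 1) * exp (- r * c)) (Gamma a * c powr - a)"
proof (rule has_bochner_integral_nn_integral)
  show "(\<integral>\<^sup>+ r. ennreal (indicator {0<..} r * r powr (a - 1) * exp (- r * c)) \<partial>lborel) = ennreal (Gamma a * c powr - a)"
    unfolding nn_integral_powr_exp[OF assms] by (simp add: powr_minus divide_inverse)
qed (use assms in \<open>auto intro!: mult_nonneg_nonneg less_imp_le[OF Gamma_real_pos]\<close>)

definition gauss_weight :: "real \<Rightarrow> real \<Rightarrow> real \<Rightarrow> real" where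
  "gauss_weight \<epsilon> a r = indicator {0<..} r * r powr (a - 1) * exp (- r * \<epsilon>\<^sup>2)"

text \<open>Normalized as the heat kernel at time \<open>r\<close>, so that its cosine transform is \<open>exp (- r |x|\<^sup>2)\<close>.\<close>

definition gauss_kernel :: "real \<Rightarrow> 'a::euclidean_space \<Rightarrow> real" where
  "gauss_kernel r \<xi> = (4 * pi * r) powr - (real DIM('a) / 2) * exp (- (norm \<xi>)\<^sup>2 / (4 * r))"

text \<open>Up to a factor this is a Bessel potential kernel: the Fourier transform of a power of
  \<open>\<epsilon>\<^sup>2 + |x|\<^sup>2\<close>.\<close>

definition bubble_symbol :: "real \<Rightarrow> real \<Rightarrow> 'a::euclidean_space \<Rightarrow> real" where
  "bubble_symbol \<epsilon> a \<xi> = (LINT r|lborel. gauss_weight \<epsilon> a r * gauss_kernel r \<xi>)"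

lemma gauss_weight_nonneg: "gauss_weight \<epsilon> a r \<ge> 0" by (simp add: gauss_weight_def indicator_def)

lemma gauss_kernel_nonneg: "gauss_kernel r \<xi> \<ge> 0" by (simp add: gauss_kernel_def)

lemma bubble_symbol_nonneg: "bubble_symbol \<epsilon> a \<xi> \<ge> 0"
  unfolding bubble_symbol_def
  by (intro integral_nonneg_AE AE_I2 mult_nonneg_nonneg gauss_weight_nonneg gauss_kernel_nonneg)

lemma gauss_weight_measurable [measurable]: "gauss_weight \<epsilon> a \<in> borel_measurable borel"
  unfolding gauss_weight_def[abs_def] by measurable

lemma gauss_kernel_measurable [measurable (raw)]:
  fixes g :: "'b \<Rightarrow> 'a::euclidean_space"
  assumes "f \<in> borel_measurable M" "g \<in> borel_measurable M"
  shows "(\<lambda>x. gauss_kernel (f x) (g x)) \<in> borel_measurable M"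
  using assms unfolding gauss_kernel_def by measurable

lemma gauss_weight_integral:
  assumes "a > 0" "\<epsilon> > 0"
  shows "has_bochner_integral lborel (gauss_weight \<epsilon> a) (Gamma a * (\<epsilon>\<^sup>2) powr - a)"
  unfolding gauss_weight_def[abs_def] using assms by (intro has_bochner_integral_powr_exp) auto

lemma gauss_kernel_fourier:
  fixes x :: "'a::euclidean_space"
  assumes r: "r > 0"
  shows "has_bochner_integral lborel (\<lambda>\<xi>. gauss_kernel r \<xi> * cos (x \<bullet> \<xi>)) (exp (- r * (norm x)\<^sup>2))"
proof -
  have A: "has_bochner_integral lborel (\<lambda>\<xi>. (4 * pi * r) powr - (real DIM('a) / 2) * (exp (- (1 / (4 * r)) * (norm \<xi>)\<^sup>2) * cos (x \<bullet> \<xi>)))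
     ((4 * pi * r) powr - (real DIM('a) / 2) * ((pi / (1 / (4 * r))) powr (real DIM('a) / 2) * exp (- (norm x)\<^sup>2 / (4 * (1 / (4 * r))))))"
    using r by (intro has_bochner_integral_mult_right gauss_cos_integral) auto
  have B: "(4 * pi * r) powr - (real DIM('a) / 2) * ((pi / (1 / (4 * r))) powr (real DIM('a) / 2) * exp (- (norm x)\<^sup>2 / (4 * (1 / (4 * r))))) = exp (- r * (norm x)\<^sup>2)"
  proof -
    have "pi / (1 / (4 * r)) = 4 * pi * r" by simp
    moreover have "(4 * pi * r) powr - (real DIM('a) / 2) * (4 * pi * r) powr (real DIM('a) / 2) = 1"
      using r by (simp flip: powr_add)
    moreover have "- (norm x)\<^sup>2 / (4 * (1 / (4 * r))) = - r * (norm x)\<^sup>2" by simp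
    ultimately show ?thesis by (simp only: mult.assoc[symmetric] mult_1)
  qed
  have C: "(4 * pi * r) powr - (real DIM('a) / 2) * (exp (- (1 / (4 * r)) * (norm \<xi>)\<^sup>2) * cos (x \<bullet> \<xi>)) = gauss_kernel r \<xi> * cos (x \<bullet> \<xi>)" for \<xi>
    by (simp add: gauss_kernel_def)
  show ?thesis using A unfolding B C .
qed

lemma gauss_kernel_integral:
  assumes "r > 0"
  shows "has_bochner_integral lborel (gauss_kernel r :: 'a::euclidean_space \<Rightarrow> real) 1"
  using gauss_kernel_fourier[OF assms, of "0::'a"] by simp

text \<open>The Gamma integral writes \<open>\<Gamma>(a) (\<epsilon>\<^sup>2 + |x|\<^sup>2)\<^sup>-\<^sup>a\<close> as a superposition of the Gaussians
  \<open>exp (- r |x|\<^sup>2)\<close>, each of which is a Fourier transform.\<close>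

lemma bubble_fourier:
  fixes x :: "'a::euclidean_space"
  assumes a: "a > 0" and \<epsilon>: "\<epsilon> > 0"
  shows "has_bochner_integral lborel (\<lambda>\<xi>. bubble_symbol \<epsilon> a \<xi> * cos (x \<bullet> \<xi>)) (Gamma a * (\<epsilon>\<^sup>2 + (norm x)\<^sup>2) powr - a)"
proof -
  let ?H = "\<lambda>(r, \<xi>). gauss_weight \<epsilon> a r * (gauss_kernel r \<xi> * cos (x \<bullet> \<xi>))"
  have gk: "integrable lborel (\<lambda>\<xi>. gauss_kernel r \<xi> * cos (x \<bullet> \<xi>))" if "r > 0" for r
    using gauss_kernel_fourier[OF that, of x] by (simp add: has_bochner_integral_iff)
  have i: "integrable (lborel \<Otimes>\<^sub>M lborel) ?H"
  proof (rule lborel_pair.Fubini_integrable)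
    show "?H \<in> borel_measurable (lborel \<Otimes>\<^sub>M lborel)" by measurable
    show "integrable lborel (\<lambda>r. LINT \<xi>|lborel. norm (?H (r, \<xi>)))"
    proof (rule integrable_dominated)
      show "integrable lborel (gauss_weight \<epsilon> a)" using gauss_weight_integral[OF a \<epsilon>] by (simp add: has_bochner_integral_iff)
      show "(\<lambda>r. LINT \<xi>|lborel. norm (?H (r, \<xi>))) \<in> borel_measurable lborel" by measurable
      fix r :: real
      show "\<bar>LINT \<xi>|lborel. norm (?H (r, \<xi>))\<bar> \<le> gauss_weight \<epsilon> a r"
      proof (cases "r > 0")
        case True
        note g = gauss_kernel_integral[OF True, where 'a = 'a]
        have "(LINT \<xi>|lborel. norm (?H (r, \<xi>))) \<le> (LINT \<xi>|lborel. gauss_weight \<epsilon> a r * gauss_kernel r (\<xi>::'a))"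
        proof (rule integral_mono)
          show "integrable lborel (\<lambda>\<xi>. norm (?H (r, \<xi>)))" using integrable_abs[OF integrable_mult_right[OF gk[OF True]]] by simp
          show "integrable lborel (\<lambda>\<xi>::'a. gauss_weight \<epsilon> a r * gauss_kernel r \<xi>)" using g by (simp add: has_bochner_integral_iff)
          show "norm (?H (r, \<xi>)) \<le> gauss_weight \<epsilon> a r * gauss_kernel r \<xi>" for \<xi>
            using mult_left_le[of "\<bar>cos (x \<bullet> \<xi>)\<bar>" "gauss_weight \<epsilon> a r * gauss_kernel r \<xi>"]
            by (simp add: abs_mult gauss_weight_nonneg gauss_kernel_nonneg mult.assoc)
        qed
        also have "\<dots> = gauss_weight \<epsilon> a r" using g by (simp add: has_bochner_integral_iff)
        finally show ?thesis by (simp add: abs_of_nonneg integral_nonneg_AE)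
      qed (simp add: gauss_weight_def)
    qed
    show "AE r in lborel. integrable lborel (\<lambda>\<xi>. ?H (r, \<xi>))"
    proof (rule AE_I2)
      fix r show "integrable lborel (\<lambda>\<xi>. ?H (r, \<xi>))"
        using gk[of r] by (cases "r > 0") (simp_all add: gauss_weight_def)
    qed
  qed
  have inner: "(LINT r|lborel. ?H (r, \<xi>)) = bubble_symbol \<epsilon> a \<xi> * cos (x \<bullet> \<xi>)" for \<xi>
    by (simp add: bubble_symbol_def mult.assoc[symmetric])
  have "integrable lborel (\<lambda>\<xi>. LINT r|lborel. ?H (r, \<xi>))"
    using lborel_pair.integrable_fst'[OF lborel_pair.integrable_product_swap[OF i]] by (simp add: case_prod_beta')
  then have I: "integrable lborel (\<lambda>\<xi>. bubble_symbol \<epsilon> a \<xi> * cos (x \<bullet> \<xi>))" unfolding inner .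
  have "(LINT \<xi>|lborel. LINT r|lborel. ?H (r, \<xi>)) = (LINT r|lborel. LINT \<xi>|lborel. ?H (r, \<xi>))"
    using lborel_pair.Fubini_integral[of "\<lambda>r \<xi>. ?H (r, \<xi>)"] i by simp
  also have "\<dots> = (LINT r|lborel. indicator {0<..} r * r powr (a - 1) * exp (- r * (\<epsilon>\<^sup>2 + (norm x)\<^sup>2)))"
  proof (intro Bochner_Integration.integral_cong refl)
    fix r :: real
    show "(LINT \<xi>|lborel. ?H (r, \<xi>)) = indicator {0<..} r * r powr (a - 1) * exp (- r * (\<epsilon>\<^sup>2 + (norm x)\<^sup>2))"
    proof (cases "r > 0")
      case True
      have "exp (- r * \<epsilon>\<^sup>2) * exp (- r * (norm x)\<^sup>2) = exp (- r * (\<epsilon>\<^sup>2 + (norm x)\<^sup>2))"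
        by (simp flip: exp_add add: algebra_simps)
      then show ?thesis using gauss_kernel_fourier[OF True, of x]
        by (simp add: has_bochner_integral_iff gauss_weight_def)
    qed (simp add: gauss_weight_def)
  qed
  also have "\<dots> = Gamma a * (\<epsilon>\<^sup>2 + (norm x)\<^sup>2) powr - a"
    using has_bochner_integral_powr_exp[OF a, of "\<epsilon>\<^sup>2 + (norm x)\<^sup>2"] \<epsilon> by (simp add: has_bochner_integral_iff add_pos_nonneg)
  finally show ?thesis using I unfolding inner by (simp add: has_bochner_integral_iff)
qed

text \<open>The substitution \<open>r \<mapsto> c / r\<close>.\<close>

lemma integral_inversion_halfline:
  fixes f :: "real \<Rightarrow> real"
  assumes c: "c > 0" and f: "integrable lborel (\<lambda>r. indicator {0<..} r * f r)"
  shows "(LINT r|lborel. indicator {0<..} r * (c / r\<^sup>2 * f (c / r))) = (LINT r|lborel. indicator {0<..} r * f r)"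
proof -
  have sf: "set_integrable lebesgue {0<..} f"
    using f unfolding set_integrable_def by (subst integrable_completion) auto
  have img: "(\<lambda>r. c / r) ` {0<..} = {0<..}"
  proof
    show "{0<..} \<subseteq> (\<lambda>r. c / r) ` {0<..}"
    proof
      fix y :: real assume "y \<in> {0<..}"
      then show "y \<in> (\<lambda>r. c / r) ` {0<..}" using c by (intro image_eqI[of _ _ "c / y"]) auto
    qed
  qed (use c in auto)
  have "(\<lambda>r. \<bar>- c / r\<^sup>2\<bar> * f (c / r)) absolutely_integrable_on {0<..} \<and>
      integral {0<..} (\<lambda>r. \<bar>- c / r\<^sup>2\<bar> * f (c / r)) = integral {0<..} f"
  proof (rule has_absolute_integral_change_of_variables_1'[where f = f and g = "\<lambda>r. c / r" and g' = "\<lambda>r. - c / r\<^sup>2" and S = "{0<..}", THEN iffD2])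
    show "((\<lambda>r. c / r) has_field_derivative - c / r\<^sup>2) (at r within {0<..})" if "r \<in> {0<..}" for r
      using that by (auto intro!: derivative_eq_intros simp: power2_eq_square)
    show "inj_on (\<lambda>r. c / r) {0<..}" using c by (auto simp: inj_on_def)
    show "f absolutely_integrable_on (\<lambda>r. c / r) ` {0<..} \<and> integral ((\<lambda>r. c / r) ` {0<..}) f = integral {0<..} f"
      unfolding img using sf by simp
  qed simp
  then have s1: "set_integrable lebesgue {0<..} (\<lambda>r. c / r\<^sup>2 * f (c / r))"
    and s2: "integral {0<..} (\<lambda>r. c / r\<^sup>2 * f (c / r)) = integral {0<..} f" using c by simp_all
  have m: "(\<lambda>r. indicator {0<..} r * f r) \<in> borel_measurable borel" using f by (auto dest: borel_measurable_integrable)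
  have "(\<lambda>r. indicator {0<..} r * (c / r\<^sup>2) * (indicator {0<..} (c / r) * f (c / r))) \<in> borel_measurable borel"
    by (intro borel_measurable_times measurable_compose[OF _ m]) measurable
  also have "(\<lambda>r. indicator {0<..} r * (c / r\<^sup>2) * (indicator {0<..} (c / r) * f (c / r))) = (\<lambda>r. indicator {0<..} r * (c / r\<^sup>2 * f (c / r)))"
    using c by (auto simp: fun_eq_iff indicator_def)
  finally have m2: "(\<lambda>r. indicator {0<..} r * (c / r\<^sup>2 * f (c / r))) \<in> borel_measurable borel" .
  have "(LINT r|lborel. indicator {0<..} r * (c / r\<^sup>2 * f (c / r))) = (LINT r:{0<..}|lebesgue. c / r\<^sup>2 * f (c / r))"
    unfolding set_lebesgue_integral_def using m2 by (subst integral_completion) auto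
  also have "\<dots> = (LINT r:{0<..}|lebesgue. f r)"
    using set_lebesgue_integral_eq_integral(2)[OF s1] set_lebesgue_integral_eq_integral(2)[OF sf] s2 by simp
  also have "\<dots> = (LINT r|lborel. indicator {0<..} r * f r)"
    unfolding set_lebesgue_integral_def using m by (subst integral_completion) auto
  finally show ?thesis .
qed

text \<open>The inversion \<open>r \<mapsto> |\<xi>|\<^sup>2 / (4 \<epsilon>\<^sup>2 r)\<close> of the Gaussian parameter exchanges the two
  exponents and produces the factor \<open>|\<xi>|\<^sup>2\<^sup>s\<close>.\<close>

lemma bubble_symbol_powr:
  fixes \<xi> :: "'a::euclidean_space"
  assumes s: "0 < s" "2 * s < real DIM('a)" and \<epsilon>: "\<epsilon> > 0" and \<xi>: "\<xi> \<noteq> 0"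
  shows "norm \<xi> powr (2 * s) * bubble_symbol \<epsilon> (real DIM('a) / 2 - s) \<xi>
    = 4 powr s * \<epsilon> powr (2 * s) * bubble_symbol \<epsilon> (real DIM('a) / 2 + s) \<xi>"
proof -
  let ?N = "real DIM('a)"
  define L where "L = (norm \<xi>)\<^sup>2 / 4"
  have L: "L > 0" using \<xi> by (simp add: L_def)
  define P where "P = (4 * pi) powr - (?N / 2)"
  have form: "gauss_weight \<epsilon> (?N / 2 + \<nu>) r * gauss_kernel r \<xi> = P * (indicator {0<..} r * (r powr (\<nu> - 1) * exp (- (r * \<epsilon>\<^sup>2 + L / r))))" for \<nu> r
  proof (cases "r > 0")
    case True
    have "r powr (?N / 2 + \<nu> - 1) * r powr - (?N / 2) = r powr (\<nu> - 1)" by (simp flip: powr_add)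
    moreover have "(4 * pi * r) powr - (?N / 2) = P * r powr - (?N / 2)" unfolding P_def by (rule powr_mult)
    moreover have "exp (- r * \<epsilon>\<^sup>2) * exp (- (norm \<xi>)\<^sup>2 / (4 * r)) = exp (- (r * \<epsilon>\<^sup>2 + L / r))"
      by (simp flip: exp_add add: L_def)
    moreover have "gauss_weight \<epsilon> (?N / 2 + \<nu>) r * gauss_kernel r \<xi>
       = (r powr (?N / 2 + \<nu> - 1) * (4 * pi * r) powr - (?N / 2)) * (exp (- r * \<epsilon>\<^sup>2) * exp (- (norm \<xi>)\<^sup>2 / (4 * r)))"
      using True by (simp add: gauss_weight_def gauss_kernel_def mult_ac)
    ultimately show ?thesis using True by (simp add: mult_ac)
  qed (simp add: gauss_weight_def)
  define f where "f r = r powr (s - 1) * exp (- (r * \<epsilon>\<^sup>2 + L / r))" for r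
  have fi: "integrable lborel (\<lambda>r. indicator {0<..} r * f r)"
  proof (rule integrable_dominated)
    show "integrable lborel (gauss_weight \<epsilon> s)" using gauss_weight_integral[OF s(1) \<epsilon>] by (simp add: has_bochner_integral_iff)
    show "\<bar>indicator {0<..} r * f r\<bar> \<le> gauss_weight \<epsilon> s r" for r
      using L by (auto simp: gauss_weight_def f_def indicator_def abs_mult)
    show "(\<lambda>r. indicator {0<..} r * f r) \<in> borel_measurable lborel" unfolding f_def[abs_def] by measurable
  qed
  define c where "c = L / \<epsilon>\<^sup>2"
  have c: "c > 0" using L \<epsilon> by (simp add: c_def)
  have b1: "bubble_symbol \<epsilon> (?N / 2 + s) \<xi> = P * (LINT r|lborel. indicator {0<..} r * f r)"
    unfolding bubble_symbol_def form f_def by simp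
  have "bubble_symbol \<epsilon> (?N / 2 - s) \<xi> = P * (LINT r|lborel. indicator {0<..} r * (r powr (- s - 1) * exp (- (r * \<epsilon>\<^sup>2 + L / r))))"
    unfolding bubble_symbol_def using form[of "- s"] by simp
  also have "(LINT r|lborel. indicator {0<..} r * (r powr (- s - 1) * exp (- (r * \<epsilon>\<^sup>2 + L / r))))
     = (LINT r|lborel. c powr - s * (indicator {0<..} r * (c / r\<^sup>2 * f (c / r))))"
  proof (intro Bochner_Integration.integral_cong refl)
    fix r :: real
    show "indicator {0<..} r * (r powr (- s - 1) * exp (- (r * \<epsilon>\<^sup>2 + L / r))) = c powr - s * (indicator {0<..} r * (c / r\<^sup>2 * f (c / r)))"
    proof (cases "r > 0")
      case True
      have e1: "c / r * \<epsilon>\<^sup>2 = L / r" "L / (c / r) = r * \<epsilon>\<^sup>2" using True L \<epsilon> by (simp_all add: c_def field_simps)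
      have pw: "c powr - s * (c / r\<^sup>2 * (c / r) powr (s - 1)) = r powr (- s - 1)"
      proof -
        have "(c / r) powr (s - 1) = c powr (s - 1) * r powr (1 - s)"
          using True c by (simp add: powr_divide powr_diff field_simps)
        moreover have "c powr - s * c * c powr (s - 1) = 1"
          using c powr_add[of c "- s" 1] powr_add[of c "1 - s" "s - 1"] by (simp add: powr_add[symmetric])
        moreover have "r powr (1 - s) / r\<^sup>2 = r powr (- s - 1)"
          using True by (simp add: powr_diff powr_minus power2_eq_square field_simps)
        moreover have "c powr - s * (c / r\<^sup>2 * (c powr (s - 1) * r powr (1 - s))) = (c powr - s * c * c powr (s - 1)) * (r powr (1 - s) / r\<^sup>2)"
          by simp
        ultimately show ?thesis by (simp only: mult_1)
      qed
      have E: "exp (- (c / r * \<epsilon>\<^sup>2 + L / (c / r))) = exp (- (r * \<epsilon>\<^sup>2 + L / r))"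
        by (simp only: e1 add.commute)
      have "c powr - s * (c / r\<^sup>2 * f (c / r)) = (c powr - s * (c / r\<^sup>2 * (c / r) powr (s - 1))) * exp (- (r * \<epsilon>\<^sup>2 + L / r))"
        unfolding f_def E by (simp only: mult.assoc)
      then have e2: "c powr - s * (c / r\<^sup>2 * f (c / r)) = r powr (- s - 1) * exp (- (r * \<epsilon>\<^sup>2 + L / r))"
        unfolding pw .
      have ind: "indicator {0<..} r = (1::real)" using True by simp
      show ?thesis unfolding ind mult_1 by (rule e2[symmetric])
    qed simp
  qed
  also have "\<dots> = c powr - s * (LINT r|lborel. indicator {0<..} r * f r)"
    by (simp only: integral_mult_right_zero integral_inversion_halfline[OF c fi])
  finally have b2: "bubble_symbol \<epsilon> (?N / 2 - s) \<xi> = c powr - s * bubble_symbol \<epsilon> (?N / 2 + s) \<xi>"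
    unfolding b1 by simp
  have "norm \<xi> powr (2 * s) * c powr - s = 4 powr s * \<epsilon> powr (2 * s)"
  proof -
    have n: "(norm \<xi>)\<^sup>2 powr s = norm \<xi> powr (2 * s)" "\<epsilon>\<^sup>2 powr s = \<epsilon> powr (2 * s)"
      using powr_powr[of "norm \<xi>" 2 s] powr_powr[of \<epsilon> 2 s] \<epsilon> by simp_all
    have "c powr - s = 4 powr s * \<epsilon> powr (2 * s) / norm \<xi> powr (2 * s)"
      using \<epsilon> \<xi> by (simp add: c_def L_def powr_minus powr_divide powr_mult n field_simps)
    then show ?thesis using \<xi> by simp
  qed
  then show ?thesis unfolding b2 by (simp only: mult.assoc[symmetric])
qed

text \<open>Taking second differences multiplies the Fourier integrand by \<open>2 (1 - cos (\<xi> \<bullet> z))\<close>. Integrated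
  against the kernel this gives the factor \<open>|\<xi>|\<^sup>2\<^sup>s\<close>, by the normalization of the constant, and
  \<open>bubble_symbol_powr\<close> recognizes the product as the symbol of another bubble.\<close>

lemma flap_bubble:
  fixes x :: "'a::euclidean_space"
  assumes s: "0 < s" "s < 1" "2 * s < real DIM('a)" and \<epsilon>: "\<epsilon> > 0"
  defines "f \<equiv> \<lambda>x::'a. (\<epsilon>\<^sup>2 + (norm x)\<^sup>2) powr - (real DIM('a) / 2 - s)"
  shows "integrable lborel (\<lambda>z. diff2 f x z * levy s z)"
    and "flap s f x = 4 powr s * \<epsilon> powr (2 * s) * Gamma (real DIM('a) / 2 + s) / Gamma (real DIM('a) / 2 - s)
       * (\<epsilon>\<^sup>2 + (norm x)\<^sup>2) powr - (real DIM('a) / 2 + s)"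
proof -
  let ?N = "real DIM('a)" and ?C = "frac_lap_const DIM('a) s"
  define b where "b = ?N / 2 - s"
  define a where "a = ?N / 2 + s"
  have ab: "a > 0" "b > 0" using s by (auto simp: a_def b_def)
  have C: "?C > 0"
    unfolding frac_lap_const_def using s by (intro divide_pos_pos mult_pos_pos Gamma_real_pos) auto
  define D where "D = (bubble_symbol \<epsilon> b :: 'a \<Rightarrow> real)"
  have D0: "D \<xi> \<ge> 0" for \<xi> by (simp add: D_def bubble_symbol_nonneg)
  have Dm[measurable]: "D \<in> borel_measurable borel"
    unfolding D_def bubble_symbol_def[abs_def] by measurable
  have frep: "has_bochner_integral lborel (\<lambda>\<xi>. D \<xi> * cos (x \<bullet> \<xi>)) (Gamma b * f x)" for x
    using bubble_fourier[OF ab(2) \<epsilon>, of x] by (simp add: D_def f_def b_def)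
  have d2: "has_bochner_integral lborel (\<lambda>\<xi>. 2 * (D \<xi> * cos (x \<bullet> \<xi>)) * (1 - cos (\<xi> \<bullet> z))) (Gamma b * diff2 f x z)" for x z
  proof -
    have "has_bochner_integral lborel (\<lambda>\<xi>. 2 * (D \<xi> * cos (x \<bullet> \<xi>)) - D \<xi> * cos ((x + z) \<bullet> \<xi>) - D \<xi> * cos ((x - z) \<bullet> \<xi>))
       (2 * (Gamma b * f x) - Gamma b * f (x + z) - Gamma b * f (x - z))"
      by (intro has_bochner_integral_diff has_bochner_integral_mult_right frep)
    moreover have "2 * (D \<xi> * cos (x \<bullet> \<xi>)) - D \<xi> * cos ((x + z) \<bullet> \<xi>) - D \<xi> * cos ((x - z) \<bullet> \<xi>) = 2 * (D \<xi> * cos (x \<bullet> \<xi>)) * (1 - cos (\<xi> \<bullet> z))" for \<xi>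
      by (simp add: inner_add_left inner_diff_left cos_add cos_diff inner_commute[of \<xi> z] algebra_simps)
    moreover have "2 * (Gamma b * f x) - Gamma b * f (x + z) - Gamma b * f (x - z) = Gamma b * diff2 f x z"
      by (simp add: diff2_def algebra_simps)
    ultimately show ?thesis by simp
  qed
  have sy: "has_bochner_integral lborel (\<lambda>z. ?C * ((1 - cos (\<xi> \<bullet> z)) * levy s z)) (norm \<xi> powr (2 * s))" for \<xi> :: 'a
    using frac_lap_const_symbol[OF s(1,2), of \<xi>] unfolding divide_norm_powr_levy by (simp add: mult_ac)
  have AEp: "AE \<xi> in lborel. norm \<xi> powr (2 * s) * D \<xi> = 4 powr s * \<epsilon> powr (2 * s) * bubble_symbol \<epsilon> a \<xi>"
    using AE_lborel_singleton[of "0::'a"] by eventually_elim (simp add: D_def b_def a_def bubble_symbol_powr[OF s(1,3) \<epsilon>])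
  have bm[measurable]: "(bubble_symbol \<epsilon> a :: 'a \<Rightarrow> real) \<in> borel_measurable borel"
    unfolding bubble_symbol_def[abs_def] by measurable
  have arep: "has_bochner_integral lborel (\<lambda>\<xi>. norm \<xi> powr (2 * s) * D \<xi> * cos (x \<bullet> \<xi>)) (4 powr s * \<epsilon> powr (2 * s) * (Gamma a * (\<epsilon>\<^sup>2 + (norm x)\<^sup>2) powr - a))" for x
  proof (rule has_bochner_integral_cong_AE[THEN iffD1])
    show "has_bochner_integral lborel (\<lambda>\<xi>. 4 powr s * \<epsilon> powr (2 * s) * (bubble_symbol \<epsilon> a \<xi> * cos (x \<bullet> \<xi>))) (4 powr s * \<epsilon> powr (2 * s) * (Gamma a * (\<epsilon>\<^sup>2 + (norm x)\<^sup>2) powr - a))"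
      by (intro has_bochner_integral_mult_right bubble_fourier ab \<epsilon>)
    show "AE \<xi> in lborel. 4 powr s * \<epsilon> powr (2 * s) * (bubble_symbol \<epsilon> a \<xi> * cos (x \<bullet> \<xi>)) = norm \<xi> powr (2 * s) * D \<xi> * cos (x \<bullet> \<xi>)"
      using AEp by eventually_elim (simp add: mult.assoc[symmetric])
  qed measurable
  let ?H = "\<lambda>(\<xi>, z). D \<xi> * cos (x \<bullet> \<xi>) * (?C * ((1 - cos (\<xi> \<bullet> z)) * levy s z))"
  have i: "integrable (lborel \<Otimes>\<^sub>M lborel) ?H"
  proof (rule lborel_pair.Fubini_integrable)
    show "?H \<in> borel_measurable (lborel \<Otimes>\<^sub>M lborel)" by measurable
    show "AE \<xi> in lborel. integrable lborel (\<lambda>z. ?H (\<xi>, z))"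
      using sy by (auto simp: has_bochner_integral_iff intro!: AE_I2)
    have "(LINT z|lborel. norm (?H (\<xi>, z))) = \<bar>cos (x \<bullet> \<xi>)\<bar> * (norm \<xi> powr (2 * s) * D \<xi>)" for \<xi>
    proof -
      have "(LINT z|lborel. norm (?H (\<xi>, z))) = (LINT z|lborel. \<bar>D \<xi> * cos (x \<bullet> \<xi>)\<bar> * (?C * ((1 - cos (\<xi> \<bullet> z)) * levy s z)))"
        using C by (intro Bochner_Integration.integral_cong refl) (simp add: abs_mult levy_nonneg)
      also have "\<dots> = \<bar>D \<xi> * cos (x \<bullet> \<xi>)\<bar> * norm \<xi> powr (2 * s)"
        using sy[of \<xi>] by (simp add: has_bochner_integral_iff)
      finally show ?thesis using D0[of \<xi>] by (simp add: abs_mult mult_ac)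
    qed
    moreover have "integrable lborel (\<lambda>\<xi>. \<bar>cos (x \<bullet> \<xi>)\<bar> * (norm \<xi> powr (2 * s) * D \<xi>))"
    proof (rule integrable_dominated)
      show "integrable lborel (\<lambda>\<xi>. norm \<xi> powr (2 * s) * D \<xi>)" using arep[of 0] by (simp add: has_bochner_integral_iff)
      show "\<bar>\<bar>cos (x \<bullet> \<xi>)\<bar> * (norm \<xi> powr (2 * s) * D \<xi>)\<bar> \<le> norm \<xi> powr (2 * s) * D \<xi>" for \<xi>
        using D0[of \<xi>] by (simp add: abs_mult mult_left_le_one_le)
    qed measurable
    ultimately show "integrable lborel (\<lambda>\<xi>. LINT z|lborel. norm (?H (\<xi>, z)))" by simp
  qed
  have in1: "(LINT \<xi>|lborel. ?H (\<xi>, z)) = Gamma b * (?C / 2 * (diff2 f x z * levy s z))" for z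
  proof -
    have "(LINT \<xi>|lborel. ?H (\<xi>, z)) = (LINT \<xi>|lborel. ?C / 2 * levy s z * (2 * (D \<xi> * cos (x \<bullet> \<xi>)) * (1 - cos (\<xi> \<bullet> z))))"
      by (intro Bochner_Integration.integral_cong refl) (simp add: mult_ac)
    also have "\<dots> = ?C / 2 * levy s z * (LINT \<xi>|lborel. 2 * (D \<xi> * cos (x \<bullet> \<xi>)) * (1 - cos (\<xi> \<bullet> z)))"
      by (rule integral_mult_right_zero)
    also have "(LINT \<xi>|lborel. 2 * (D \<xi> * cos (x \<bullet> \<xi>)) * (1 - cos (\<xi> \<bullet> z))) = Gamma b * diff2 f x z"
      using d2[of x z] by (simp only: has_bochner_integral_iff)
    finally show ?thesis by (simp add: mult_ac)
  qed
  have in2: "(LINT z|lborel. ?H (\<xi>, z)) = norm \<xi> powr (2 * s) * D \<xi> * cos (x \<bullet> \<xi>)" for \<xi>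
    using sy[of \<xi>] by (simp add: has_bochner_integral_iff)
  have Gb: "Gamma b > 0" using ab by simp
  have "integrable lborel (\<lambda>z. LINT \<xi>|lborel. ?H (\<xi>, z))"
    using lborel_pair.integrable_fst'[OF lborel_pair.integrable_product_swap[OF i]] by (simp add: case_prod_beta')
  then have "integrable lborel (\<lambda>z. (Gamma b * (?C / 2)) * (diff2 f x z * levy s z))" unfolding in1 by (simp add: mult.assoc)
  from integrable_mult_right[OF this, of "1 / (Gamma b * (?C / 2))"]
  show "integrable lborel (\<lambda>z. diff2 f x z * levy s z)" using Gb C by simp
  have "Gamma b * flap s f x = (LINT z|lborel. LINT \<xi>|lborel. ?H (\<xi>, z))"
    unfolding in1 flap_def by simp
  also have "\<dots> = (LINT \<xi>|lborel. LINT z|lborel. ?H (\<xi>, z))"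
    using lborel_pair.Fubini_integral[of "\<lambda>\<xi> z. ?H (\<xi>, z)"] i by simp
  also have "\<dots> = 4 powr s * \<epsilon> powr (2 * s) * (Gamma a * (\<epsilon>\<^sup>2 + (norm x)\<^sup>2) powr - a)"
    unfolding in2 using arep[of x] by (simp add: has_bochner_integral_iff)
  finally show "flap s f x = 4 powr s * \<epsilon> powr (2 * s) * Gamma (?N / 2 + s) / Gamma (?N / 2 - s)
       * (\<epsilon>\<^sup>2 + (norm x)\<^sup>2) powr - (?N / 2 + s)"
    using Gb unfolding a_def[symmetric] b_def[symmetric] by (simp add: field_simps)
qed

lemma bubble_integral:
  assumes s: "0 < s" and \<epsilon>: "\<epsilon> > 0"
  shows "has_bochner_integral lborel (\<lambda>x::'a::euclidean_space. (\<epsilon>\<^sup>2 + (norm x)\<^sup>2) powr - (real DIM('a) / 2 + s))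
     (pi powr (real DIM('a) / 2) * Gamma s * \<epsilon> powr - (2 * s) / Gamma (real DIM('a) / 2 + s))"
proof -
  let ?N = "real DIM('a)"
  define a where "a = ?N / 2 + s"
  have a: "a > 0" using s by (simp add: a_def add_nonneg_pos)
  have Ga: "Gamma a > 0" using a by simp
  let ?h = "\<lambda>r (x::'a). ennreal (indicator {0<..} r * r powr (a - 1) * exp (- r * (\<epsilon>\<^sup>2 + (norm x)\<^sup>2)))"
  have e: "\<epsilon>\<^sup>2 + (norm x)\<^sup>2 > 0" for x :: 'a using \<epsilon> by (simp add: add_pos_nonneg)
  have "(\<integral>\<^sup>+x. ennreal (Gamma a * (\<epsilon>\<^sup>2 + (norm (x::'a))\<^sup>2) powr - a) \<partial>lborel) = (\<integral>\<^sup>+x. (\<integral>\<^sup>+r. ?h r x \<partial>lborel) \<partial>lborel)"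
    by (intro nn_integral_cong, subst nn_integral_powr_exp[OF a e]) (simp add: powr_minus divide_inverse)
  also have "\<dots> = (\<integral>\<^sup>+r. (\<integral>\<^sup>+x. ?h r x \<partial>lborel) \<partial>lborel)"
    by (rule lborel_pair.Fubini') measurable
  also have "\<dots> = (\<integral>\<^sup>+r. ennreal (pi powr (?N / 2)) * ennreal (indicator {0<..} r * r powr (s - 1) * exp (- r * \<epsilon>\<^sup>2)) \<partial>lborel)"
  proof (intro nn_integral_cong)
    fix r :: real
    show "(\<integral>\<^sup>+x. ?h r x \<partial>lborel) = ennreal (pi powr (?N / 2)) * ennreal (indicator {0<..} r * r powr (s - 1) * exp (- r * \<epsilon>\<^sup>2))"
    proof (cases "r > 0")
      case True
      have G: "has_bochner_integral lborel (\<lambda>y::'a. exp (- r * (norm y)\<^sup>2)) ((pi / r) powr (?N / 2))"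
        using gauss_cos_integral[OF True, of "0::'a"] by simp
      have "(\<integral>\<^sup>+x. ?h r x \<partial>lborel) = (\<integral>\<^sup>+x. ennreal (r powr (a - 1) * exp (- r * \<epsilon>\<^sup>2)) * ennreal (exp (- r * (norm (x::'a))\<^sup>2)) \<partial>lborel)"
      proof (intro nn_integral_cong)
        fix x :: 'a
        have "exp (- r * (\<epsilon>\<^sup>2 + (norm x)\<^sup>2)) = exp (- r * \<epsilon>\<^sup>2) * exp (- r * (norm x)\<^sup>2)"
          by (simp flip: exp_add add: algebra_simps)
        then show "?h r x = ennreal (r powr (a - 1) * exp (- r * \<epsilon>\<^sup>2)) * ennreal (exp (- r * (norm x)\<^sup>2))"
          using True by (simp flip: ennreal_mult' add: mult.assoc)
      qed
      also have "\<dots> = ennreal (r powr (a - 1) * exp (- r * \<epsilon>\<^sup>2)) * (\<integral>\<^sup>+x. ennreal (exp (- r * (norm (x::'a))\<^sup>2)) \<partial>lborel)"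
        by (rule nn_integral_cmult) measurable
      also have "(\<integral>\<^sup>+x. ennreal (exp (- r * (norm (x::'a))\<^sup>2)) \<partial>lborel) = ennreal ((pi / r) powr (?N / 2))"
        using G by (subst nn_integral_eq_integral) (auto simp: has_bochner_integral_iff)
      also have "ennreal (r powr (a - 1) * exp (- r * \<epsilon>\<^sup>2)) * ennreal ((pi / r) powr (?N / 2)) = ennreal (pi powr (?N / 2)) * ennreal (indicator {0<..} r * r powr (s - 1) * exp (- r * \<epsilon>\<^sup>2))"
      proof -
        have pr: "r powr (a - 1) * (pi / r) powr (?N / 2) = pi powr (?N / 2) * r powr (s - 1)"
        proof -
          have "a - 1 = (s - 1) + ?N / 2" by (simp add: a_def)
          then have "r powr (a - 1) = r powr (s - 1) * r powr (?N / 2)" by (simp only: powr_add)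
          then show ?thesis using True by (simp add: powr_divide)
        qed
        have ind: "indicator {0<..} r = (1::real)" using True by simp
        have "r powr (a - 1) * exp (- r * \<epsilon>\<^sup>2) * (pi / r) powr (?N / 2) = (r powr (a - 1) * (pi / r) powr (?N / 2)) * exp (- r * \<epsilon>\<^sup>2)"
          by (simp only: mult_ac)
        then have eq: "r powr (a - 1) * exp (- r * \<epsilon>\<^sup>2) * (pi / r) powr (?N / 2) = pi powr (?N / 2) * (indicator {0<..} r * r powr (s - 1) * exp (- r * \<epsilon>\<^sup>2))"
          unfolding pr ind by (simp only: mult.assoc mult_1)
        have "ennreal (r powr (a - 1) * exp (- r * \<epsilon>\<^sup>2)) * ennreal ((pi / r) powr (?N / 2)) = ennreal (r powr (a - 1) * exp (- r * \<epsilon>\<^sup>2) * (pi / r) powr (?N / 2))"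
          by (rule ennreal_mult'[symmetric]) simp
        also have "\<dots> = ennreal (pi powr (?N / 2)) * ennreal (indicator {0<..} r * r powr (s - 1) * exp (- r * \<epsilon>\<^sup>2))"
          unfolding eq by (rule ennreal_mult') simp
        finally show ?thesis .
      qed
      finally show ?thesis .
    qed simp
  qed
  also have "\<dots> = ennreal (pi powr (?N / 2)) * ennreal (Gamma s / (\<epsilon>\<^sup>2) powr s)"
  proof -
    have n: "(\<integral>\<^sup>+r. ennreal (indicator {0<..} r * r powr (s - 1) * exp (- r * \<epsilon>\<^sup>2)) \<partial>lborel) = ennreal (Gamma s / (\<epsilon>\<^sup>2) powr s)"
      by (rule nn_integral_powr_exp) (use s \<epsilon> in auto)
    show ?thesis unfolding n[symmetric] by (rule nn_integral_cmult) measurable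
  qed
  also have "(\<epsilon>\<^sup>2) powr s = \<epsilon> powr (2 * s)" using powr_powr[of \<epsilon> 2 s] \<epsilon> by simp
  also have "ennreal (pi powr (?N / 2)) * ennreal (Gamma s / \<epsilon> powr (2 * s)) = ennreal (pi powr (?N / 2) * Gamma s * \<epsilon> powr - (2 * s))"
  proof -
    have "Gamma s / \<epsilon> powr (2 * s) = Gamma s * \<epsilon> powr - (2 * s)" by (simp only: powr_minus divide_inverse)
    then show ?thesis by (simp only: mult.assoc ennreal_mult'[OF powr_ge_zero])
  qed
  finally have n: "(\<integral>\<^sup>+x. ennreal (Gamma a * (\<epsilon>\<^sup>2 + (norm (x::'a))\<^sup>2) powr - a) \<partial>lborel) = ennreal (pi powr (?N / 2) * Gamma s * \<epsilon> powr - (2 * s))" .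
  have "has_bochner_integral lborel (\<lambda>x::'a. Gamma a * (\<epsilon>\<^sup>2 + (norm x)\<^sup>2) powr - a) (pi powr (?N / 2) * Gamma s * \<epsilon> powr - (2 * s))"
  proof (rule has_bochner_integral_nn_integral[OF _ _ _ n])
    show "0 \<le> pi powr (?N / 2) * Gamma s * \<epsilon> powr - (2 * s)"
      using s by (intro mult_nonneg_nonneg less_imp_le[OF Gamma_real_pos]) simp_all
    show "AE x in lborel. 0 \<le> Gamma a * (\<epsilon>\<^sup>2 + (norm (x::'a))\<^sup>2) powr - a"
      using Ga by (intro AE_I2 mult_nonneg_nonneg) simp_all
  qed measurable
  from has_bochner_integral_mult_right[OF this, of "1 / Gamma a"] Ga show ?thesis
    by (simp add: a_def[symmetric])
qed

section \<open>Differences of bubbles as test functions\<close>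

text \<open>Along the segment from \<open>x - z\<close> to \<open>x + z\<close> the function is \<open>g\<close> of a quadratic polynomial in one
  variable; each differentiation in it costs a factor \<open>|z|\<close> and gains one power of decay.\<close>

lemma radial_symbol_bound:
  fixes x0 :: "'a::euclidean_space" and g g1 g2 :: "real \<Rightarrow> real"
  assumes \<epsilon>: "\<epsilon> > 0" and k: "k \<ge> 0" and M: "M \<ge> 0"
    and d1: "\<And>q. q \<ge> 0 \<Longrightarrow> (g has_real_derivative g1 q) (at q)"
    and d2: "\<And>q. q \<ge> 0 \<Longrightarrow> (g1 has_real_derivative g2 q) (at q)"
    and b0: "\<And>q. q \<ge> 0 \<Longrightarrow> \<bar>g q\<bar> \<le> M * (\<epsilon>\<^sup>2 + q) powr - k"
    and b1: "\<And>q. q \<ge> 0 \<Longrightarrow> \<bar>g1 q\<bar> \<le> M * (\<epsilon>\<^sup>2 + q) powr (- k - 1)"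
    and b2: "\<And>q. q \<ge> 0 \<Longrightarrow> \<bar>g2 q\<bar> \<le> M * (\<epsilon>\<^sup>2 + q) powr (- k - 2)"
  shows "\<exists>A. symbol_bound (2 * k) A (\<lambda>y. g ((norm (y - x0))\<^sup>2))"
proof -
  let ?f = "\<lambda>y. g ((norm (y - x0))\<^sup>2)"
  \<comment> \<open>On the segment \<open>1 + |x|\<close> is at most \<open>L\<close> times the root of \<open>\<epsilon>\<^sup>2 + |y - x0|\<^sup>2\<close>.\<close>
  define L where "L = 2 * ((1 + norm x0) / \<epsilon> + 1)"
  have L: "L \<ge> 1" using \<epsilon> by (simp add: L_def)
  define Q where "Q y = \<epsilon>\<^sup>2 + (norm (y - x0))\<^sup>2" for y
  have Q: "Q y > 0" for y using \<epsilon> by (simp add: Q_def add_pos_nonneg)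
  have far: "(1 + norm x) / L \<le> sqrt (Q (x + t *\<^sub>R z))"
    if z: "norm z \<le> (1 + norm x) / 2" and t: "\<bar>t\<bar> \<le> 1" for x z :: 'a and t
  proof -
    let ?y = "x + t *\<^sub>R z"
    have "norm (t *\<^sub>R z) \<le> 1 * norm z" using t by (simp add: mult_left_le_one_le)
    then have "norm x \<le> norm ?y + norm z" using norm_triangle_ineq2[of x "- (t *\<^sub>R z)"] by simp
    then have y: "(1 + norm x) / 2 \<le> 1 + norm ?y" using z by argo
    have "\<epsilon> \<le> sqrt (Q ?y)" "norm (?y - x0) \<le> sqrt (Q ?y)"
      by (auto intro!: real_le_rsqrt simp: Q_def)
    moreover have "norm ?y \<le> norm (?y - x0) + norm x0" using norm_triangle_ineq[of "?y - x0" x0] by simp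
    moreover have "1 + norm x0 = (1 + norm x0) / \<epsilon> * \<epsilon>" using \<epsilon> by simp
    moreover have "(1 + norm x0) / \<epsilon> * \<epsilon> \<le> (1 + norm x0) / \<epsilon> * sqrt (Q ?y)"
      using \<epsilon> calculation(1) by (intro mult_left_mono) auto
    ultimately have "1 + norm ?y \<le> ((1 + norm x0) / \<epsilon> + 1) * sqrt (Q ?y)"
      unfolding distrib_right by argo
    then have "1 + norm x \<le> L * sqrt (Q ?y)" using y unfolding L_def by argo
    then show ?thesis using L by (simp add: divide_le_eq mult.commute)
  qed
  have pw: "Q (x + t *\<^sub>R z) powr - (j / 2) \<le> L powr (2 * k + 2) * (1 + norm x) powr - j"
    if z: "norm z \<le> (1 + norm x) / 2" and t: "\<bar>t\<bar> \<le> 1" and j: "0 \<le> j" "j \<le> 2 * k + 2" for x z :: 'a and t j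
  proof -
    let ?y = "x + t *\<^sub>R z"
    have "Q ?y powr - (j / 2) = (sqrt (Q ?y)) powr - j"
      using Q[of ?y] by (simp add: powr_half_sqrt[symmetric] powr_powr)
    also have "\<dots> \<le> ((1 + norm x) / L) powr - j"
      using far[OF z t] L j by (intro powr_mono2') (auto intro!: divide_pos_pos)
    also have "\<dots> = L powr j * (1 + norm x) powr - j"
      using L by (simp add: powr_divide powr_minus field_simps)
    also have "\<dots> \<le> L powr (2 * k + 2) * (1 + norm x) powr - j"
      using L j by (intro mult_right_mono powr_mono) auto
    finally show ?thesis .
  qed
  define A where "A = 12 * M * L powr (2 * k + 2)"
  have "symbol_bound (2 * k) A ?f"
    unfolding symbol_bound_def
  proof (intro allI impI conjI)
    fix x z :: 'a
    have "\<bar>?f x\<bar> \<le> M * Q x powr - k" using b0[of "(norm (x - x0))\<^sup>2"] by (simp add: Q_def)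
    also have "\<dots> \<le> M * (L powr (2 * k + 2) * (1 + norm x) powr - (2 * k))"
      using pw[of 0 x 0 "2 * k"] k M by (intro mult_left_mono) auto
    also have "\<dots> \<le> 12 * (M * (L powr (2 * k + 2) * (1 + norm x) powr - (2 * k)))" using M by simp
    finally show "\<bar>?f x\<bar> \<le> A * (1 + norm x) powr - (2 * k)" by (simp add: A_def mult.assoc)
    assume z: "norm z \<le> (1 + norm x) / 2"
    define v where "v t = x + t *\<^sub>R z - x0" for t
    define q where "q t = (norm (v t))\<^sup>2" for t
    have qd: "(q has_real_derivative 2 * (v t \<bullet> z)) (at t)" for t
    proof -
      have e: "q = (\<lambda>t. (norm (x - x0))\<^sup>2 + t * (2 * ((x - x0) \<bullet> z)) + t\<^sup>2 * (norm z)\<^sup>2)"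
        unfolding q_def v_def power2_norm_eq_inner
        by (simp add: fun_eq_iff inner_add_left inner_add_right inner_diff_left inner_diff_right inner_commute power2_eq_square algebra_simps)
      have "v t \<bullet> z = (x - x0) \<bullet> z + t * (norm z)\<^sup>2"
        unfolding v_def power2_norm_eq_inner by (simp add: inner_add_left inner_diff_left algebra_simps)
      then show ?thesis unfolding e by (auto intro!: derivative_eq_intros simp: algebra_simps)
    qed
    have q0: "q t \<ge> 0" for t by (simp add: q_def)
    have Qq: "\<epsilon>\<^sup>2 + q t = Q (x + t *\<^sub>R z)" for t by (simp add: Q_def q_def v_def)
    define h where "h t = g (q t)" for t
    define h1 where "h1 t = g1 (q t) * (2 * (v t \<bullet> z))" for t
    define h2 where "h2 t = g2 (q t) * (2 * (v t \<bullet> z)) * (2 * (v t \<bullet> z)) + g1 (q t) * (2 * (norm z)\<^sup>2)" for t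
    have hd: "(h has_real_derivative h1 t) (at t)" for t
      unfolding h_def h1_def by (rule DERIV_chain2[OF d1[OF q0] qd])
    have hd1: "(h1 has_real_derivative h2 t) (at t)" for t
    proof -
      have "((\<lambda>t. 2 * (v t \<bullet> z)) has_real_derivative 2 * (norm z)\<^sup>2) (at t)"
      proof -
        have e: "(\<lambda>t. 2 * (v t \<bullet> z)) = (\<lambda>t. 2 * ((x - x0) \<bullet> z) + t * (2 * (norm z)\<^sup>2))"
          unfolding v_def power2_norm_eq_inner by (simp add: fun_eq_iff inner_add_left inner_diff_left algebra_simps)
        show ?thesis unfolding e by (auto intro!: derivative_eq_intros)
      qed
      from DERIV_mult[OF DERIV_chain2[OF d2[OF q0] qd] this] show ?thesis
        unfolding h1_def h2_def by (simp add: mult_ac add.commute)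
    qed
    have vQ: "\<bar>v t \<bullet> z\<bar> \<le> Q (x + t *\<^sub>R z) powr (1 / 2) * norm z" for t
    proof -
      have "norm (v t) \<le> sqrt (Q (x + t *\<^sub>R z))" by (intro real_le_rsqrt) (simp add: Q_def v_def)
      then have "norm (v t) * norm z \<le> sqrt (Q (x + t *\<^sub>R z)) * norm z" by (intro mult_right_mono) auto
      then show ?thesis using Cauchy_Schwarz_ineq2[of "v t" z] Q[of "x + t *\<^sub>R z"] by (simp add: powr_half_sqrt)
    qed
    have B1: "\<bar>h1 t\<bar> \<le> 2 * M * (L powr (2 * k + 2) * (1 + norm x) powr (- (2 * k) - 1)) * norm z" if t: "\<bar>t\<bar> \<le> 1" for t
    proof -
      let ?Q = "Q (x + t *\<^sub>R z)"
      have "\<bar>h1 t\<bar> \<le> (M * ?Q powr (- k - 1)) * (2 * (?Q powr (1 / 2) * norm z))"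
        unfolding h1_def abs_mult using b1[OF q0[of t]] vQ[of t] M by (intro mult_mono) (auto simp: Qq)
      also have "\<dots> = 2 * M * (?Q powr (- k - 1) * ?Q powr (1 / 2)) * norm z" by simp
      also have "?Q powr (- k - 1) * ?Q powr (1 / 2) = ?Q powr - ((2 * k + 1) / 2)"
      proof -
        have "- k - 1 + 1 / 2 = - ((2 * k + 1) / 2)" by (simp add: field_simps)
        then show ?thesis by (simp only: powr_add[symmetric])
      qed
      also have "2 * M * ?Q powr - ((2 * k + 1) / 2) * norm z \<le> 2 * M * (L powr (2 * k + 2) * (1 + norm x) powr - (2 * k + 1)) * norm z"
        using pw[OF z t, of "2 * k + 1"] k M by (intro mult_right_mono mult_left_mono) auto
      finally show ?thesis by simp
    qed
    have B2: "\<bar>h2 t\<bar> \<le> 6 * M * (L powr (2 * k + 2) * (1 + norm x) powr (- (2 * k) - 2)) * (norm z)\<^sup>2" if t: "\<bar>t\<bar> \<le> 1" for t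
    proof -
      let ?Q = "Q (x + t *\<^sub>R z)"
      have "\<bar>g2 (q t) * (2 * (v t \<bullet> z)) * (2 * (v t \<bullet> z))\<bar> \<le> (M * ?Q powr (- k - 2)) * (2 * (?Q powr (1 / 2) * norm z)) * (2 * (?Q powr (1 / 2) * norm z))"
        unfolding abs_mult using b2[OF q0[of t]] vQ[of t] M by (intro mult_mono) (auto simp: Qq)
      also have "\<dots> = 4 * M * (?Q powr (- k - 2) * (?Q powr (1 / 2) * ?Q powr (1 / 2))) * (norm z)\<^sup>2" by (simp add: power2_eq_square)
      also have "?Q powr (- k - 2) * (?Q powr (1 / 2) * ?Q powr (1 / 2)) = ?Q powr (- k - 1)"
      proof -
        have "- k - 2 + (1 / 2 + 1 / 2) = - k - 1" by simp
        then show ?thesis by (simp only: powr_add[symmetric])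
      qed
      finally have 1: "\<bar>g2 (q t) * (2 * (v t \<bullet> z)) * (2 * (v t \<bullet> z))\<bar> \<le> 4 * M * ?Q powr (- k - 1) * (norm z)\<^sup>2" .
      have "\<bar>g1 (q t) * (2 * (norm z)\<^sup>2)\<bar> \<le> (M * ?Q powr (- k - 1)) * (2 * (norm z)\<^sup>2)"
        unfolding abs_mult using b1[OF q0[of t]] M by (intro mult_mono) (auto simp: Qq)
      then have "\<bar>h2 t\<bar> \<le> 6 * M * ?Q powr - ((2 * k + 2) / 2) * (norm z)\<^sup>2"
        using 1 abs_triangle_ineq[of "g2 (q t) * (2 * (v t \<bullet> z)) * (2 * (v t \<bullet> z))" "g1 (q t) * (2 * (norm z)\<^sup>2)"]
        by (simp add: h2_def add_divide_distrib)
      also have "\<dots> \<le> 6 * M * (L powr (2 * k + 2) * (1 + norm x) powr - (2 * k + 2)) * (norm z)\<^sup>2"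
        using pw[OF z t, of "2 * k + 2"] k M by (intro mult_right_mono mult_left_mono) auto
      finally show ?thesis by simp
    qed
    let ?P = "L powr (2 * k + 2)"
    have "\<bar>h 1 - h 0\<bar> \<le> 2 * M * (?P * (1 + norm x) powr (- (2 * k) - 1)) * norm z"
      by (rule derivative_bound_unit_interval[of h h1]) (use hd B1 in auto)
    also have "\<dots> \<le> 12 * (M * (?P * (1 + norm x) powr (- (2 * k) - 1)) * norm z)"
      using M mult_nonneg_nonneg[of "M * (?P * (1 + norm x) powr (- (2 * k) - 1))" "norm z"] by simp
    finally show "\<bar>?f (x + z) - ?f x\<bar> \<le> A * (1 + norm x) powr (- (2 * k) - 1) * norm z"
      by (simp add: h_def q_def v_def A_def mult.assoc)
    define D where "D = 6 * M * (?P * (1 + norm x) powr (- (2 * k) - 2)) * (norm z)\<^sup>2"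
    have B1': "\<bar>h1 t - h1 (- t)\<bar> \<le> 2 * D" if t: "0 \<le> t" "t \<le> 1" for t
    proof -
      have "\<bar>(h1 (1 * t) - h1 (- (1 * t))) - (h1 (0 * t) - h1 (- (0 * t)))\<bar> \<le> 2 * D"
      proof (rule derivative_bound_unit_interval[of "\<lambda>c. h1 (c * t) - h1 (- (c * t))" "\<lambda>c. t * (h2 (c * t) + h2 (- (c * t)))"])
        fix c :: real assume c: "0 \<le> c" "c \<le> 1"
        have "((\<lambda>c. h1 (c * t)) has_real_derivative h2 (c * t) * t) (at c)"
          by (rule DERIV_chain2[OF hd1]) (auto intro!: derivative_eq_intros)
        moreover have "((\<lambda>c. h1 (- (c * t))) has_real_derivative h2 (- (c * t)) * - t) (at c)"
          by (rule DERIV_chain2[OF hd1]) (auto intro!: derivative_eq_intros)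
        ultimately have "((\<lambda>c. h1 (c * t) - h1 (- (c * t))) has_real_derivative h2 (c * t) * t - h2 (- (c * t)) * - t) (at c)"
          by (rule DERIV_diff)
        then show "((\<lambda>c. h1 (c * t) - h1 (- (c * t))) has_real_derivative t * (h2 (c * t) + h2 (- (c * t)))) (at c)"
          by (simp add: algebra_simps)
        have ct: "\<bar>c * t\<bar> \<le> 1" using c t mult_le_one[of c t] by simp
        have "\<bar>h2 (c * t) + h2 (- (c * t))\<bar> \<le> 2 * D"
          using B2[OF ct] B2[of "- (c * t)"] ct unfolding D_def by simp
        then show "\<bar>t * (h2 (c * t) + h2 (- (c * t)))\<bar> \<le> 2 * D"
          using t mult_mono[of t 1 "\<bar>h2 (c * t) + h2 (- (c * t))\<bar>" "2 * D"] by (simp add: abs_mult)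
      qed
      then show ?thesis by simp
    qed
    have "\<bar>(h 1 + h (- 1)) - (h 0 + h (- 0))\<bar> \<le> 2 * D"
    proof (rule derivative_bound_unit_interval[of "\<lambda>t. h t + h (- t)" "\<lambda>t. h1 t - h1 (- t)"])
      fix t :: real assume t: "0 \<le> t" "t \<le> 1"
      have "((\<lambda>t. h (- t)) has_real_derivative h1 (- t) * - 1) (at t)"
        by (rule DERIV_chain2[OF hd]) (auto intro!: derivative_eq_intros)
      from DERIV_add[OF hd this] show "((\<lambda>t. h t + h (- t)) has_real_derivative h1 t - h1 (- t)) (at t)" by simp
    qed (rule B1')
    moreover have "diff2 ?f x z = - ((h 1 + h (- 1)) - (h 0 + h (- 0)))"
      by (simp add: diff2_def h_def q_def v_def)
    ultimately have "\<bar>diff2 ?f x z\<bar> \<le> 2 * D" by simp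
    then show "\<bar>diff2 ?f x z\<bar> \<le> A * (1 + norm x) powr (- (2 * k) - 2) * (norm z)\<^sup>2"
      by (simp add: D_def A_def mult.assoc)
  qed
  then show ?thesis by blast
qed

lemma powr_diff_bounds:
  fixes A B j :: real
  assumes "0 < A" "A \<le> B" "0 \<le> j"
  shows "0 \<le> A powr - j - B powr - j" "A powr - j - B powr - j \<le> j * (B - A) * A powr (- j - 1)"
proof -
  show "0 \<le> A powr - j - B powr - j" using assms powr_mono2'[of "- j" A B] by simp
  show "A powr - j - B powr - j \<le> j * (B - A) * A powr (- j - 1)"
  proof (cases "A = B")
    case False
    then have "\<exists>t>A. t < B \<and> B powr - j - A powr - j = (B - A) * (- j * t powr (- j - 1))"
      using assms by (intro MVT2) (auto intro!: derivative_eq_intros simp: powr_diff)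
    then obtain t where t: "A < t" "t < B" "B powr - j - A powr - j = (B - A) * (- j * t powr (- j - 1))" by blast
    have "t powr (- j - 1) \<le> A powr (- j - 1)" using t assms by (intro powr_mono2') auto
    then have "j * (B - A) * t powr (- j - 1) \<le> j * (B - A) * A powr (- j - 1)" using assms by (intro mult_left_mono) auto
    then show ?thesis using t(3) by (simp add: algebra_simps)
  qed (use assms in simp)
qed

text \<open>The leading terms at infinity cancel. Differentiating \<open>H\<close>, the difference of two powers, only
  raises the exponent, up to a factor, and by the mean value theorem each such difference is one power smaller than
  its terms.\<close>

lemma bubble_diff_symbol_bound:
  fixes x0 :: "'a::euclidean_space"
  assumes \<epsilon>: "0 < \<epsilon>" "\<epsilon> \<le> R" and b: "b > 0"
  shows "\<exists>A. symbol_bound (2 * (b + 1)) A (\<lambda>y. (\<epsilon>\<^sup>2 + (norm (y - x0))\<^sup>2) powr - b - (R\<^sup>2 + (norm (y - x0))\<^sup>2) powr - b)"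
proof -
  define H where "H j q = (\<epsilon>\<^sup>2 + q) powr - j - (R\<^sup>2 + q) powr - j" for j q
  have le: "\<epsilon>\<^sup>2 \<le> R\<^sup>2" using \<epsilon> by (intro power_mono) auto
  have pos: "\<epsilon>\<^sup>2 + q > 0" "R\<^sup>2 + q > 0" if "q \<ge> 0" for q using that \<epsilon> by (auto intro!: add_pos_nonneg)
  have Hd: "(H j has_real_derivative - j * H (j + 1) q) (at q)" if "q \<ge> 0" for j q
  proof -
    have d: "((\<lambda>q. (c + q) powr - j) has_real_derivative - j * (c + q) powr (- (j + 1))) (at q)" if "c + q > 0" for c
    proof -
      have "((\<lambda>q. c + q) has_real_derivative 1) (at q)" by (auto intro!: derivative_eq_intros)
      from DERIV_chain2[OF has_real_derivative_powr[OF that, of "- j"] this] show ?thesis by simp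
    qed
    from DERIV_diff[OF d[OF pos(1)[OF that]] d[OF pos(2)[OF that]]] show ?thesis
      unfolding H_def[abs_def] by (simp add: algebra_simps)
  qed
  have Hb: "\<bar>H j q\<bar> \<le> j * (R\<^sup>2 - \<epsilon>\<^sup>2) * (\<epsilon>\<^sup>2 + q) powr (- j - 1)" if "q \<ge> 0" "j \<ge> 0" for j q
    using powr_diff_bounds[of "\<epsilon>\<^sup>2 + q" "R\<^sup>2 + q" j] pos[OF that(1)] le that by (simp add: H_def)
  define D where "D = R\<^sup>2 - \<epsilon>\<^sup>2"
  have D: "D \<ge> 0" using le by (simp add: D_def)
  define M where "M = b * D + b * (b + 1) * D + b * (b + 1) * (b + 2) * D"
  have M: "b * D \<le> M" "b * (b + 1) * D \<le> M" "b * (b + 1) * (b + 2) * D \<le> M" "M \<ge> 0"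
    using b D by (auto simp: M_def)
  have "\<exists>A. symbol_bound (2 * (b + 1)) A (\<lambda>y. H b ((norm (y - x0))\<^sup>2))"
  proof (rule radial_symbol_bound[OF \<epsilon>(1) _ M(4), where ?g1.0 = "\<lambda>q. - b * H (b + 1) q" and ?g2.0 = "\<lambda>q. - b * (- (b + 1) * H (b + 1 + 1) q)"])
    fix q :: real assume q: "q \<ge> 0"
    show "(H b has_real_derivative - b * H (b + 1) q) (at q)" by (rule Hd[OF q])
    show "((\<lambda>q. - b * H (b + 1) q) has_real_derivative - b * (- (b + 1) * H (b + 1 + 1) q)) (at q)"
      by (rule DERIV_cmult[OF Hd[OF q]])
    have "\<bar>H b q\<bar> \<le> b * D * (\<epsilon>\<^sup>2 + q) powr (- b - 1)" using Hb[OF q, of b] b by (simp add: D_def)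
    also have "\<dots> \<le> M * (\<epsilon>\<^sup>2 + q) powr (- b - 1)" by (intro mult_right_mono M) auto
    finally show "\<bar>H b q\<bar> \<le> M * (\<epsilon>\<^sup>2 + q) powr - (b + 1)" by simp
    have "\<bar>- b * H (b + 1) q\<bar> = b * \<bar>H (b + 1) q\<bar>" using b by (simp add: abs_mult)
    also have "\<dots> \<le> b * ((b + 1) * D * (\<epsilon>\<^sup>2 + q) powr (- (b + 1) - 1))"
      unfolding D_def using b by (intro mult_left_mono Hb q) auto
    also have "\<dots> = b * (b + 1) * D * (\<epsilon>\<^sup>2 + q) powr (- (b + 1) - 1)" by simp
    also have "\<dots> \<le> M * (\<epsilon>\<^sup>2 + q) powr (- (b + 1) - 1)" by (intro mult_right_mono M) auto
    finally show "\<bar>- b * H (b + 1) q\<bar> \<le> M * (\<epsilon>\<^sup>2 + q) powr (- (b + 1) - 1)" .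
    have "\<bar>- b * (- (b + 1) * H (b + 1 + 1) q)\<bar> = b * (b + 1) * \<bar>H (b + 1 + 1) q\<bar>" using b by (simp add: abs_mult)
    also have "\<dots> \<le> b * (b + 1) * ((b + 1 + 1) * D * (\<epsilon>\<^sup>2 + q) powr (- (b + 1 + 1) - 1))"
      unfolding D_def using b by (intro mult_left_mono Hb q) auto
    also have "\<dots> = b * (b + 1) * (b + 2) * D * (\<epsilon>\<^sup>2 + q) powr (- (b + 1) - 2)" by (simp add: add.commute)
    also have "\<dots> \<le> M * (\<epsilon>\<^sup>2 + q) powr (- (b + 1) - 2)" by (intro mult_right_mono M) auto
    finally show "\<bar>- b * (- (b + 1) * H (b + 1 + 1) q)\<bar> \<le> M * (\<epsilon>\<^sup>2 + q) powr (- (b + 1) - 2)" .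
  qed (use b in auto)
  then show ?thesis by (simp add: H_def)
qed

section \<open>Bubbles and their densities\<close>

lemma sqrt_powr_double: "q > 0 \<Longrightarrow> sqrt q powr - (2 * a) = q powr - a"
proof -
  assume "q > 0"
  then have "sqrt q powr - (2 * a) = q powr (1 / 2 * - (2 * a))"
    by (simp only: powr_half_sqrt[symmetric] powr_powr less_imp_le)
  also have "1 / 2 * - (2 * a) = - a" by simp
  finally show ?thesis .
qed

text \<open>The fundamental solution regularized at the scale \<open>\<epsilon>\<close>.\<close>

definition bubble :: "real \<Rightarrow> real \<Rightarrow> 'a::euclidean_space \<Rightarrow> real" where
  "bubble s \<epsilon> x = riesz_const DIM('a) s * (\<epsilon>\<^sup>2 + (norm x)\<^sup>2) powr - (real DIM('a) / 2 - s)"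

text \<open>The fractional Laplacian of the bubble: a probability density concentrated at the scale
  \<open>\<epsilon>\<close>.\<close>

definition bubble_density :: "real \<Rightarrow> real \<Rightarrow> 'a::euclidean_space \<Rightarrow> real" where
  "bubble_density s \<epsilon> x = Gamma (real DIM('a) / 2 + s) / (pi powr (real DIM('a) / 2) * Gamma s) * \<epsilon> powr (2 * s)
     * (\<epsilon>\<^sup>2 + (norm x)\<^sup>2) powr - (real DIM('a) / 2 + s)"

lemma riesz_const_pos:
  assumes "0 < s" "2 * s < real N"
  shows "riesz_const N s > 0"
  unfolding riesz_const_def using assms by (intro divide_pos_pos mult_pos_pos Gamma_real_pos) auto

lemma bubble_density_const_pos:
  assumes "0 < s"
  shows "Gamma (real N / 2 + s) / (pi powr (real N / 2) * Gamma s) > 0"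
  using assms by (intro divide_pos_pos mult_pos_pos Gamma_real_pos) (auto intro: add_nonneg_pos)

lemma bubble_density_nonneg:
  assumes "0 < s" shows "bubble_density s \<epsilon> (x :: 'a::euclidean_space) \<ge> 0"
  unfolding bubble_density_def using bubble_density_const_pos[OF assms, of "DIM('a)"]
  by (intro mult_nonneg_nonneg) auto

lemma bubble_nonneg:
  assumes "0 < s" "2 * s < real DIM('a)" shows "bubble s \<epsilon> (x :: 'a::euclidean_space) \<ge> 0"
  unfolding bubble_def using riesz_const_pos[OF assms] by (intro mult_nonneg_nonneg) auto

lemma bubble_measurable [measurable]: "bubble s \<epsilon> \<in> borel_measurable borel"
  unfolding bubble_def[abs_def] by measurable

lemma bubble_density_measurable [measurable]: "bubble_density s \<epsilon> \<in> borel_measurable borel"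
  unfolding bubble_density_def[abs_def] by measurable

lemma bubble_density_integral:
  assumes s: "0 < s" and \<epsilon>: "\<epsilon> > 0"
  shows "has_bochner_integral lborel (bubble_density s \<epsilon> :: 'a::euclidean_space \<Rightarrow> real) 1"
proof -
  let ?N = "real DIM('a)"
  have G: "Gamma (?N / 2 + s) > 0" "Gamma s > 0" using s by (auto intro!: Gamma_real_pos add_nonneg_pos)
  define c where "c = Gamma (?N / 2 + s) / (pi powr (?N / 2) * Gamma s) * \<epsilon> powr (2 * s)"
  have "has_bochner_integral lborel (\<lambda>x::'a. c * (\<epsilon>\<^sup>2 + (norm x)\<^sup>2) powr - (?N / 2 + s))
      (c * (pi powr (?N / 2) * Gamma s * \<epsilon> powr - (2 * s) / Gamma (?N / 2 + s)))"
    by (intro has_bochner_integral_mult_right bubble_integral s \<epsilon>)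
  moreover have "c * (pi powr (?N / 2) * Gamma s * \<epsilon> powr - (2 * s) / Gamma (?N / 2 + s)) = 1"
  proof -
    have "g / (p * h) * e * (p * h * e' / g) = 1" if "g > 0" "h > 0" "p > 0" "e * e' = 1" for g h p e e' :: real
      using that by (simp add: field_simps)
    from this[OF G, of "pi powr (?N / 2)" "\<epsilon> powr (2 * s)" "\<epsilon> powr - (2 * s)"] show ?thesis
      using \<epsilon> unfolding c_def by (simp flip: powr_add)
  qed
  ultimately show ?thesis unfolding bubble_density_def[abs_def] c_def by simp
qed

lemma flap_reflect: "flap s (\<lambda>y. f (x0 - y)) y = flap s f (x0 - y)"
proof -
  have "diff2 (\<lambda>y. f (x0 - y)) y z = diff2 f (x0 - y) z" for z
    by (simp add: diff2_def algebra_simps)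
  then show ?thesis by (simp add: flap_def)
qed

lemma flap_bubble_eq_density:
  fixes x :: "'a::euclidean_space"
  assumes s: "0 < s" "s < 1" "2 * s < real DIM('a)" and \<epsilon>: "\<epsilon> > 0"
  shows "integrable lborel (\<lambda>z. diff2 (bubble s \<epsilon>) x z * levy s z)"
    and "flap s (bubble s \<epsilon>) x = bubble_density s \<epsilon> x"
proof -
  let ?N = "real DIM('a)"
  let ?f = "\<lambda>x::'a. (\<epsilon>\<^sup>2 + (norm x)\<^sup>2) powr - (?N / 2 - s)"
  have d: "diff2 (bubble s \<epsilon>) x z = riesz_const DIM('a) s * diff2 ?f x z" for z
    by (simp add: bubble_def diff2_def algebra_simps)
  have "integrable lborel (\<lambda>z. riesz_const DIM('a) s * (diff2 ?f x z * levy s z))"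
    by (intro integrable_mult_right flap_bubble(1) s \<epsilon>)
  then show "integrable lborel (\<lambda>z. diff2 (bubble s \<epsilon>) x z * levy s z)"
    unfolding d by (simp add: mult.assoc)
  have "flap s (bubble s \<epsilon>) x = riesz_const DIM('a) s * flap s ?f x"
    using flap_cmult[of s "riesz_const DIM('a) s" ?f x] by (simp add: bubble_def[abs_def])
  also have "\<dots> = bubble_density s \<epsilon> x"
  proof -
    have G: "Gamma (?N / 2 - s) > 0" using s by (intro Gamma_real_pos) auto
    have e: "(?N - 2 * s) / 2 = ?N / 2 - s" by (simp add: diff_divide_distrib)
    have "(4::real) powr s = 2 powr (2 * s)" using powr_powr[of 2 2 s] by simp
    then have "riesz_const DIM('a) s * (4 powr s * \<epsilon> powr (2 * s) * Gamma (?N / 2 + s) / Gamma (?N / 2 - s))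
        = Gamma (?N / 2 + s) / (pi powr (?N / 2) * Gamma s) * \<epsilon> powr (2 * s)"
      unfolding riesz_const_def e using G by (simp add: field_simps)
    then show ?thesis unfolding flap_bubble(2)[OF s \<epsilon>] bubble_density_def
      by (simp only: mult.assoc[symmetric])
  qed
  finally show "flap s (bubble s \<epsilon>) x = bubble_density s \<epsilon> x" .
qed

lemma bubble_density_le_bracket:
  fixes x0 :: "'a::euclidean_space"
  assumes s: "0 < s" and \<epsilon>: "\<epsilon> > 0"
  shows "\<exists>C. \<forall>y. bubble_density s \<epsilon> (x0 - y) \<le> C * (1 + norm y) powr - (real DIM('a) + 2 * s)"
proof -
  let ?a = "real DIM('a) / 2 + s"
  define L where "L = (1 + norm x0) / \<epsilon> + 1"
  have L: "L > 0" using \<epsilon> by (simp add: L_def add_nonneg_pos)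
  define c where "c = Gamma (real DIM('a) / 2 + s) / (pi powr (real DIM('a) / 2) * Gamma s) * \<epsilon> powr (2 * s)"
  have c: "c \<ge> 0" unfolding c_def
    by (rule mult_nonneg_nonneg[OF less_imp_le[OF bubble_density_const_pos[OF s]] powr_ge_zero])
  have "bubble_density s \<epsilon> (x0 - y) \<le> c * L powr (2 * ?a) * (1 + norm y) powr - (2 * ?a)" for y
  proof -
    let ?q = "\<epsilon>\<^sup>2 + (norm (x0 - y))\<^sup>2"
    have q: "?q > 0" using \<epsilon> by (simp add: add_pos_nonneg)
    have "\<epsilon> \<le> sqrt ?q" "norm (x0 - y) \<le> sqrt ?q" by (auto intro!: real_le_rsqrt)
    moreover have "norm y \<le> norm (x0 - y) + norm x0" using norm_triangle_ineq[of "y - x0" x0] by (simp add: norm_minus_commute)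
    moreover have "1 + norm x0 = (1 + norm x0) / \<epsilon> * \<epsilon>" using \<epsilon> by simp
    moreover have "(1 + norm x0) / \<epsilon> * \<epsilon> \<le> (1 + norm x0) / \<epsilon> * sqrt ?q"
      using \<epsilon> calculation(1) by (intro mult_left_mono) auto
    ultimately have "1 + norm y \<le> L * sqrt ?q" unfolding L_def distrib_right by argo
    then have "(1 + norm y) / L \<le> sqrt ?q" using L by (simp add: divide_le_eq mult.commute)
    then have "sqrt ?q powr - (2 * ?a) \<le> ((1 + norm y) / L) powr - (2 * ?a)"
      using L s by (intro powr_mono2') (auto intro!: divide_pos_pos)
    moreover have "sqrt ?q powr - (2 * ?a) = ?q powr - ?a"
      by (rule sqrt_powr_double[OF q])
    moreover have "((1 + norm y) / L) powr - (2 * ?a) = L powr (2 * ?a) * (1 + norm y) powr - (2 * ?a)"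
      using L by (simp only: powr_divide powr_minus) (simp add: field_simps)
    ultimately have "?q powr - ?a \<le> L powr (2 * ?a) * (1 + norm y) powr - (2 * ?a)" by simp
    from mult_left_mono[OF this c] show ?thesis
      unfolding bubble_density_def c_def[symmetric] by (simp only: mult.assoc)
  qed
  moreover have "2 * ?a = real DIM('a) + 2 * s" by simp
  ultimately show ?thesis by metis
qed

lemma bubble_density_tempered_integrable:
  fixes u :: "'a::euclidean_space \<Rightarrow> real"
  assumes s: "0 < s" and \<epsilon>: "\<epsilon> > 0" and u: "tempered s u"
  shows "integrable lborel (\<lambda>y. u y * bubble_density s \<epsilon> (x0 - y))"
proof -
  note [measurable] = tempered_measurable[OF u]
  obtain C where C: "\<forall>y. bubble_density s \<epsilon> (x0 - y) \<le> C * (1 + norm y) powr - (real DIM('a) + 2 * s)"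
    using bubble_density_le_bracket[OF s \<epsilon>] ..
  show ?thesis
  proof (rule integrable_dominated)
    show "integrable lborel (\<lambda>y. C * \<bar>(1 + norm y) powr - (real DIM('a) + 2 * s) * u y\<bar>)"
      using tempered_integrable[OF u] by simp
    fix y
    show "\<bar>u y * bubble_density s \<epsilon> (x0 - y)\<bar> \<le> C * \<bar>(1 + norm y) powr - (real DIM('a) + 2 * s) * u y\<bar>"
      using mult_left_mono[OF C[rule_format, of y], of "\<bar>u y\<bar>"] bubble_density_nonneg[OF s, of \<epsilon> "x0 - y"]
      by (simp add: abs_mult mult_ac)
  qed measurable
qed

text \<open>The densities \<open>bubble_density s \<epsilon>\<close> form an approximate identity.\<close>

lemma bubble_density_tendsto:
  fixes u :: "'a::euclidean_space \<Rightarrow> real"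
  assumes s: "0 < s" and u: "tempered s u" and cont: "isCont u x0"
    and \<epsilon>: "\<And>n. \<epsilon> n > 0" "\<epsilon> \<longlonglongrightarrow> 0"
  shows "(\<lambda>n. LINT y|lborel. u y * bubble_density s (\<epsilon> n) (x0 - y)) \<longlonglongrightarrow> u x0"
proof (rule LIMSEQ_I)
  fix \<eta> :: real assume \<eta>: "\<eta> > 0"
  note [measurable] = tempered_measurable[OF u]
  let ?N = "real DIM('a)"
  obtain d where d: "d > 0" "\<And>y. norm (y - x0) < d \<Longrightarrow> \<bar>u y - u x0\<bar> \<le> \<eta> / 2"
  proof -
    have "\<exists>d>0. \<forall>y. dist y x0 < d \<longrightarrow> dist (u y) (u x0) < \<eta> / 2"
      using cont \<eta> unfolding continuous_at_eps_delta by (metis half_gt_zero)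
    then show ?thesis using that by (force simp: dist_norm)
  qed
  define c where "c = Gamma (?N / 2 + s) / (pi powr (?N / 2) * Gamma s)"
  have c: "c > 0" unfolding c_def by (rule bubble_density_const_pos[OF s])
  let ?t = "\<lambda>y. levy_tail d s (y - x0) * (\<bar>u y\<bar> + \<bar>u x0\<bar>)"
  have ti: "integrable lborel ?t"
  proof -
    have "integrable lborel (\<lambda>z. levy_tail d s z * \<bar>u (x0 + z)\<bar> + levy_tail d s z * \<bar>u x0\<bar>)"
      using levy_tail_tempered(2)[OF s d(1) u, of x0] levy_far[OF s d(1), where 'a = 'a]
      by (intro Bochner_Integration.integrable_add integrable_mult_left) (auto simp: has_bochner_integral_iff)
    then have "has_bochner_integral lborel (\<lambda>z. ?t (x0 + z)) (LINT z|lborel. ?t (x0 + z))"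
      by (simp add: has_bochner_integral_iff distrib_left)
    then have "has_bochner_integral lborel ?t (LINT z|lborel. ?t (x0 + z))"
      by (rule has_bochner_integral_translate[of ?t x0, THEN iffD1])
    then show ?thesis by (simp add: has_bochner_integral_iff)
  qed
  define E where "E = (LINT y|lborel. ?t y)"
  have "(\<lambda>n. c * \<epsilon> n powr (2 * s) * E) \<longlonglongrightarrow> c * 0 * E"
    using tendsto_zero_powrI[OF \<epsilon>(2) tendsto_const, of "2 * s"] s less_imp_le[OF \<epsilon>(1)]
    by (intro tendsto_intros) auto
  then have "eventually (\<lambda>n. c * \<epsilon> n powr (2 * s) * E < \<eta> / 2) sequentially"
    using \<eta> by (intro order_tendstoD(2)[of _ 0]) auto
  then obtain n0 where n0: "\<And>n. n \<ge> n0 \<Longrightarrow> c * \<epsilon> n powr (2 * s) * E < \<eta> / 2"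
    unfolding eventually_sequentially by blast
  show "\<exists>no. \<forall>n\<ge>no. norm ((LINT y|lborel. u y * bubble_density s (\<epsilon> n) (x0 - y)) - u x0) < \<eta>"
  proof (intro exI[of _ n0] allI impI)
    fix n assume n: "n \<ge> n0"
    let ?K = "\<lambda>y. bubble_density s (\<epsilon> n) (x0 - y)"
    have K: "has_bochner_integral lborel ?K 1"
      using bubble_density_integral[OF s \<epsilon>(1)] has_bochner_integral_reflect[of "bubble_density s (\<epsilon> n)" x0] by simp
    have uK: "integrable lborel (\<lambda>y. u y * ?K y)" by (rule bubble_density_tempered_integrable[OF s \<epsilon>(1) u])
    have "(LINT y|lborel. u y * ?K y) - u x0 = (LINT y|lborel. (u y - u x0) * ?K y)"
      using K uK by (simp add: has_bochner_integral_iff left_diff_distrib)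
    also have "\<bar>\<dots>\<bar> \<le> (LINT y|lborel. \<eta> / 2 * ?K y + c * \<epsilon> n powr (2 * s) * ?t y)"
    proof (rule integral_abs_bound_integral)
      show "integrable lborel (\<lambda>y. (u y - u x0) * ?K y)" using K uK by (simp add: has_bochner_integral_iff left_diff_distrib)
      show "integrable lborel (\<lambda>y. \<eta> / 2 * ?K y + c * \<epsilon> n powr (2 * s) * ?t y)"
        using K ti by (intro Bochner_Integration.integrable_add integrable_mult_right) (auto simp: has_bochner_integral_iff)
      fix y
      have K0: "?K y \<ge> 0" by (rule bubble_density_nonneg[OF s])
      have t0: "0 \<le> c * \<epsilon> n powr (2 * s) * ?t y" using c by (simp add: levy_tail_nonneg)
      show "\<bar>(u y - u x0) * ?K y\<bar> \<le> \<eta> / 2 * ?K y + c * \<epsilon> n powr (2 * s) * ?t y"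
      proof (cases "norm (y - x0) < d")
        case True
        then show ?thesis using mult_right_mono[OF d(2)[OF True] K0] K0 t0 by (simp add: abs_mult)
      next
        case False
        have ny: "norm (y - x0) > 0" using False d(1) by linarith
        have "?K y \<le> c * \<epsilon> n powr (2 * s) * levy_tail d s (y - x0)"
        proof -
          have "((\<epsilon> n)\<^sup>2 + (norm (x0 - y))\<^sup>2) powr - (?N / 2 + s) \<le> ((norm (x0 - y))\<^sup>2) powr - (?N / 2 + s)"
            using ny s by (intro powr_mono2') (auto simp: norm_minus_commute)
          also have "\<dots> = levy s (y - x0)"
          proof -
            have "((norm (x0 - y))\<^sup>2) powr - (?N / 2 + s) = (norm (x0 - y) powr 2) powr - (?N / 2 + s)" by simp
            also have "\<dots> = norm (x0 - y) powr (2 * - (?N / 2 + s))" by (rule powr_powr)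
            also have "2 * - (?N / 2 + s) = - (?N + 2 * s)" by simp
            finally show ?thesis by (simp only: levy_def norm_minus_commute)
          qed
          also have "\<dots> = levy_tail d s (y - x0)" using False by (simp add: levy_tail_def)
          finally show ?thesis unfolding bubble_density_def c_def[symmetric] using c by (intro mult_left_mono) auto
        qed
        then have "\<bar>u y - u x0\<bar> * ?K y \<le> (\<bar>u y\<bar> + \<bar>u x0\<bar>) * (c * \<epsilon> n powr (2 * s) * levy_tail d s (y - x0))"
          using K0 by (intro mult_mono) auto
        moreover have "0 \<le> \<eta> / 2 * ?K y" using K0 \<eta> by simp
        ultimately show ?thesis using K0 by (simp add: abs_mult mult_ac)
      qed
    qed
    also have "\<dots> = \<eta> / 2 + c * \<epsilon> n powr (2 * s) * E"
      using K ti by (simp add: has_bochner_integral_iff E_def)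
    finally show "norm ((LINT y|lborel. u y * ?K y) - u x0) < \<eta>" using n0[OF n] by simp
  qed
qed

text \<open>The Liouville property: averages at a large scale \<open>R\<close> hardly depend on the centre.\<close>

lemma bubble_density_shift_le:
  fixes x0 x1 y :: "'a::euclidean_space"
  assumes s: "0 < s" and R: "R > 0"
  shows "bubble_density s R (x0 - y) \<le> (1 + norm (x0 - x1) / R) powr (real DIM('a) + 2 * s) * bubble_density s R (x1 - y)"
proof -
  let ?a = "real DIM('a) / 2 + s"
  define \<theta> where "\<theta> = 1 + norm (x0 - x1) / R"
  have \<theta>: "\<theta> \<ge> 1" using R by (simp add: \<theta>_def)
  define q0 q1 where "q0 = R\<^sup>2 + (norm (x0 - y))\<^sup>2" and "q1 = R\<^sup>2 + (norm (x1 - y))\<^sup>2"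
  have q: "q0 > 0" "q1 > 0" using R by (auto simp: q0_def q1_def intro!: add_pos_nonneg)
  \<comment> \<open>The triangle inequality in \<open>\<real> \<times> \<real>\<^sup>N\<close> compares the two square roots.\<close>
  have nR: "sqrt q0 = norm (R, x0 - y)" "sqrt q1 = norm (R, x1 - y)"
    by (simp_all add: q0_def q1_def norm_Pair)
  have "norm (R, x1 - y) \<le> norm (R, x0 - y) + norm (0::real, x1 - x0)"
    using norm_triangle_ineq[of "(R, x0 - y)" "(0, x1 - x0)"] by simp
  then have "sqrt q1 \<le> sqrt q0 + norm (x0 - x1)" unfolding nR by (simp add: norm_Pair norm_minus_commute)
  moreover have "norm (x0 - x1) \<le> norm (x0 - x1) / R * sqrt q0"
  proof -
    have "R \<le> sqrt q0" by (intro real_le_rsqrt) (simp add: q0_def)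
    then have "norm (x0 - x1) / R * R \<le> norm (x0 - x1) / R * sqrt q0" using R by (intro mult_left_mono) auto
    then show ?thesis using R by simp
  qed
  ultimately have le: "sqrt q1 \<le> \<theta> * sqrt q0" unfolding \<theta>_def distrib_right by simp
  have "(\<theta> * sqrt q0) powr - (2 * ?a) \<le> sqrt q1 powr - (2 * ?a)"
    using le q s by (intro powr_mono2') auto
  then have "\<theta> powr (2 * ?a) * (\<theta> * sqrt q0) powr - (2 * ?a) \<le> \<theta> powr (2 * ?a) * sqrt q1 powr - (2 * ?a)"
    by (intro mult_left_mono) auto
  moreover have "\<theta> powr (2 * ?a) * (\<theta> * sqrt q0) powr - (2 * ?a) = sqrt q0 powr - (2 * ?a)"
  proof -
    have "\<theta> powr (2 * ?a) * \<theta> powr - (2 * ?a) = 1" using \<theta> by (simp flip: powr_add)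
    then show ?thesis unfolding powr_mult by (simp only: mult.assoc[symmetric] mult_1)
  qed
  moreover have "sqrt q0 powr - (2 * ?a) = q0 powr - ?a" "sqrt q1 powr - (2 * ?a) = q1 powr - ?a"
    using q by (simp_all only: sqrt_powr_double)
  ultimately have qq: "q0 powr - ?a \<le> \<theta> powr (2 * ?a) * q1 powr - ?a" by simp
  define c where "c = Gamma ?a / (pi powr (real DIM('a) / 2) * Gamma s) * R powr (2 * s)"
  have c: "c \<ge> 0" unfolding c_def
    by (rule mult_nonneg_nonneg[OF less_imp_le[OF bubble_density_const_pos[OF s]] powr_ge_zero])
  have "c * q0 powr - ?a \<le> \<theta> powr (2 * ?a) * (c * q1 powr - ?a)"
    using mult_left_mono[OF qq c] by (simp add: mult_ac)
  moreover have "2 * ?a = real DIM('a) + 2 * s" by simp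
  ultimately show ?thesis unfolding bubble_density_def c_def q0_def q1_def \<theta>_def by (simp only:)
qed

section \<open>The representation formula\<close>

locale positive_punctured_equation = punctured_equation +
  assumes u_pos: "\<And>x. x \<noteq> 0 \<Longrightarrow> u x > 0"
    and F_nonneg: "\<And>x. x \<noteq> 0 \<Longrightarrow> F x \<ge> 0"
begin

definition average :: "real \<Rightarrow> 'a \<Rightarrow> real" where
  "average R x = (LINT y|lborel. u y * bubble_density s R (x - y))"

lemma N2s': "2 * s < real DIM('a)" using N2s by simp

lemma average_integrable: "R > 0 \<Longrightarrow> integrable lborel (\<lambda>y. u y * bubble_density s R (x - y))"
  by (rule bubble_density_tempered_integrable[OF s(1) _ u])

lemma average_nonneg: "average R x \<ge> 0"
  unfolding average_def
proof (rule integral_nonneg_AE)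
  show "AE y in lborel. 0 \<le> u y * bubble_density s R (x - y)"
    using AE_lborel_singleton[of "0::'a"]
    by eventually_elim (simp add: mult_nonneg_nonneg less_imp_le[OF u_pos] bubble_density_nonneg[OF s(1)])
qed

lemma AE_lebesgue_ne: "AE y in lebesgue. y \<noteq> (a::'a)"
  using AE_lborel_singleton[of a] by (rule AE_completion)

lemma bubble_le:
  assumes "0 < \<epsilon>" "\<epsilon> \<le> R"
  shows "bubble s R x \<le> bubble s \<epsilon> (x :: 'a)"
proof -
  have "\<epsilon>\<^sup>2 \<le> R\<^sup>2" using assms by (intro power_mono) auto
  then have "(R\<^sup>2 + (norm x)\<^sup>2) powr - (real DIM('a) / 2 - s) \<le> (\<epsilon>\<^sup>2 + (norm x)\<^sup>2) powr - (real DIM('a) / 2 - s)"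
    using assms N2s by (intro powr_mono2') (auto intro!: add_pos_nonneg)
  then show ?thesis unfolding bubble_def using riesz_const_pos[OF s(1) N2s'] by (intro mult_left_mono) auto
qed

lemma bubble_diff_symbol:
  assumes "0 < \<epsilon>" "\<epsilon> \<le> R"
  shows "\<exists>A. symbol_bound dec A (\<lambda>y. bubble s \<epsilon> (x - y) - bubble s R (x - y :: 'a))"
proof -
  let ?b = "real DIM('a) / 2 - s"
  obtain A where A: "symbol_bound (2 * (?b + 1)) A (\<lambda>y. (\<epsilon>\<^sup>2 + (norm (y - x))\<^sup>2) powr - ?b - (R\<^sup>2 + (norm (y - x))\<^sup>2) powr - ?b)"
    using bubble_diff_symbol_bound[OF assms, of ?b x] N2s by auto
  have d: "2 * (?b + 1) = dec" by (simp add: dec_def)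
  have "(\<lambda>y. riesz_const DIM('a) s * ((\<epsilon>\<^sup>2 + (norm (y - x))\<^sup>2) powr - ?b - (R\<^sup>2 + (norm (y - x))\<^sup>2) powr - ?b))
     = (\<lambda>y. bubble s \<epsilon> (x - y) - bubble s R (x - y))"
    by (simp add: bubble_def fun_eq_iff right_diff_distrib norm_minus_commute)
  with symbol_bound_cmult[OF A, of "riesz_const DIM('a) s"] show ?thesis unfolding d by auto
qed

text \<open>The coefficient of the Dirac mass in the equation; it is unique because the class contains functions
  that do not vanish at the origin.\<close>

definition point_mass :: real where
  "point_mass = (SOME m. \<forall>A f. f \<in> borel_measurable borel \<longrightarrow> symbol_bound dec A f \<longrightarrow> defect f = m * f 0)"

lemma defect_point_mass:
  assumes "f \<in> borel_measurable borel" "symbol_bound dec A f"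
  shows "defect f = point_mass * f 0"
  using someI_ex[OF defect_eq_point_mass] assms unfolding point_mass_def by blast

text \<open>The super-mean value formula with its remainder: the averages at two scales differ by a
  truncated potential of the right-hand side and of the point mass.\<close>

lemma average_identity:
  assumes R: "0 < \<epsilon>" "\<epsilon> \<le> R"
  shows "integrable lebesgue (\<lambda>y. F y * (bubble s \<epsilon> (x - y) - bubble s R (x - y)))"
    and "average \<epsilon> x - average R x = (LINT y|lebesgue. F y * (bubble s \<epsilon> (x - y) - bubble s R (x - y)))
       + point_mass * (bubble s \<epsilon> x - bubble s R x)"
proof -
  let ?f = "\<lambda>y. bubble s \<epsilon> (x - y) - bubble s R (x - y)"
  have R0: "R > 0" using R by simp
  obtain A where A: "symbol_bound dec A ?f" using bubble_diff_symbol[OF R] by blast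
  have m: "?f \<in> borel_measurable borel" by measurable
  show "integrable lebesgue (\<lambda>y. F y * ?f y)" by (rule symbol_F_integrable[OF m A])
  have "flap s ?f y = bubble_density s \<epsilon> (x - y) - bubble_density s R (x - y)" for y
  proof -
    have "flap s ?f y = flap s (\<lambda>y. bubble s \<epsilon> y - bubble s R y) (x - y)"
      using flap_reflect[of s "\<lambda>y. bubble s \<epsilon> y - bubble s R y" x y] by simp
    also have "\<dots> = flap s (bubble s \<epsilon>) (x - y) - flap s (bubble s R) (x - y)"
      by (rule flap_diff[OF flap_bubble_eq_density(1)[OF s N2s' R(1)] flap_bubble_eq_density(1)[OF s N2s' R0]])
    finally show ?thesis unfolding flap_bubble_eq_density(2)[OF s N2s' R(1)] flap_bubble_eq_density(2)[OF s N2s' R0] .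
  qed
  then have "(LINT y|lborel. u y * flap s ?f y) = average \<epsilon> x - average R x"
    unfolding average_def using average_integrable[OF R(1)] average_integrable[OF R0] by (simp add: right_diff_distrib)
  moreover have "defect ?f = point_mass * (bubble s \<epsilon> x - bubble s R x)"
    using defect_point_mass[OF m A] by simp
  ultimately show "average \<epsilon> x - average R x = (LINT y|lebesgue. F y * ?f y) + point_mass * (bubble s \<epsilon> x - bubble s R x)"
    unfolding defect_def by simp
qed

definition tiny :: "nat \<Rightarrow> real" where "tiny n = 1 / real (Suc n)"

lemma tiny: "tiny n > 0" "tiny n \<le> 1" "tiny \<longlonglongrightarrow> 0"
proof -
  show "tiny n > 0" "tiny n \<le> 1" by (simp_all add: tiny_def)
  show "tiny \<longlonglongrightarrow> 0" unfolding tiny_def[abs_def] using LIMSEQ_inverse_real_of_nat by (simp add: inverse_eq_divide)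
qed

lemma tiny_mono: "m \<le> n \<Longrightarrow> tiny n \<le> tiny m"
  by (simp add: tiny_def frac_le)

text \<open>At the origin the average at the scale \<open>\<epsilon>\<close>, multiplied by \<open>\<epsilon>\<^sup>N\<^sup>-\<^sup>2\<^sup>s\<close>, tends to a positive multiple
  of the point mass: the integral of \<open>F\<close> against the scaled bubbles tends to zero by dominated
  convergence.\<close>

lemma point_mass_nonneg: "point_mass \<ge> 0"
proof -
  define k where "k = real DIM('a) - 2 * s"
  have k: "k > 0" using N2s by (simp add: k_def)
  define \<rho> where "\<rho> = riesz_const DIM('a) s"
  have \<rho>: "\<rho> > 0" unfolding \<rho>_def by (rule riesz_const_pos[OF s(1) N2s'])
  have kb: "2 * (real DIM('a) / 2 - s) = k" by (simp add: k_def)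
  have b0: "bubble s \<epsilon> (0::'a) = \<rho> * \<epsilon> powr - k" if "\<epsilon> > 0" for \<epsilon>
  proof -
    have "(\<epsilon>\<^sup>2) powr - (real DIM('a) / 2 - s) = \<epsilon> powr - k"
      using sqrt_powr_double[of "\<epsilon>\<^sup>2" "real DIM('a) / 2 - s"] that unfolding kb by simp
    then show ?thesis by (simp add: bubble_def \<rho>_def)
  qed
  \<comment> \<open>The first bound provides the dominating function, the second one the pointwise limit.\<close>
  have bub: "tiny n powr k * bubble s (tiny n) y \<le> \<rho> * (2 powr k * (1 + norm y) powr - k)"
    "tiny n powr k * bubble s (tiny n) y \<le> \<rho> * (tiny n powr k * norm y powr - k)" if "y \<noteq> 0" for n and y :: 'a
  proof -
    let ?q = "(tiny n)\<^sup>2 + (norm y)\<^sup>2"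
    have q: "?q > 0" using tiny(1)[of n] by (simp add: add_pos_nonneg)
    have b: "bubble s (tiny n) y = \<rho> * sqrt ?q powr - k"
      using sqrt_powr_double[OF q, of "real DIM('a) / 2 - s"] unfolding kb by (simp add: bubble_def \<rho>_def)
    have b1: "norm y \<le> sqrt ?q" and b2: "tiny n \<le> sqrt ?q" by (auto intro!: real_le_rsqrt)
    from b1 have "sqrt ?q powr - k \<le> norm y powr - k" using that k by (intro powr_mono2') auto
    then show "tiny n powr k * bubble s (tiny n) y \<le> \<rho> * (tiny n powr k * norm y powr - k)"
      unfolding b using \<rho> by (simp add: mult.left_commute mult_left_mono)
    have "tiny n * (1 + norm y) \<le> tiny n + 1 * norm y"
      unfolding distrib_left using tiny(2)[of n] by (intro add_mono mult_right_mono) auto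
    also have "\<dots> \<le> sqrt ?q + sqrt ?q" using add_mono[OF b2 b1] by (simp only: mult_1)
    finally have "tiny n * (1 + norm y) / 2 \<le> (sqrt ?q + sqrt ?q) / 2" by (rule divide_right_mono) simp
    then have "tiny n * ((1 + norm y) / 2) \<le> sqrt ?q" by simp
    then have "sqrt ?q powr - k \<le> (tiny n * ((1 + norm y) / 2)) powr - k"
      using k tiny(1)[of n] by (intro powr_mono2') auto
    also have "\<dots> = tiny n powr - k * (2 powr k * (1 + norm y) powr - k)"
      unfolding powr_mult[of "tiny n"] by (subst half_powr_minus) auto
    finally have "tiny n powr k * sqrt ?q powr - k \<le> tiny n powr k * (tiny n powr - k * (2 powr k * (1 + norm y) powr - k))"
      by (intro mult_left_mono) auto
    also have "\<dots> = 2 powr k * (1 + norm y) powr - k"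
      using tiny(1)[of n] by (simp add: mult.assoc[symmetric] powr_add[symmetric])
    finally show "tiny n powr k * bubble s (tiny n) y \<le> \<rho> * (2 powr k * (1 + norm y) powr - k)"
      unfolding b using \<rho> by (simp add: mult.left_commute mult_left_mono)
  qed
  let ?f = "\<lambda>n y. tiny n powr k * (bubble s (tiny n) (0 - y) - bubble s 1 (0 - y :: 'a))"
  have fb: "0 \<le> ?f n y \<and> ?f n y \<le> tiny n powr k * bubble s (tiny n) y" for n y
  proof -
    have e: "bubble s \<epsilon> (0 - y) = bubble s \<epsilon> y" for \<epsilon> by (simp add: bubble_def)
    have "bubble s 1 y \<le> bubble s (tiny n) y" by (rule bubble_le[OF tiny(1,2)])
    moreover have "0 \<le> bubble s 1 y" by (rule bubble_nonneg[OF s(1) N2s'])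
    ultimately show ?thesis unfolding e by (auto intro!: mult_left_mono mult_nonneg_nonneg)
  qed
  have tk: "(\<lambda>n. tiny n powr k) \<longlonglongrightarrow> 0"
    by (rule tendsto_zero_powrI[OF tiny(3) tendsto_const _ k]) (simp add: less_imp_le[OF tiny(1)])
  have "(\<lambda>n. LINT y|lebesgue. F y * ?f n y) \<longlonglongrightarrow> (LINT (y::'a)|lebesgue. 0::real)"
  proof (rule integral_dominated_convergence[where w = "\<lambda>y::'a. \<rho> * 2 powr k * \<bar>F y * (1 + norm y) powr - k\<bar>"])
    show "integrable lebesgue (\<lambda>y. \<rho> * 2 powr k * \<bar>F y * (1 + norm y) powr - k\<bar>)"
      using F_int unfolding k_def by simp
    show "AE y in lebesgue. (\<lambda>n. F y * ?f n y) \<longlonglongrightarrow> 0"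
      using AE_lebesgue_ne[of 0]
    proof eventually_elim
      case (elim y)
      have "(\<lambda>n. \<rho> * (tiny n powr k * norm y powr - k)) \<longlonglongrightarrow> \<rho> * (0 * norm y powr - k)"
        by (intro tendsto_intros tk)
      then have up: "(\<lambda>n. \<rho> * (tiny n powr k * norm y powr - k)) \<longlonglongrightarrow> 0" by simp
      have "0 \<le> ?f n y" "?f n y \<le> \<rho> * (tiny n powr k * norm y powr - k)" for n
        by (rule conjunct1[OF fb]) (rule order_trans[OF conjunct2[OF fb] bub(2)[OF elim]])
      then have "(\<lambda>n. ?f n y) \<longlonglongrightarrow> 0"
        by (rule tendsto_sandwich[OF always_eventually[OF allI] always_eventually[OF allI] tendsto_const up])
      then show ?case by (rule tendsto_mult_right_zero)
    qed
    show "AE y in lebesgue. norm (F y * ?f n y) \<le> \<rho> * 2 powr k * \<bar>F y * (1 + norm y) powr - k\<bar>" for n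
      using AE_lebesgue_ne[of 0]
    proof eventually_elim
      case (elim y)
      have "\<bar>?f n y\<bar> \<le> \<rho> * (2 powr k * (1 + norm y) powr - k)"
        unfolding abs_of_nonneg[OF conjunct1[OF fb]] by (rule order_trans[OF conjunct2[OF fb] bub(1)[OF elim]])
      from mult_left_mono[OF this, of "\<bar>F y\<bar>"] show ?case by (simp add: abs_mult mult_ac)
    qed
    show "(\<lambda>y. F y * ?f n y) \<in> borel_measurable lebesgue" for n
      by (intro borel_measurable_times[OF F_measurable] measurable_completion) measurable
  qed simp
  then have L1: "(\<lambda>n. LINT y|lebesgue. F y * ?f n y) \<longlonglongrightarrow> 0" by simp
  have key: "- (tiny n powr k * average 1 0) - (LINT y|lebesgue. F y * ?f n y) \<le> point_mass * \<rho> * (1 - tiny n powr k)" for n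
  proof -
    have "average (tiny n) 0 - average 1 0 = (LINT y|lebesgue. F y * (bubble s (tiny n) (0 - y) - bubble s 1 (0 - y)))
       + point_mass * (bubble s (tiny n) (0::'a) - bubble s 1 (0::'a))"
      by (rule average_identity(2)[OF tiny(1,2)])
    then have "tiny n powr k * (average (tiny n) 0 - average 1 0) = tiny n powr k * (LINT y|lebesgue. F y * (bubble s (tiny n) (0 - y) - bubble s 1 (0 - y)))
       + point_mass * (tiny n powr k * (bubble s (tiny n) (0::'a) - bubble s 1 (0::'a)))"
      by (simp only: distrib_left mult.left_commute)
    moreover have "tiny n powr k * (LINT y|lebesgue. F y * (bubble s (tiny n) (0 - y) - bubble s 1 (0 - y))) = (LINT y|lebesgue. F y * ?f n y)"
      unfolding mult.left_commute[of "F _"] by (rule integral_mult_right_zero[symmetric])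
    moreover have "tiny n powr k * (bubble s (tiny n) (0::'a) - bubble s 1 (0::'a)) = \<rho> * (1 - tiny n powr k)"
    proof -
      have "tiny n powr k * tiny n powr - k = 1" using tiny(1)[of n] by (simp flip: powr_add)
      then show ?thesis unfolding b0[OF tiny(1)] b0[OF zero_less_one] by (simp add: right_diff_distrib mult.left_commute)
    qed
    ultimately have "tiny n powr k * (average (tiny n) 0 - average 1 0)
        = (LINT y|lebesgue. F y * ?f n y) + point_mass * (\<rho> * (1 - tiny n powr k))"
      by (simp only:)
    then have "tiny n powr k * average (tiny n) 0 - tiny n powr k * average 1 0
        = (LINT y|lebesgue. F y * ?f n y) + point_mass * \<rho> * (1 - tiny n powr k)"
      by (simp only: right_diff_distrib[of "tiny n powr k"] mult.assoc)
    moreover have "0 \<le> tiny n powr k * average (tiny n) 0" by (intro mult_nonneg_nonneg average_nonneg) auto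
    ultimately show ?thesis by argo
  qed
  have L2: "(\<lambda>n. - (tiny n powr k * average 1 0) - (LINT y|lebesgue. F y * ?f n y)) \<longlonglongrightarrow> - (0 * average 1 0) - 0"
    by (intro tendsto_intros tk L1)
  have L3: "(\<lambda>n. point_mass * \<rho> * (1 - tiny n powr k)) \<longlonglongrightarrow> point_mass * \<rho> * (1 - 0)"
    by (intro tendsto_intros tk)
  have "- (0 * average 1 0) - 0 \<le> point_mass * \<rho> * (1 - 0)"
    by (rule LIMSEQ_le[OF L2 L3]) (use key in blast)
  then show ?thesis using \<rho> by (simp add: zero_le_mult_iff)
qed

text \<open>The test kernel between the scales \<open>1/(n+1)\<close> and \<open>n+1\<close>; it increases to the fundamental solution.\<close>

definition green :: "nat \<Rightarrow> 'a \<Rightarrow> real" where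
  "green n x = bubble s (tiny n) x - bubble s (real (Suc n)) x"

lemma green_props:
  shows green_nonneg: "0 \<le> green n x" and green_mono: "m \<le> n \<Longrightarrow> green m x \<le> green n x"
    and green_tendsto: "x \<noteq> 0 \<Longrightarrow> (\<lambda>n. green n x) \<longlonglongrightarrow> fund_sol s x"
proof -
  have le: "tiny n \<le> real (Suc n)" using tiny(2)[of n] by simp
  show "0 \<le> green n x" unfolding green_def using bubble_le[OF tiny(1) le] by simp
  show "green m x \<le> green n x" if "m \<le> n"
    unfolding green_def using bubble_le[OF tiny(1) tiny_mono[OF that], of x] bubble_le[of "real (Suc m)" "real (Suc n)" x] that by simp
  show "(\<lambda>n. green n x) \<longlonglongrightarrow> fund_sol s x" if x: "x \<noteq> 0"
  proof -
    let ?b = "real DIM('a) / 2 - s"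
    have b: "?b > 0" using N2s by simp
    have nx: "norm x > 0" using x by simp
    have "(\<lambda>n. riesz_const DIM('a) s * ((tiny n)\<^sup>2 + (norm x)\<^sup>2) powr - ?b) \<longlonglongrightarrow> riesz_const DIM('a) s * (0\<^sup>2 + (norm x)\<^sup>2) powr - ?b"
      using nx by (intro tendsto_intros tiny(3)) auto
    moreover have "riesz_const DIM('a) s * (0\<^sup>2 + (norm x)\<^sup>2) powr - ?b = fund_sol s x"
      using sqrt_powr_double[of "(norm x)\<^sup>2" ?b] nx by (simp add: fund_sol_def)
    ultimately have 1: "(\<lambda>n. bubble s (tiny n) x) \<longlonglongrightarrow> fund_sol s x" by (simp add: bubble_def)
    have "filterlim (\<lambda>n. (real (Suc n))\<^sup>2 + (norm x)\<^sup>2) at_top sequentially"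
    proof (rule filterlim_at_top_mono[OF filterlim_real_sequentially], rule always_eventually, rule allI)
      fix n
      have "real n \<le> 1 * real (Suc n)" by simp
      also have "\<dots> \<le> real (Suc n) * real (Suc n)" by (intro mult_right_mono) auto
      finally have "real n \<le> (real (Suc n))\<^sup>2" by (simp only: power2_eq_square)
      then show "real n \<le> (real (Suc n))\<^sup>2 + (norm x)\<^sup>2" using zero_le_power2[of "norm x"] by linarith
    qed
    then have "(\<lambda>n. ((real (Suc n))\<^sup>2 + (norm x)\<^sup>2) powr - ?b) \<longlonglongrightarrow> 0"
      using b by (intro tendsto_neg_powr) auto
    then have "(\<lambda>n. riesz_const DIM('a) s * ((real (Suc n))\<^sup>2 + (norm x)\<^sup>2) powr - ?b) \<longlonglongrightarrow> riesz_const DIM('a) s * 0"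
      by (intro tendsto_intros)
    then have 2: "(\<lambda>n. bubble s (real (Suc n)) x) \<longlonglongrightarrow> 0" by (simp add: bubble_def)
    show ?thesis using tendsto_diff[OF 1 2] by (simp add: green_def)
  qed
qed

lemma average_green:
  "average (tiny n) x = average (real (Suc n)) x + (LINT y|lebesgue. F y * green n (x - y)) + point_mass * green n x"
  "integrable lebesgue (\<lambda>y. F y * green n (x - y))"
proof -
  have le: "tiny n \<le> real (Suc n)" using tiny(2)[of n] by simp
  show "average (tiny n) x = average (real (Suc n)) x + (LINT y|lebesgue. F y * green n (x - y)) + point_mass * green n x"
    "integrable lebesgue (\<lambda>y. F y * green n (x - y))"
    using average_identity[OF tiny(1) le, of x] by (simp_all add: green_def)
qed

text \<open>Monotone convergence. The integrals are bounded by the averages at small scales, since both the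
  average at the large scale and the point mass are nonnegative, and the averages converge to \<open>u x\<close>.\<close>

lemma riesz_potential_limit:
  assumes x: "x \<noteq> 0"
  shows "integrable lebesgue (\<lambda>y. F y * fund_sol s (x - y))"
    and "(\<lambda>n. LINT y|lebesgue. F y * green n (x - y)) \<longlonglongrightarrow> (LINT y|lebesgue. F y * fund_sol s (x - y))"
proof -
  let ?I = "\<lambda>n. LINT y|lebesgue. F y * green n (x - y)"
  have cont: "isCont u x" using u_cont x by (simp add: continuous_on_eq_continuous_at open_Compl)
  have lim: "(\<lambda>n. average (tiny n) x) \<longlonglongrightarrow> u x"
    unfolding average_def by (rule bubble_density_tendsto[OF s(1) u cont tiny(1,3)])
  then obtain B where B: "\<And>n. average (tiny n) x \<le> B"
    using convergent_imp_Bseq[OF convergentI[OF lim]] by (metis Bseq_def abs_le_D1 real_norm_def)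
  have mono: "AE y in lebesgue. mono (\<lambda>n. F y * green n (x - y))"
    using AE_lebesgue_ne[of 0] by eventually_elim (auto intro!: monoI mult_left_mono green_mono F_nonneg)
  have inc: "incseq ?I"
  proof (rule incseq_SucI)
    fix n
    show "?I n \<le> ?I (Suc n)"
      by (rule integral_mono_AE[OF average_green(2) average_green(2)])
         (use mono in eventually_elim, simp add: mono_def)
  qed
  have bd: "?I n \<le> B" for n
    using average_green(1)[of n x] average_nonneg[of "real (Suc n)" x] B[of n]
      mult_nonneg_nonneg[OF point_mass_nonneg green_nonneg[of n x]] by simp
  obtain L where L: "?I \<longlonglongrightarrow> L" using incseq_convergent[OF inc, of B] bd by blast
  have ptw: "AE y in lebesgue. (\<lambda>n. F y * green n (x - y)) \<longlonglongrightarrow> F y * fund_sol s (x - y)"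
    using AE_lebesgue_ne[of x] by eventually_elim (intro tendsto_mult_left green_tendsto, simp)
  have m: "(\<lambda>y. F y * fund_sol s (x - y)) \<in> borel_measurable lebesgue"
    unfolding fund_sol_def by (intro borel_measurable_times[OF F_measurable] measurable_completion) measurable
  show "integrable lebesgue (\<lambda>y. F y * fund_sol s (x - y))"
    by (rule integrable_monotone_convergence[OF average_green(2) mono ptw L m])
  have "(LINT y|lebesgue. F y * fund_sol s (x - y)) = L"
    by (rule integral_monotone_convergence[OF average_green(2) mono ptw L m])
  then show "?I \<longlonglongrightarrow> (LINT y|lebesgue. F y * fund_sol s (x - y))" using L by simp
qed

lemma average_tendsto:
  assumes x: "x \<noteq> 0"
  shows "(\<lambda>n. average (real (Suc n)) x) \<longlonglongrightarrow> u x - (LINT y|lebesgue. F y * fund_sol s (x - y)) - point_mass * fund_sol s x"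
proof -
  have cont: "isCont u x" using u_cont x by (simp add: continuous_on_eq_continuous_at open_Compl)
  have "(\<lambda>n. average (tiny n) x) \<longlonglongrightarrow> u x"
    unfolding average_def by (rule bubble_density_tendsto[OF s(1) u cont tiny(1,3)])
  then have "(\<lambda>n. average (tiny n) x - (LINT y|lebesgue. F y * green n (x - y)) - point_mass * green n x)
      \<longlonglongrightarrow> u x - (LINT y|lebesgue. F y * fund_sol s (x - y)) - point_mass * fund_sol s x"
    by (intro tendsto_intros riesz_potential_limit(2)[OF x] green_tendsto[OF x])
  then show ?thesis using average_green(1)[of _ x] by simp
qed

lemma average_shift:
  assumes "R > 0"
  shows "average R x0 \<le> (1 + norm (x0 - x1) / R) powr (real DIM('a) + 2 * s) * average R x1"
proof -
  have "average R x0 \<le> (LINT y|lborel. (1 + norm (x0 - x1) / R) powr (real DIM('a) + 2 * s) * (u y * bubble_density s R (x1 - y)))"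
    unfolding average_def
  proof (rule integral_mono_AE)
    show "AE y in lborel. u y * bubble_density s R (x0 - y) \<le> (1 + norm (x0 - x1) / R) powr (real DIM('a) + 2 * s) * (u y * bubble_density s R (x1 - y))"
      using AE_lborel_singleton[of "0::'a"]
    proof eventually_elim
      case (elim y)
      show ?case
        using mult_left_mono[OF bubble_density_shift_le[OF s(1) assms, of x0 y x1] less_imp_le[OF u_pos[OF elim]]]
        by (simp only: mult.left_commute)
    qed
  qed (intro integrable_mult_right average_integrable assms)+
  then show ?thesis by (simp add: average_def)
qed

text \<open>The remainder \<open>h\<close> is the limit of averages at large scales. These agree in the limit for any two
  centres, and they are nonnegative.\<close>

theorem representation_up_to_constant:
  obtains c where "c \<ge> 0"
    "\<And>x. x \<noteq> 0 \<Longrightarrow> u x = (LINT y|lebesgue. F y * fund_sol s (x - y)) + point_mass * fund_sol s x + c"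
proof -
  define h where "h x = u x - (LINT y|lebesgue. F y * fund_sol s (x - y)) - point_mass * fund_sol s x" for x
  have lim: "(\<lambda>n. average (real (Suc n)) x) \<longlonglongrightarrow> h x" if "x \<noteq> 0" for x
    unfolding h_def by (rule average_tendsto[OF that])
  have le: "h x0 \<le> h x1" if x: "x0 \<noteq> 0" "x1 \<noteq> 0" for x0 x1
  proof -
    have "(\<lambda>n. norm (x0 - x1) * tiny n) \<longlonglongrightarrow> norm (x0 - x1) * 0" by (intro tendsto_intros tiny(3))
    then have "(\<lambda>n. (1 + norm (x0 - x1) / real (Suc n)) powr (real DIM('a) + 2 * s)) \<longlonglongrightarrow> (1 + norm (x0 - x1) * 0) powr (real DIM('a) + 2 * s)"
      by (intro tendsto_intros) (simp_all add: tiny_def)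
    then have "(\<lambda>n. (1 + norm (x0 - x1) / real (Suc n)) powr (real DIM('a) + 2 * s) * average (real (Suc n)) x1) \<longlonglongrightarrow> (1 + norm (x0 - x1) * 0) powr (real DIM('a) + 2 * s) * h x1"
      by (intro tendsto_mult lim x)
    then have L: "(\<lambda>n. (1 + norm (x0 - x1) / real (Suc n)) powr (real DIM('a) + 2 * s) * average (real (Suc n)) x1) \<longlonglongrightarrow> h x1" by simp
    show ?thesis
      by (rule LIMSEQ_le[OF lim[OF x(1)] L]) (intro exI[of _ 0] allI impI average_shift, simp)
  qed
  have "\<exists>x0::'a. x0 \<noteq> 0" using nonempty_Basis nonzero_Basis by blast
  then obtain x0 :: 'a where x0: "x0 \<noteq> 0" by blast
  have "h x0 \<ge> 0" by (rule LIMSEQ_le_const[OF lim[OF x0]]) (use average_nonneg in blast)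
  moreover have "u x = (LINT y|lebesgue. F y * fund_sol s (x - y)) + point_mass * fund_sol s x + h x0" if "x \<noteq> 0" for x
    using le[OF that x0] le[OF x0 that] unfolding h_def by linarith
  ultimately show ?thesis using that by blast
qed

lemma fund_sol_nonneg: "fund_sol s (x :: 'a) \<ge> 0"
  unfolding fund_sol_def using riesz_const_pos[OF s(1) N2s'] by (intro mult_nonneg_nonneg) auto

lemma potential_nonneg: "(LINT y|lebesgue. F y * fund_sol s (x - y)) \<ge> 0"
proof (rule integral_nonneg_AE)
  show "AE y in lebesgue. 0 \<le> F y * fund_sol s (x - y)"
    using AE_lebesgue_ne[of 0] by eventually_elim (intro mult_nonneg_nonneg F_nonneg fund_sol_nonneg)
qed

end

text \<open>The integral over the ball of radius \<open>R\<close> around \<open>x\<close> is at least of the order \<open>R\<^sup>N\<^sup>-\<^sup>\<mu>\<close>.\<close>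

lemma not_integrable_norm_powr:
  fixes x :: "'a::euclidean_space"
  assumes \<mu>: "0 < \<mu>" "\<mu> < real DIM('a)" and c: "c > 0"
    and le: "\<And>y. y \<noteq> 0 \<Longrightarrow> c / norm (x - y) powr \<mu> \<le> g y"
  shows "\<not> set_integrable lebesgue (- {0}) g"
proof
  assume "set_integrable lebesgue (- {0}) g"
  then have g: "integrable lebesgue (\<lambda>y. indicator (- {0}) y * g y)" by (simp add: set_integrable_def)
  let ?N = "real DIM('a)"
  define J where "J = (LINT y|lebesgue. indicator (- {0}) y * g y)"
  define V where "V = c * (unit_ball_vol ?N * ?N / (?N - \<mu>))"
  have V: "V > 0" using c \<mu> by (simp add: V_def)
  have "V * R powr (?N - \<mu>) \<le> J" if R: "R > 0" for R
  proof -
    have hb: "has_bochner_integral lborel (\<lambda>z::'a. c * (indicator (cball 0 R) z * norm z powr - \<mu>)) (V * R powr (?N - \<mu>))"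
      unfolding V_def mult.assoc using integral_norm_powr_cball[where 'a = 'a, OF \<mu>(2), of R] R
      by (intro has_bochner_integral_mult_right) auto
    then have hb': "has_bochner_integral lborel (\<lambda>y::'a. c * (indicator (cball 0 R) (x - y) * norm (x - y) powr - \<mu>)) (V * R powr (?N - \<mu>))"
      using has_bochner_integral_reflect[of "\<lambda>z. c * (indicator (cball 0 R) z * norm z powr - \<mu>)" x] by simp
    then have i: "integrable lebesgue (\<lambda>y::'a. c * (indicator (cball 0 R) (x - y) * norm (x - y) powr - \<mu>))"
      and e: "(LINT y|lebesgue. c * (indicator (cball 0 R) (x - y) * norm (x - y) powr - \<mu>)) = V * R powr (?N - \<mu>)"
      by (auto simp: has_bochner_integral_iff integrable_completion integral_completion)
    have "(LINT y|lebesgue. c * (indicator (cball 0 R) (x - y) * norm (x - y) powr - \<mu>)) \<le> J"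
      unfolding J_def
    proof (rule integral_mono_AE[OF i g])
      have "AE y in lebesgue. y \<noteq> (0::'a)" using AE_lborel_singleton[of 0] by (rule AE_completion)
      then show "AE y in lebesgue. c * (indicator (cball 0 R) (x - y) * norm (x - y) powr - \<mu>) \<le> indicator (- {0}) y * g y"
      proof eventually_elim
        case (elim y)
        have "c * (indicator (cball 0 R) (x - y) * norm (x - y) powr - \<mu>) \<le> c * (1 * norm (x - y) powr - \<mu>)"
          using c by (intro mult_left_mono mult_right_mono) (auto simp: indicator_def)
        also have "\<dots> = c / norm (x - y) powr \<mu>" by (simp add: powr_minus divide_inverse)
        also have "\<dots> \<le> g y" by (rule le[OF elim])
        finally show ?case using elim by simp
      qed
    qed
    then show ?thesis unfolding e .
  qed
  note bd = this
  have J: "J > 0" using bd[of 1] V by simp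
  \<comment> \<open>With this radius the lower bound \<open>V R\<^sup>N\<^sup>-\<^sup>\<mu>\<close> is twice the total integral.\<close>
  define R where "R = (2 * J / V) powr (1 / (?N - \<mu>))"
  have "R > 0" using J V by (simp add: R_def)
  moreover have "R powr (?N - \<mu>) = 2 * J / V" using J V \<mu> by (simp add: R_def powr_powr)
  ultimately have "V * (2 * J / V) \<le> J" using bd[of R] by simp
  then show False using V J by simp
qed

theorem theorem1p1:
  fixes u F :: "'a::euclidean_space \<Rightarrow> real" and s \<mu> p q :: real
  assumes "0 < s" "s < 1" "real DIM('a) > 2 * s"
    and "0 < \<mu>" "\<mu> < real DIM('a)" "p > 0" "q > 0"
    and "positive_punctured_solution s \<mu> p q u"
    and "\<And>x. x \<noteq> 0 \<Longrightarrow> F x = choquard p \<mu> u x * u x powr q"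
    and "integrable lebesgue (\<lambda>y. F y / (1 + norm y powr (real DIM('a) - 2 * s)))"
    and "Limsup (at 0) (\<lambda>x. ereal (norm x powr (real DIM('a) - 2 * s) * u x)) < \<infinity>"
  shows "(\<forall>x. x \<noteq> 0 \<longrightarrow>
            integrable lebesgue (\<lambda>y. F y / norm (x - y) powr (real DIM('a) - 2 * s))) \<and>
         (\<exists>m\<ge>0. (\<forall>x. x \<noteq> 0 \<longrightarrow> u x = riesz_potential s F x + m * fund_sol s x) \<and>
            (\<forall>\<phi>. test_function \<phi> \<longrightarrow>
               frac_lap_distr s u \<phi> = (LINT x|lebesgue. F x * \<phi> x) + m * \<phi> 0))"
proof -
  note s = assms(1,2) and N2s = assms(3) and \<mu> = assms(4,5) and p = assms(6)
  let ?k = "real DIM('a) - 2 * s"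
  obtain \<beta> where Ls: "u \<in> Ls_space s" and \<beta>: "\<beta> > 0" "2 * s + \<beta> \<notin> \<nat>" "Holder_loc (2 * s + \<beta>) (- {0}) u"
    and pos: "\<And>x. x \<noteq> 0 \<Longrightarrow> u x > 0" and fin: "\<And>x. x \<noteq> 0 \<Longrightarrow> choquard_finite p \<mu> u x"
    and lap: "\<And>x. x \<noteq> 0 \<Longrightarrow> has_frac_lap s u x (choquard p \<mu> u x * u x powr q)"
    using assms(8) unfolding positive_punctured_solution_def by blast
  have op: "open (- {0::'a})" by (simp add: open_Compl)
  have cont: "continuous_on (- {0}) u"
  proof (rule Ck_Holder_loc_imp_continuous_on[OF op])
    have "2 * s + \<beta> \<notin> \<int>" using \<beta> s by (auto simp: Nats_altdef2)
    then show "0 < frac (2 * s + \<beta>)" by (simp add: frac_gt_0_iff)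
    show "Ck_Holder_loc (nat \<lfloor>2 * s + \<beta>\<rfloor>) (frac (2 * s + \<beta>)) (- {0}) u" using \<beta>(3) by (simp add: Holder_loc_def)
  qed
  have Fi: "integrable lebesgue (\<lambda>y. F y * (1 + norm y) powr - ?k)"
  proof (rule integrable_dominated)
    show i: "integrable lebesgue (\<lambda>y. 2 * \<bar>F y / (1 + norm y powr ?k)\<bar>)"
      by (intro integrable_mult_right integrable_abs assms(10))
    have "(\<lambda>y. F y / (1 + norm y powr ?k) * ((1 + norm y powr ?k) * (1 + norm y) powr - ?k)) \<in> borel_measurable lebesgue"
      by (rule borel_measurable_times[OF borel_measurable_integrable[OF assms(10)]]) (intro measurable_completion, simp)
    moreover have "F y / (1 + norm y powr ?k) * ((1 + norm y powr ?k) * (1 + norm y) powr - ?k) = F y * (1 + norm y) powr - ?k" for y :: 'a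
    proof -
      have "1 + norm y powr ?k > 0" by (intro add_pos_nonneg) auto
      then show ?thesis by simp
    qed
    ultimately show "(\<lambda>y. F y * (1 + norm y) powr - ?k) \<in> borel_measurable lebesgue" by simp
    fix y :: 'a
    have "\<bar>F y\<bar> * (1 + norm y) powr - ?k \<le> \<bar>F y\<bar> * (2 / (1 + norm y powr ?k))"
      using powr_bracket_le[of ?k "norm y"] N2s by (intro mult_left_mono) auto
    moreover have "1 + norm y powr ?k > 0" by (intro add_pos_nonneg) auto
    ultimately show "\<bar>F y * (1 + norm y) powr - ?k\<bar> \<le> 2 * \<bar>F y / (1 + norm y powr ?k)\<bar>"
      by (simp add: abs_mult mult.commute[of 2])
  qed
  have ub: "\<exists>C r. 0 < r \<and> (\<forall>x. x \<noteq> 0 \<longrightarrow> norm x \<le> r \<longrightarrow> \<bar>u x\<bar> \<le> C * norm x powr - ?k)"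
  proof -
    obtain n :: nat where "Limsup (at 0) (\<lambda>x. ereal (norm x powr ?k * u x)) < ereal (real n)"
      using assms(11) less_PInf_Ex_of_nat[of "Limsup (at 0) (\<lambda>x. ereal (norm x powr ?k * u x))"] by auto
    then have "eventually (\<lambda>x. ereal (norm x powr ?k * u x) < ereal (real n)) (at 0)" by (rule Limsup_lessD)
    then obtain d where d: "d > 0" "\<And>x. x \<noteq> 0 \<Longrightarrow> norm x < d \<Longrightarrow> norm x powr ?k * u x < real n"
      unfolding eventually_at by (auto simp: dist_norm)
    have "\<bar>u x\<bar> \<le> real n * norm x powr - ?k" if x: "x \<noteq> 0" "norm x \<le> d / 2" for x
    proof -
      have "norm x powr ?k * u x \<le> real n" using d x by (intro less_imp_le d(2)) auto
      then have "norm x powr - ?k * (norm x powr ?k * u x) \<le> norm x powr - ?k * real n" by (intro mult_left_mono) auto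
      moreover have "norm x powr - ?k * norm x powr ?k = 1" using x by (simp flip: powr_add)
      ultimately have "u x \<le> norm x powr - ?k * real n" by (simp only: mult.assoc[symmetric] mult_1)
      then show ?thesis using pos[OF x(1)] by (simp add: mult.commute)
    qed
    then show ?thesis using d(1) by (intro exI[of _ "real n"] exI[of _ "d / 2"]) auto
  qed
  have reg: "\<exists>\<gamma>>2 * s. \<exists>r>0. \<exists>B\<ge>0. \<forall>x\<in>K. \<forall>z. norm z \<le> r \<longrightarrow> \<bar>diff2 u x z\<bar> \<le> B * norm z powr \<gamma>"
    if K: "compact K" "K \<subseteq> - {0}" for K
  proof (rule Holder_loc_imp_diff2_bound[OF op K \<beta>(3), of "2 * s"])
    fix \<gamma> r B assume *: "2 * s < \<gamma>" "0 < r" "0 \<le> B" "\<And>x z. x \<in> K \<Longrightarrow> norm z \<le> r \<Longrightarrow> \<bar>diff2 u x z\<bar> \<le> B * norm z powr \<gamma>"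
    show ?thesis
      by (rule exI[of _ \<gamma>], rule conjI[OF *(1)], rule exI[of _ r], rule conjI[OF *(2)], rule exI[of _ B], rule conjI[OF *(3)]) (use *(4) in blast)
  qed (use \<beta> s in auto)
  have Fn: "F x \<ge> 0" if "x \<noteq> 0" for x
  proof -
    have "choquard p \<mu> u x \<ge> 0" unfolding choquard_def set_lebesgue_integral_def
      by (intro integral_nonneg_AE AE_I2) auto
    then show ?thesis unfolding assms(9)[OF that] by simp
  qed
  interpret positive_punctured_equation s "real DIM('a) + 2 - 2 * s" u F
    by unfold_locales
       (use s N2s Ls_space_imp_tempered[OF s(1) Ls cont] cont reg lap assms(9) Fi ub pos Fn in auto)
  obtain c where c: "c \<ge> 0"
    and rep: "\<And>x. x \<noteq> 0 \<Longrightarrow> u x = (LINT y|lebesgue. F y * fund_sol s (x - y)) + point_mass * fund_sol s x + c"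
    using representation_up_to_constant by blast
  \<comment> \<open>A positive constant would bound \<open>u\<close> from below and make the Choquard potential infinite.\<close>
  have c0: "c = 0"
  proof (rule ccontr)
    assume "c \<noteq> 0"
    with c have c: "c > 0" by simp
    obtain x1 :: 'a where x1: "x1 \<noteq> 0" using nonempty_Basis nonzero_Basis by blast
    have "\<not> set_integrable lebesgue (- {0}) (\<lambda>y. u y powr p / norm (x1 - y) powr \<mu>)"
    proof (rule not_integrable_norm_powr[OF \<mu>, of "c powr p"])
      fix y :: 'a assume y: "y \<noteq> 0"
      have "c \<le> u y" unfolding rep[OF y]
        using potential_nonneg[of y] mult_nonneg_nonneg[OF point_mass_nonneg fund_sol_nonneg[of y]] by linarith
      then show "c powr p / norm (x1 - y) powr \<mu> \<le> u y powr p / norm (x1 - y) powr \<mu>"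
        using c p by (intro divide_right_mono powr_mono2) auto
    qed (use c in simp)
    then show False using fin[OF x1] by (simp add: choquard_finite_def)
  qed
  have \<rho>: "riesz_const DIM('a) s > 0" using s N2s by (intro riesz_const_pos) auto
  have fs: "F y * fund_sol s (x - y) = riesz_const DIM('a) s * (F y / norm (x - y) powr ?k)" for x y :: 'a
    unfolding fund_sol_def powr_minus divide_inverse by (simp only: mult.left_commute)
  have pot: "(LINT y|lebesgue. F y * fund_sol s (x - y)) = riesz_potential s F x" for x
    unfolding fs riesz_potential_def by (rule integral_mult_right_zero)
  have int: "integrable lebesgue (\<lambda>y. F y / norm (x - y) powr ?k)" if "x \<noteq> 0" for x
    using integrable_mult_right[OF riesz_potential_limit(1)[OF that, unfolded fs], of "1 / riesz_const DIM('a) s"] \<rho> by simp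
  have distr: "frac_lap_distr s u \<phi> = (LINT x|lebesgue. F x * \<phi> x) + point_mass * \<phi> 0" if \<phi>: "test_function \<phi>" for \<phi>
  proof -
    obtain A where A: "symbol_bound (real DIM('a) + 2 - 2 * s) A \<phi>" and m[measurable]: "\<phi> \<in> borel_measurable borel"
      using test_function_symbol_bound[OF \<phi> dec(2)] by blast
    have "tempered s \<phi>"
      unfolding tempered_def
    proof (rule conjI[OF m], rule integrable_dominated)
      show "integrable lborel (\<lambda>y::'a. A * (1 + norm y) powr - (real DIM('a) + 2 * s))"
        using s by (intro integrable_mult_right integrable_bracket_powr) auto
      fix y :: 'a
      have "(1 + norm y) powr - (real DIM('a) + 2 - 2 * s) \<le> (1 + norm y) powr 0" using dec(2) by (intro powr_mono) auto
      then have "A * (1 + norm y) powr - (real DIM('a) + 2 - 2 * s) \<le> A * (1 + norm y) powr 0"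
        using symbol_bound_nonneg[OF A] by (intro mult_left_mono) auto
      then have "\<bar>\<phi> y\<bar> \<le> A" using order_trans[OF symbol_boundD(1)[OF A, of y]] by simp
      then show "\<bar>(1 + norm y) powr - (real DIM('a) + 2 * s) * \<phi> y\<bar> \<le> A * (1 + norm y) powr - (real DIM('a) + 2 * s)"
        by (simp add: abs_mult mult.commute mult_right_mono)
    qed measurable
    then have fl: "frac_lap s \<phi> x = flap s \<phi> x" for x
      by (rule frac_lap_eq_flap[OF s(1) _ symbol_levy_integrable[OF m A]])
    have "frac_lap_distr s u \<phi> = (LINT x|lborel. u x * flap s \<phi> x)"
      unfolding frac_lap_distr_def fl by (rule integral_completion) measurable
    then show ?thesis using defect_point_mass[OF m A] unfolding defect_def by simp
  qed
  show ?thesis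
    using int rep point_mass_nonneg distr unfolding c0 pot by auto
qed

end
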